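(* Let $(Q,\mathfrak{n},k)$ be a local ring, $x\in\mathfrak{n}$ a non-zerodivisor of $Q$, and $R=Q/(x)$. Let $M$ be a finitely generated non-zero $R$-module, and assume that $N$ is an $R$-module which is pre-rigid of degree $r$ with respect to $M$ and $Q$. If $\operatorname{Tor}_n^R(M,N)=0$ for some $n>r$, then $\operatorname{Tor}^Q_{n-2i}(M,N)=0$ for all $i$ with $n\ge n-2i > r$. If moreover $r=0$, then $\operatorname{Tor}^Q_{n-2i}(M,N)=0$ for all $i\ge 0$.
   Context: "Local ring" means commutative Noetherian local ring. Higher homotopies: let $F$ be a $Q$-free resolution of $M$. A system of higher homotopies on $F$ is a family $\{\sigma_i\}_{i\ge 0}$ where each $\sigma_i$ is a degree $2i-1$ endomorphism of $F$ as a graded $Q$-module, with $\sigma_0=\partial^F$ (the differential of $F$), $\sigma_0\sigma_1+\sigma_1\sigma_0=x\operatorname{Id}_F$, and $\sum_{i+j=n}\sigma_i\sigma_j=0$ for $n>1$. The component of $\sigma_i$ from $F_j$ to $F_{j+2i-1}$ is denoted $(\sigma_i)_j$. Pre-rigidity: an $R$-module $N$ is pre-rigid of degree $r$ with respect to $M$ and $Q$ if there exist a $Q$-free resolution $F$ of $M$ and a system of higher homotopies $\{\sigma_i\}_{i\ge 0}$ on $F$ such that the induced maps $(\sigma_i)_j\otimes_Q N: F_j\otimes_Q N \to F_{j+2i-1}\otimes_Q N$ are zero for all $j>r-(2i-1)$ and all $i\ge 1$. *)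

theory Defs
  imports "HOL-Algebra.QuotRing" "HOL-Algebra.Ring_Divisibility" "Jordan_Normal_Form.Missing_VectorSpace"
begin

section \<open>Rings and modules\<close>

locale local_ring = cring Q + noetherian_ring Q for Q (structure) and \<nn> +
  assumes maximal: "maximalideal \<nn> Q"
    and unique: "maximalideal J Q \<Longrightarrow> J = \<nn>"

definition nonzerodivisor :: "('a, 'c) ring_scheme \<Rightarrow> 'a \<Rightarrow> bool" where
  "nonzerodivisor Q x \<longleftrightarrow>
     x \<in> carrier Q \<and> (\<forall>a\<in>carrier Q. a \<otimes>\<^bsub>Q\<^esub> x = \<zero>\<^bsub>Q\<^esub> \<longrightarrow> a = \<zero>\<^bsub>Q\<^esub>)"

definition zero_module :: "('a, 'm, 'c) module_scheme \<Rightarrow> bool" where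
  "zero_module M \<longleftrightarrow> carrier M = {\<zero>\<^bsub>M\<^esub>}"

definition fg_module :: "('a, 'c) ring_scheme \<Rightarrow> ('a, 'm, 'd) module_scheme \<Rightarrow> bool" where
  "fg_module R M \<longleftrightarrow> module R M \<and>
     (\<exists>A. finite A \<and> A \<subseteq> carrier M \<and> module.span R M A = carrier M)"

definition free_module :: "('a, 'c) ring_scheme \<Rightarrow> ('a, 'm, 'd) module_scheme \<Rightarrow> bool" where
  "free_module R M \<longleftrightarrow> module R M \<and>
     (\<exists>B. B \<subseteq> carrier M \<and> \<not> module.lin_dep R M B \<and> module.span R M B = carrier M)"

text \<open>The fields \<^const>\<open>monoid.mult\<close> and \<^const>\<open>monoid.one\<close> of a module record carry no meaning; the
  constructions below fill them arbitrarily.\<close>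

definition restrict_scalars :: "('a \<Rightarrow> 'b) \<Rightarrow> ('b, 'm) module \<Rightarrow> ('a, 'm) module" where
  "restrict_scalars \<phi> M =
     \<lparr>carrier = carrier M, monoid.mult = monoid.mult M, one = one M, zero = zero M, add = add M,
      smult = (\<lambda>a m. \<phi> a \<odot>\<^bsub>M\<^esub> m)\<rparr>"

definition quotient_module :: "('a, 'm, 'd) module_scheme \<Rightarrow> 'm set \<Rightarrow> ('a, 'm set) module" where
  "quotient_module M K =
     \<lparr>carrier = a_rcosets\<^bsub>M\<^esub> K, monoid.mult = (\<lambda>_ _. K), one = K, zero = K, add = set_add M,
      smult = (\<lambda>a X. \<Union>m\<in>X. K +>\<^bsub>M\<^esub> (a \<odot>\<^bsub>M\<^esub> m))\<rparr>"

text \<open>The free module on a set \<open>B\<close>: finitely supported functions, with support in \<open>B\<close>.\<close>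

definition free_on :: "('a, 'c) ring_scheme \<Rightarrow> 'b set \<Rightarrow> ('a, 'b \<Rightarrow> 'a) module" where
  "free_on R B =
     \<lparr>carrier = {c. range c \<subseteq> carrier R \<and> finite {b. c b \<noteq> \<zero>\<^bsub>R\<^esub>} \<and> {b. c b \<noteq> \<zero>\<^bsub>R\<^esub>} \<subseteq> B},
      monoid.mult = (\<lambda>_ _ _. \<zero>\<^bsub>R\<^esub>), one = (\<lambda>_. \<zero>\<^bsub>R\<^esub>),
      zero = (\<lambda>_. \<zero>\<^bsub>R\<^esub>), add = (\<lambda>c c' b. c b \<oplus>\<^bsub>R\<^esub> c' b),
      smult = (\<lambda>a c b. a \<otimes>\<^bsub>R\<^esub> c b)\<rparr>"

definition unit_vec :: "('a, 'c) ring_scheme \<Rightarrow> 'b \<Rightarrow> 'b \<Rightarrow> 'a" where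
  "unit_vec R b = (\<lambda>b'. if b' = b then \<one>\<^bsub>R\<^esub> else \<zero>\<^bsub>R\<^esub>)"

definition lin_ext ::
    "('a, 'c) ring_scheme \<Rightarrow> ('a, 'm, 'd) module_scheme \<Rightarrow> ('b \<Rightarrow> 'm) \<Rightarrow> ('b \<Rightarrow> 'a) \<Rightarrow> 'm" where
  "lin_ext R M g c = (\<Oplus>\<^bsub>M\<^esub>b\<in>{b. c b \<noteq> \<zero>\<^bsub>R\<^esub>}. c b \<odot>\<^bsub>M\<^esub> g b)"


section \<open>Tensor products\<close>

definition tensor_relations ::
    "('a, 'c) ring_scheme \<Rightarrow> ('a, 'm, 'd) module_scheme \<Rightarrow> ('a, 'n, 'e) module_scheme
     \<Rightarrow> ('m \<times> 'n \<Rightarrow> 'a) set" where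
  "tensor_relations R M N =
     (let F = free_on R (carrier M \<times> carrier N); e = unit_vec R in
        {e (m \<oplus>\<^bsub>M\<^esub> m', n) \<ominus>\<^bsub>F\<^esub> (e (m, n) \<oplus>\<^bsub>F\<^esub> e (m', n)) | m m' n.
           m \<in> carrier M \<and> m' \<in> carrier M \<and> n \<in> carrier N} \<union>
        {e (m, n \<oplus>\<^bsub>N\<^esub> n') \<ominus>\<^bsub>F\<^esub> (e (m, n) \<oplus>\<^bsub>F\<^esub> e (m, n')) | m n n'.
           m \<in> carrier M \<and> n \<in> carrier N \<and> n' \<in> carrier N} \<union>
        {e (a \<odot>\<^bsub>M\<^esub> m, n) \<ominus>\<^bsub>F\<^esub> a \<odot>\<^bsub>F\<^esub> e (m, n) | a m n.
           a \<in> carrier R \<and> m \<in> carrier M \<and> n \<in> carrier N} \<union>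
        {e (m, a \<odot>\<^bsub>N\<^esub> n) \<ominus>\<^bsub>F\<^esub> a \<odot>\<^bsub>F\<^esub> e (m, n) | a m n.
           a \<in> carrier R \<and> m \<in> carrier M \<and> n \<in> carrier N})"

definition tensor_kernel ::
    "('a, 'c) ring_scheme \<Rightarrow> ('a, 'm, 'd) module_scheme \<Rightarrow> ('a, 'n, 'e) module_scheme
     \<Rightarrow> ('m \<times> 'n \<Rightarrow> 'a) set" where
  "tensor_kernel R M N =
     module.span R (free_on R (carrier M \<times> carrier N)) (tensor_relations R M N)"

definition tensor ::
    "('a, 'c) ring_scheme \<Rightarrow> ('a, 'm, 'd) module_scheme \<Rightarrow> ('a, 'n, 'e) module_scheme
     \<Rightarrow> ('a, ('m \<times> 'n \<Rightarrow> 'a) set) module" where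
  "tensor R M N = quotient_module (free_on R (carrier M \<times> carrier N)) (tensor_kernel R M N)"

definition pure_tensor ::
    "('a, 'c) ring_scheme \<Rightarrow> ('a, 'm, 'd) module_scheme \<Rightarrow> ('a, 'n, 'e) module_scheme
     \<Rightarrow> 'm \<Rightarrow> 'n \<Rightarrow> ('m \<times> 'n \<Rightarrow> 'a) set" where
  "pure_tensor R M N m n =
     tensor_kernel R M N +>\<^bsub>free_on R (carrier M \<times> carrier N)\<^esub> unit_vec R (m, n)"

text \<open>For linear \<open>f\<close> from \<open>M\<close> to \<open>M'\<close>, the induced map from \<open>M \<otimes> N\<close> to \<open>M' \<otimes> N\<close>: the
  linear extension of \<open>(m, n) \<mapsto> f m \<otimes> n\<close> to the free module on pairs is constant on each coset,
  and \<^const>\<open>the_elem\<close> picks its value.\<close>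

definition tensor_map ::
    "('a, 'c) ring_scheme \<Rightarrow> ('a, 'm', 'd) module_scheme \<Rightarrow> ('a, 'n, 'e) module_scheme
     \<Rightarrow> ('m \<Rightarrow> 'm') \<Rightarrow> ('m \<times> 'n \<Rightarrow> 'a) set \<Rightarrow> ('m' \<times> 'n \<Rightarrow> 'a) set" where
  "tensor_map R M' N f X =
     the_elem (lin_ext R (tensor R M' N) (\<lambda>(m, n). pure_tensor R M' N (f m) n) ` X)"


section \<open>Complexes, free resolutions and Tor\<close>

text \<open>Complexes are indexed by the integers, with \<open>d j\<close> mapping \<open>C j\<close> to \<open>C (j - 1)\<close>.\<close>

definition homology ::
    "(int \<Rightarrow> ('a, 'm, 'd) module_scheme) \<Rightarrow> (int \<Rightarrow> 'm \<Rightarrow> 'm) \<Rightarrow> int \<Rightarrow> ('a, 'm set) module" where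
  "homology C d j =
     quotient_module ((C j)\<lparr>carrier := a_kernel (C j) (C (j - 1)) (d j)\<rparr>)
       (d (j + 1) ` carrier (C (j + 1)))"

definition free_resolution ::
    "('a, 'c) ring_scheme \<Rightarrow> ('a, 'm, 'd) module_scheme
     \<Rightarrow> (int \<Rightarrow> ('a, 'f, 'e) module_scheme) \<Rightarrow> (int \<Rightarrow> 'f \<Rightarrow> 'f) \<Rightarrow> bool" where
  "free_resolution R M F d \<longleftrightarrow>
     (\<forall>j. free_module R (F j)) \<and>
     (\<forall>j<0. zero_module (F j)) \<and>
     (\<forall>j. d j \<in> module_hom R (F j) (F (j - 1))) \<and>
     (\<forall>j>0. a_kernel (F j) (F (j - 1)) (d j) = d (j + 1) ` carrier (F (j + 1))) \<and>
     (\<exists>\<epsilon>\<in>module_hom R (F 0) M.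
        \<epsilon> ` carrier (F 0) = carrier M \<and> a_kernel (F 0) M \<epsilon> = d 1 ` carrier (F 1))"

text \<open>The standard free resolution of a module \<open>M\<close>. The degree 0 term is free on the elements of
  \<open>M\<close>; the degree \<open>n + 1\<close> term is free on (presentations, as lists of coefficients and basis
  elements, of) all elements of the kernel of the preceding map. All these basis elements live in
  one type.\<close>

datatype ('a, 'm) cell = Gen (gen: 'm) | Syz "('a \<times> ('a, 'm) cell) list"

primrec chain_of :: "('a, 'c) ring_scheme \<Rightarrow> ('a \<times> 'b) list \<Rightarrow> 'b \<Rightarrow> 'a" where
  "chain_of R [] = (\<lambda>_. \<zero>\<^bsub>R\<^esub>)"
| "chain_of R (p # l) = (\<lambda>b. (if b = snd p then fst p else \<zero>\<^bsub>R\<^esub>) \<oplus>\<^bsub>R\<^esub> chain_of R l b)"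

primrec cell_boundary :: "('a, 'c) ring_scheme \<Rightarrow> ('a, 'm) cell \<Rightarrow> ('a, 'm) cell \<Rightarrow> 'a" where
  "cell_boundary R (Gen m) = (\<lambda>_. \<zero>\<^bsub>R\<^esub>)"
| "cell_boundary R (Syz l) = chain_of R l"

definition standard_diff ::
    "('a, 'c) ring_scheme \<Rightarrow> int \<Rightarrow> (('a, 'm) cell \<Rightarrow> 'a) \<Rightarrow> ('a, 'm) cell \<Rightarrow> 'a" where
  "standard_diff R j = lin_ext R (free_on R UNIV) (cell_boundary R)"

primrec cells :: "('a, 'c) ring_scheme \<Rightarrow> ('a, 'm, 'd) module_scheme \<Rightarrow> nat \<Rightarrow> ('a, 'm) cell set" where
  "cells R M 0 = Gen ` carrier M"
| "cells R M (Suc n) =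
     {Syz l | l. set l \<subseteq> carrier R \<times> cells R M n \<and>
        (if n = 0 then lin_ext R M gen (chain_of R l) = \<zero>\<^bsub>M\<^esub>
         else standard_diff R (int n) (chain_of R l) = (\<lambda>_. \<zero>\<^bsub>R\<^esub>))}"

definition standard_res ::
    "('a, 'c) ring_scheme \<Rightarrow> ('a, 'm, 'd) module_scheme
     \<Rightarrow> int \<Rightarrow> ('a, ('a, 'm) cell \<Rightarrow> 'a) module" where
  "standard_res R M j = free_on R (if j < 0 then {} else cells R M (nat j))"

definition Tor ::
    "('a, 'c) ring_scheme \<Rightarrow> ('a, 'm, 'd) module_scheme \<Rightarrow> ('a, 'n, 'e) module_scheme \<Rightarrow> int
     \<Rightarrow> ('a, ((('a, 'm) cell \<Rightarrow> 'a) \<times> 'n \<Rightarrow> 'a) set set) module" where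
  "Tor R M N =
     homology (\<lambda>j. tensor R (standard_res R M j) N)
       (\<lambda>j. tensor_map R (standard_res R M (j - 1)) N (standard_diff R j))"


section \<open>Higher homotopies and pre-rigidity\<close>

text \<open>The map \<open>\<sigma> i j\<close> is the component of \<open>\<sigma> i\<close> from \<open>F j\<close> to \<open>F (j + 2 i - 1)\<close>.\<close>

definition higher_homotopies ::
    "('a, 'c) ring_scheme \<Rightarrow> 'a \<Rightarrow> (int \<Rightarrow> ('a, 'f, 'e) module_scheme) \<Rightarrow> (int \<Rightarrow> 'f \<Rightarrow> 'f)
     \<Rightarrow> (nat \<Rightarrow> int \<Rightarrow> 'f \<Rightarrow> 'f) \<Rightarrow> bool" where
  "higher_homotopies Q x F d \<sigma> \<longleftrightarrow>
     (\<forall>i j. \<sigma> i j \<in> module_hom Q (F j) (F (j + 2 * int i - 1))) \<and>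
     (\<forall>j. \<forall>v\<in>carrier (F j). \<sigma> 0 j v = d j v) \<and>
     (\<forall>j. \<forall>v\<in>carrier (F j).
        \<sigma> 0 (j + 1) (\<sigma> 1 j v) \<oplus>\<^bsub>F j\<^esub> \<sigma> 1 (j - 1) (\<sigma> 0 j v) = x \<odot>\<^bsub>F j\<^esub> v) \<and>
     (\<forall>n>1. \<forall>j. \<forall>v\<in>carrier (F j).
        (\<Oplus>\<^bsub>F (j + 2 * int n - 2)\<^esub>i\<in>{..n}. \<sigma> i (j + 2 * int (n - i) - 1) (\<sigma> (n - i) j v))
          = \<zero>\<^bsub>F (j + 2 * int n - 2)\<^esub>)"

text \<open>Here \<open>M\<close> and \<open>N\<close> are modules over \<open>R = Q/(x)\<close>, and \<open>\<pi>\<close> is the projection from \<open>Q\<close> to \<open>R\<close>. The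
  type argument is the type of the elements of the resolution.\<close>

definition pre_rigid ::
    "'f itself \<Rightarrow> ('a, 'c) ring_scheme \<Rightarrow> 'a \<Rightarrow> ('a set, 'm) module \<Rightarrow> ('a set, 'n) module \<Rightarrow> int
     \<Rightarrow> bool" where
  "pre_rigid _ Q x M N r \<longleftrightarrow>
     (let \<pi> = (\<lambda>q. PIdl\<^bsub>Q\<^esub> x +>\<^bsub>Q\<^esub> q) in
      \<exists>(F :: int \<Rightarrow> ('a, 'f) module) d \<sigma>.
        free_resolution Q (restrict_scalars \<pi> M) F d \<and>
        higher_homotopies Q x F d \<sigma> \<and>
        (\<forall>i\<ge>1. \<forall>j > r - (2 * int i - 1). \<forall>t\<in>carrier (tensor Q (F j) (restrict_scalars \<pi> N)).
           tensor_map Q (F (j + 2 * int i - 1)) (restrict_scalars \<pi> N) (\<sigma> i j) t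
             = \<zero>\<^bsub>tensor Q (F (j + 2 * int i - 1)) (restrict_scalars \<pi> N)\<^esub>))"


section \<open>The standard resolution is a free resolution\<close>

lemma free_on_simps:
  "c \<in> carrier (free_on R B) \<longleftrightarrow> (\<forall>b. c b \<in> carrier R) \<and> finite {b. c b \<noteq> \<zero>\<^bsub>R\<^esub>} \<and> (\<forall>b. c b \<noteq> \<zero>\<^bsub>R\<^esub> \<longrightarrow> b \<in> B)"
  "zero (free_on R B) = (\<lambda>_. \<zero>\<^bsub>R\<^esub>)"
  "c \<oplus>\<^bsub>free_on R B\<^esub> c' = (\<lambda>b. c b \<oplus>\<^bsub>R\<^esub> c' b)"
  "a \<odot>\<^bsub>free_on R B\<^esub> c = (\<lambda>b. a \<otimes>\<^bsub>R\<^esub> c b)"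
  by (auto simp: free_on_def)

context cring begin

lemma free_on_add_closed:
  assumes "c \<in> carrier (free_on R B)" "c' \<in> carrier (free_on R B)"
  shows "(\<lambda>b. c b \<oplus> c' b) \<in> carrier (free_on R B)"
proof -
  have "{b. c b \<oplus> c' b \<noteq> \<zero>} \<subseteq> {b. c b \<noteq> \<zero>} \<union> {b. c' b \<noteq> \<zero>}" by auto
  moreover have "finite \<dots>" using assms by (simp add: free_on_simps)
  ultimately have "finite {b. c b \<oplus> c' b \<noteq> \<zero>}" using finite_subset by blast
  moreover have "b \<in> B" if "c b \<oplus> c' b \<noteq> \<zero>" for b
    using that assms l_zero[OF zero_closed] unfolding free_on_simps(1) by metis
  ultimately show ?thesis using assms by (simp add: free_on_simps)
qed

lemma free_on_smult_closed:
  assumes "a \<in> carrier R" "c \<in> carrier (free_on R B)"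
  shows "(\<lambda>b. a \<otimes> c b) \<in> carrier (free_on R B)"
proof -
  have "{b. a \<otimes> c b \<noteq> \<zero>} \<subseteq> {b. c b \<noteq> \<zero>}" using assms(1) by auto
  then have "finite {b. a \<otimes> c b \<noteq> \<zero>}" using assms finite_subset unfolding free_on_simps(1) by metis
  moreover have "b \<in> B" if "a \<otimes> c b \<noteq> \<zero>" for b
    using that assms r_null[OF assms(1)] unfolding free_on_simps(1) by metis
  ultimately show ?thesis using assms by (simp add: free_on_simps)
qed

lemma free_on_module: "module R (free_on R B)"
proof (rule moduleI[OF is_cring])
  show "abelian_group (free_on R B)"
  proof (rule abelian_groupI)
    fix c assume c: "c \<in> carrier (free_on R B)"
    have "(\<lambda>b. \<ominus> \<one> \<otimes> c b) \<in> carrier (free_on R B)" by (rule free_on_smult_closed[OF _ c]) simp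
    moreover have "(\<lambda>b. \<ominus> \<one> \<otimes> c b) \<oplus>\<^bsub>free_on R B\<^esub> c = \<zero>\<^bsub>free_on R B\<^esub>"
      using c by (auto simp: free_on_simps l_minus l_neg)
    ultimately show "\<exists>c'\<in>carrier (free_on R B). c' \<oplus>\<^bsub>free_on R B\<^esub> c = \<zero>\<^bsub>free_on R B\<^esub>" by blast
  next
    fix c c' assume "c \<in> carrier (free_on R B)" "c' \<in> carrier (free_on R B)"
    then show "c \<oplus>\<^bsub>free_on R B\<^esub> c' \<in> carrier (free_on R B)"
      using free_on_add_closed by (simp add: free_on_simps(3))
  qed (auto simp: free_on_simps a_ac)
qed (use free_on_smult_closed in \<open>auto simp: free_on_simps l_distr r_distr m_assoc\<close>)

lemma free_on_finsum:
  assumes "finite A" "f \<in> A \<rightarrow> carrier (free_on R B)"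
  shows "finsum (free_on R B) f A = (\<lambda>b. \<Oplus>a\<in>A. f a b)"
  using assms
proof (induction rule: finite_induct)
  case empty
  interpret F: module R "free_on R B" by (rule free_on_module)
  show ?case by (simp add: free_on_simps)
next
  case (insert x A)
  interpret F: module R "free_on R B" by (rule free_on_module)
  have "(\<lambda>a. f a b) \<in> A \<rightarrow> carrier R" "f x b \<in> carrier R" for b
    using insert.prems by (auto simp: Pi_iff free_on_simps)
  then show ?case using insert by (simp add: Pi_iff free_on_simps(3) F.M.finsum_insert)
qed

lemma unit_vec_closed: "b \<in> B \<Longrightarrow> unit_vec R b \<in> carrier (free_on R B)"
  by (auto simp: free_on_simps unit_vec_def)

lemma lin_ext_superset:
  assumes "module R M" "finite A" "{b. c b \<noteq> \<zero>} \<subseteq> A" "g \<in> A \<rightarrow> carrier M" "c \<in> A \<rightarrow> carrier R"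
  shows "lin_ext R M g c = (\<Oplus>\<^bsub>M\<^esub>b\<in>A. c b \<odot>\<^bsub>M\<^esub> g b)"
proof -
  interpret M: module R M by fact
  show ?thesis unfolding lin_ext_def
    by (rule M.M.add.finprod_mono_neutral_cong_left[OF assms(2,3)])
      (use assms in \<open>auto simp: Pi_iff\<close>)
qed

lemma lin_ext_hom:
  assumes "module R M" "g \<in> B \<rightarrow> carrier M"
  shows "lin_ext R M g \<in> module_hom R (free_on R B) M"
proof -
  interpret M: module R M by fact
  interpret F: module R "free_on R B" by (rule free_on_module)
  have cl: "c b \<in> carrier R" if "c \<in> carrier (free_on R B)" for b c
    using that by (auto simp: free_on_simps)
  have sup: "{b. c b \<noteq> \<zero>} \<subseteq> B" "finite {b. c b \<noteq> \<zero>}" if "c \<in> carrier (free_on R B)" for c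
    using that by (auto simp: free_on_simps)
  have "lin_ext R M g c \<in> carrier M" if "c \<in> carrier (free_on R B)" for c
    unfolding lin_ext_def using cl[OF that] sup[OF that] assms(2)
    by (intro M.M.finsum_closed) (auto simp: Pi_iff)
  moreover have "lin_ext R M g (c \<oplus>\<^bsub>free_on R B\<^esub> c') = lin_ext R M g c \<oplus>\<^bsub>M\<^esub> lin_ext R M g c'"
    if c: "c \<in> carrier (free_on R B)" "c' \<in> carrier (free_on R B)" for c c'
  proof -
    let ?A = "{b. c b \<noteq> \<zero>} \<union> {b. c' b \<noteq> \<zero>}"
    have A: "finite ?A" "?A \<subseteq> B" using sup c by auto
    have g: "g b \<in> carrier M" if "b \<in> ?A" for b using that A(2) assms(2) by blast
    have "lin_ext R M g (\<lambda>b. c b \<oplus> c' b) = (\<Oplus>\<^bsub>M\<^esub>b\<in>?A. (c b \<oplus> c' b) \<odot>\<^bsub>M\<^esub> g b)"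
      by (rule lin_ext_superset) (use A g cl c assms in auto)
    also have "\<dots> = (\<Oplus>\<^bsub>M\<^esub>b\<in>?A. c b \<odot>\<^bsub>M\<^esub> g b \<oplus>\<^bsub>M\<^esub> c' b \<odot>\<^bsub>M\<^esub> g b)"
      by (rule M.M.finsum_cong') (use g cl c in \<open>auto simp: M.smult_l_distr\<close>)
    also have "\<dots> = (\<Oplus>\<^bsub>M\<^esub>b\<in>?A. c b \<odot>\<^bsub>M\<^esub> g b) \<oplus>\<^bsub>M\<^esub> (\<Oplus>\<^bsub>M\<^esub>b\<in>?A. c' b \<odot>\<^bsub>M\<^esub> g b)"
      by (rule M.M.finsum_addf) (use g cl c in auto)
    also have "(\<Oplus>\<^bsub>M\<^esub>b\<in>?A. c b \<odot>\<^bsub>M\<^esub> g b) = lin_ext R M g c"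
      by (rule lin_ext_superset[symmetric]) (use A g cl c assms in auto)
    also have "(\<Oplus>\<^bsub>M\<^esub>b\<in>?A. c' b \<odot>\<^bsub>M\<^esub> g b) = lin_ext R M g c'"
      by (rule lin_ext_superset[symmetric]) (use A g cl c assms in auto)
    finally show ?thesis by (simp add: free_on_simps)
  qed
  moreover have "lin_ext R M g (a \<odot>\<^bsub>free_on R B\<^esub> c) = a \<odot>\<^bsub>M\<^esub> lin_ext R M g c"
    if a: "a \<in> carrier R" and c: "c \<in> carrier (free_on R B)" for a c
  proof -
    let ?A = "{b. c b \<noteq> \<zero>}"
    have A: "finite ?A" "?A \<subseteq> B" using sup c by auto
    have g: "g b \<in> carrier M" if "b \<in> ?A" for b using that A(2) assms(2) by blast
    have "lin_ext R M g (\<lambda>b. a \<otimes> c b) = (\<Oplus>\<^bsub>M\<^esub>b\<in>?A. (a \<otimes> c b) \<odot>\<^bsub>M\<^esub> g b)"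
      by (rule lin_ext_superset) (use A g cl c assms a in auto)
    also have "\<dots> = (\<Oplus>\<^bsub>M\<^esub>b\<in>?A. a \<odot>\<^bsub>M\<^esub> (c b \<odot>\<^bsub>M\<^esub> g b))"
      by (rule M.M.finsum_cong') (use g cl c a in \<open>auto simp: M.smult_assoc1\<close>)
    also have "\<dots> = a \<odot>\<^bsub>M\<^esub> (\<Oplus>\<^bsub>M\<^esub>b\<in>?A. c b \<odot>\<^bsub>M\<^esub> g b)"
      by (rule M.finsum_smult_ldistr[symmetric]) (use A g cl c a in auto)
    finally show ?thesis by (simp add: free_on_simps lin_ext_def)
  qed
  ultimately show ?thesis unfolding module_hom_def by blast
qed

lemma lin_ext_unit_vec:
  assumes "module R M" "g b \<in> carrier M"
  shows "lin_ext R M g (unit_vec R b) = g b"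
proof -
  interpret M: module R M by fact
  have "lin_ext R M g (unit_vec R b) = (\<Oplus>\<^bsub>M\<^esub>b'\<in>{b}. unit_vec R b b' \<odot>\<^bsub>M\<^esub> g b')"
    by (rule lin_ext_superset) (use assms in \<open>auto simp: unit_vec_def\<close>)
  then show ?thesis using assms by (simp add: unit_vec_def)
qed

lemma free_on_expand:
  assumes "c \<in> carrier (free_on R B)"
  shows "lin_ext R (free_on R B) (unit_vec R) c = c"
proof
  fix b
  let ?A = "insert b {b. c b \<noteq> \<zero>}"
  have A: "finite ?A" "{b. c b \<noteq> \<zero>} \<subseteq> B" "\<And>b. c b \<in> carrier R" using assms by (auto simp: free_on_simps)
  have "lin_ext R (free_on R B) (unit_vec R) c b =
     (\<Oplus>a\<in>{b. c b \<noteq> \<zero>}. (c a \<odot>\<^bsub>free_on R B\<^esub> unit_vec R a) b)"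
    unfolding lin_ext_def
    by (subst free_on_finsum) (use A in \<open>auto intro!: module.smult_closed[OF free_on_module] unit_vec_closed\<close>)
  also have "\<dots> = (\<Oplus>a\<in>{b. c b \<noteq> \<zero>}. c a \<otimes> unit_vec R a b)" by (simp add: free_on_simps)
  also have "\<dots> = (\<Oplus>a\<in>?A. if b = a then c a else \<zero>)"
    by (rule add.finprod_mono_neutral_cong_left) (use A in \<open>auto simp: unit_vec_def\<close>)
  also have "\<dots> = c b"
    by (rule add.finprod_singleton[of b ?A c, OF _ A(1)]) (use A in auto)
  finally show "lin_ext R (free_on R B) (unit_vec R) c b = c b" .
qed

lemma chain_of_closed:
  assumes "set l \<subseteq> carrier R \<times> B"
  shows "chain_of R l \<in> carrier (free_on R B)"
  using assms
proof (induction l)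
  case Nil
  then show ?case by (auto simp: free_on_simps)
next
  case (Cons p l)
  have "(\<lambda>b. if b = snd p then fst p else \<zero>) \<in> carrier (free_on R B)"
    using Cons.prems by (auto simp: free_on_simps split: if_splits)
  from free_on_add_closed[OF this] show ?case using Cons by simp
qed

lemma chain_of_surj:
  assumes "c \<in> carrier (free_on R B)"
  obtains l where "set l \<subseteq> carrier R \<times> B" "chain_of R l = c"
proof -
  have "\<exists>l. set l \<subseteq> carrier R \<times> B \<and> chain_of R l = c"
    if "finite A" "{b. c b \<noteq> \<zero>} \<subseteq> A" "c \<in> carrier (free_on R B)" for A c
    using that
  proof (induction A arbitrary: c rule: finite_induct)
    case empty
    then show ?case by (intro exI[of _ "[]"]) auto
  next
    case (insert a A)
    have cl: "c b \<in> carrier R" for b using insert.prems by (auto simp: free_on_simps)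
    show ?case
    proof (cases "c a = \<zero>")
      case True
      then show ?thesis using insert.IH[of c] insert.prems by auto
    next
      case False
      then have a: "a \<in> B" using insert.prems by (auto simp: free_on_simps)
      let ?c = "c(a := \<zero>)"
      have "finite {b. ?c b \<noteq> \<zero>}"
        by (rule finite_subset[of _ "{b. c b \<noteq> \<zero>}"]) (use insert.prems in \<open>auto simp: free_on_simps\<close>)
      then have "?c \<in> carrier (free_on R B)" using insert.prems(2) by (simp add: free_on_simps)
      moreover have "{b. ?c b \<noteq> \<zero>} \<subseteq> A" using insert.prems by auto
      ultimately obtain l where l: "set l \<subseteq> carrier R \<times> B" "chain_of R l = ?c"
        using insert.IH by metis
      have "chain_of R ((c a, a) # l) = c" using l(2) cl by auto
      then show ?thesis using l(1) a cl by (intro exI[of _ "(c a, a) # l"]) auto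
    qed
  qed
  from this[of "{b. c b \<noteq> \<zero>}" c] assms that show thesis by (auto simp: free_on_simps)
qed

lemma free_on_free: "free_module R (free_on R B)"
proof -
  interpret F: module R "free_on R B" by (rule free_on_module)
  let ?B = "unit_vec R ` B"
  have sub: "?B \<subseteq> carrier (free_on R B)" by (auto intro: unit_vec_closed)
  show ?thesis
  proof (cases "\<one> = \<zero>")
    case True
    then have 1: "carrier R = {\<zero>}" using one_zeroD by simp
    then have 0: "carrier (free_on R B) = {\<zero>\<^bsub>free_on R B\<^esub>}"
      by (auto simp: free_on_simps)
    have "F.lincomb (\<lambda>_. \<zero>) {} = \<zero>\<^bsub>free_on R B\<^esub>" by (simp add: F.lincomb_def)
    then have "F.span {} = carrier (free_on R B)" unfolding 0 F.span_def F.lincomb_def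
      by auto
    moreover have "\<not> F.lin_dep {}" by (auto simp: F.lin_dep_def)
    ultimately show ?thesis unfolding free_module_def using F.module_axioms by blast
  next
    case False
    then have inj: "inj_on (unit_vec R) X" for X
      by (auto simp: inj_on_def unit_vec_def fun_eq_iff split: if_splits)
    have lc: "F.lincomb a (unit_vec R ` A) b = a (unit_vec R b)"
      if "finite A" "A \<subseteq> B" "b \<in> A" "a \<in> unit_vec R ` A \<rightarrow> carrier R" for a A b
    proof -
      have "F.lincomb a (unit_vec R ` A) = (\<Oplus>\<^bsub>free_on R B\<^esub>b\<in>A. a (unit_vec R b) \<odot>\<^bsub>free_on R B\<^esub> unit_vec R b)"
        unfolding F.lincomb_def
        by (rule F.M.add.finprod_reindex[OF _ inj])
           (use that in \<open>auto intro!: F.smult_closed unit_vec_closed simp: Pi_iff\<close>)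
      then have "F.lincomb a (unit_vec R ` A) b = (\<Oplus>\<^bsub>free_on R B\<^esub>b\<in>A. a (unit_vec R b) \<odot>\<^bsub>free_on R B\<^esub> unit_vec R b) b"
        by simp
      also have "\<dots> = (\<Oplus>b'\<in>A. (a (unit_vec R b') \<odot>\<^bsub>free_on R B\<^esub> unit_vec R b') b)"
        by (subst free_on_finsum) (use that in \<open>auto intro!: F.smult_closed unit_vec_closed simp: Pi_iff\<close>)
      also have "\<dots> = (\<Oplus>b'\<in>A. if b = b' then a (unit_vec R b') else \<zero>)"
        by (rule finsum_cong') (use that in \<open>auto simp: free_on_simps unit_vec_def Pi_iff\<close>)
      also have "\<dots> = a (unit_vec R b)"
        using add.finprod_singleton[of b A "\<lambda>b. a (unit_vec R b)"] that by (auto simp: Pi_iff)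
      finally show ?thesis .
    qed
    have "\<not> F.lin_dep ?B"
    proof
      assume "F.lin_dep ?B"
      then obtain A a v where A: "finite A" "A \<subseteq> ?B" "a \<in> A \<rightarrow> carrier R"
          "F.lincomb a A = \<zero>\<^bsub>free_on R B\<^esub>" "v \<in> A" "a v \<noteq> \<zero>"
        unfolding F.lin_dep_def by auto
      obtain A' where A': "A' \<subseteq> B" "A = unit_vec R ` A'" using A(2) by (meson subset_imageE)
      have fA': "finite A'" using A(1) A'(2) inj finite_image_iff by blast
      obtain b where b: "b \<in> A'" "v = unit_vec R b" using A(5) A'(2) by auto
      have "a v = F.lincomb a A b" unfolding A'(2) b(2) by (rule lc[symmetric]) (use fA' A' A b in auto)
      also have "\<dots> = \<zero>" unfolding A(4) by (simp add: free_on_simps)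
      finally show False using A(6) by simp
    qed
    moreover have "F.span ?B = carrier (free_on R B)"
    proof
      show "F.span ?B \<subseteq> carrier (free_on R B)"
        unfolding F.span_def using sub by (auto intro!: F.lincomb_closed)
      show "carrier (free_on R B) \<subseteq> F.span ?B"
      proof
        fix c assume c: "c \<in> carrier (free_on R B)"
        let ?S = "{b. c b \<noteq> \<zero>}"
        let ?a = "\<lambda>v. c (inv_into UNIV (unit_vec R) v)"
        have cS: "finite ?S" "?S \<subseteq> B" "\<And>b. c b \<in> carrier R" using c by (auto simp: free_on_simps)
        have inv: "inv_into UNIV (unit_vec R) (unit_vec R b) = b" for b
          using inj[of UNIV] by (rule inv_into_f_f) simp
        have "F.lincomb ?a (unit_vec R ` ?S) = (\<Oplus>\<^bsub>free_on R B\<^esub>b\<in>?S. ?a (unit_vec R b) \<odot>\<^bsub>free_on R B\<^esub> unit_vec R b)"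
          unfolding F.lincomb_def
          by (rule F.M.add.finprod_reindex[OF _ inj])
             (use cS in \<open>auto intro!: F.smult_closed unit_vec_closed simp: Pi_iff inv\<close>)
        also have "\<dots> = c" using free_on_expand[OF c] by (simp add: lin_ext_def inv)
        finally show "c \<in> F.span ?B" unfolding F.span_def using cS
          by (auto intro!: exI[of _ ?a] exI[of _ "unit_vec R ` ?S"])
      qed
    qed
    ultimately show ?thesis unfolding free_module_def using F.module_axioms sub by blast
  qed
qed

lemma hom_eq_on_free:
  assumes "module R M" "f \<in> module_hom R (free_on R B) M" "c \<in> carrier (free_on R B)"
  shows "f c = lin_ext R M (\<lambda>b. f (unit_vec R b)) c"
proof -
  interpret M: module R M by fact
  interpret F: module R "free_on R B" by (rule free_on_module)
  interpret f: mod_hom R "free_on R B" M f by unfold_locales (rule assms(2))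
  have cl: "finite {b. c b \<noteq> \<zero>}" "{b. c b \<noteq> \<zero>} \<subseteq> B" "\<And>b. c b \<in> carrier R"
    using assms by (auto simp: free_on_simps)
  have fin: "f (\<Oplus>\<^bsub>free_on R B\<^esub>b\<in>A. h b) = (\<Oplus>\<^bsub>M\<^esub>b\<in>A. f (h b))"
    if "finite A" "h \<in> A \<rightarrow> carrier (free_on R B)" for A h
    using that
  proof (induction rule: finite_induct)
    case (insert x A)
    then have "(\<lambda>b. f (h b)) \<in> A \<rightarrow> carrier M" "f (h x) \<in> carrier M"
      using f.f_im by (auto simp: Pi_iff)
    then show ?case using insert by (simp add: F.M.finsum_insert M.M.finsum_insert Pi_iff)
  qed simp
  have u: "c b \<odot>\<^bsub>free_on R B\<^esub> unit_vec R b \<in> carrier (free_on R B)" if "b \<in> {b. c b \<noteq> \<zero>}" for b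
    using that cl by (intro F.smult_closed unit_vec_closed) auto
  have "f c = f (\<Oplus>\<^bsub>free_on R B\<^esub>b\<in>{b. c b \<noteq> \<zero>}. c b \<odot>\<^bsub>free_on R B\<^esub> unit_vec R b)"
    using free_on_expand[OF assms(3)] by (simp add: lin_ext_def)
  also have "\<dots> = (\<Oplus>\<^bsub>M\<^esub>b\<in>{b. c b \<noteq> \<zero>}. f (c b \<odot>\<^bsub>free_on R B\<^esub> unit_vec R b))"
    by (rule fin) (use cl u in auto)
  also have "\<dots> = (\<Oplus>\<^bsub>M\<^esub>b\<in>{b. c b \<noteq> \<zero>}. c b \<odot>\<^bsub>M\<^esub> f (unit_vec R b))"
  proof (rule M.M.finsum_cong'[OF refl])
    fix b assume "b \<in> {b. c b \<noteq> \<zero>}"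
    then have "unit_vec R b \<in> carrier (free_on R B)" using cl by (intro unit_vec_closed) auto
    then show "f (c b \<odot>\<^bsub>free_on R B\<^esub> unit_vec R b) = c b \<odot>\<^bsub>M\<^esub> f (unit_vec R b)" using cl by simp
  next
    show "(\<lambda>b. c b \<odot>\<^bsub>M\<^esub> f (unit_vec R b)) \<in> {b. c b \<noteq> \<zero>} \<rightarrow> carrier M"
    proof
      fix b assume "b \<in> {b. c b \<noteq> \<zero>}"
      then have "unit_vec R b \<in> carrier (free_on R B)" using cl by (intro unit_vec_closed) auto
      then have "f (unit_vec R b) \<in> carrier M" using f.f_im by auto
      then show "c b \<odot>\<^bsub>M\<^esub> f (unit_vec R b) \<in> carrier M" using cl by simp
    qed
  qed
  finally show ?thesis by (simp add: lin_ext_def)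
qed

lemma lin_ext_zero:
  assumes "module R M" "c \<in> carrier (free_on R B)" "\<And>b. b \<in> B \<Longrightarrow> g b = \<zero>\<^bsub>M\<^esub>"
  shows "lin_ext R M g c = \<zero>\<^bsub>M\<^esub>"
proof -
  interpret M: module R M by fact
  show ?thesis unfolding lin_ext_def
    by (rule M.M.add.finprod_one_eqI) (use assms in \<open>auto simp: free_on_simps\<close>)
qed

lemma lin_ext_free_UNIV:
  assumes "c \<in> carrier (free_on R B)" "g \<in> B \<rightarrow> carrier (free_on R B')"
  shows "lin_ext R (free_on R UNIV) g c = lin_ext R (free_on R B') g c"
proof -
  have g: "(\<lambda>b. c b \<odot>\<^bsub>free_on R B'\<^esub> g b) \<in> {b. c b \<noteq> \<zero>} \<rightarrow> carrier (free_on R B')"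
    using assms by (auto simp: free_on_simps(1) Pi_iff intro!: module.smult_closed[OF free_on_module, unfolded free_on_simps(1)])
  moreover have "carrier (free_on R B') \<subseteq> carrier (free_on R UNIV)" by (auto simp: free_on_simps)
  ultimately have g': "(\<lambda>b. c b \<odot>\<^bsub>free_on R UNIV\<^esub> g b) \<in> {b. c b \<noteq> \<zero>} \<rightarrow> carrier (free_on R UNIV)"
    by (auto simp: Pi_iff free_on_simps(4))
  have f: "finite {b. c b \<noteq> \<zero>}" using assms by (simp add: free_on_simps)
  show ?thesis unfolding lin_ext_def free_on_finsum[OF f g] free_on_finsum[OF f g']
    by (simp add: free_on_simps)
qed

end

context module begin

lemma cell_boundary_closed:
  assumes "b \<in> cells R M (Suc n)"
  shows "cell_boundary R b \<in> carrier (free_on R (cells R M n))"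
  using assms by (auto intro: chain_of_closed)

lemma standard_diff_eq:
  assumes "c \<in> carrier (free_on R (cells R M (Suc n)))"
  shows "standard_diff R j c = lin_ext R (free_on R (cells R M n)) (cell_boundary R) c"
  unfolding standard_diff_def
  by (rule lin_ext_free_UNIV[OF assms]) (use cell_boundary_closed in blast)

lemma module_hom_cong:
  assumes "f \<in> module_hom R A B" "\<And>v. v \<in> carrier A \<Longrightarrow> g v = f v" "module R A"
  shows "g \<in> module_hom R A B"
proof -
  interpret A: module R A by fact
  show ?thesis using assms(1,2) by (simp add: module_hom_def Pi_iff)
qed

lemma standard_diff_hom:
  "standard_diff R j \<in> module_hom R (standard_res R M j) (standard_res R M (j - 1))"
proof (cases "j \<ge> 1")
  case True
  define n where "n = nat (j - 1)"
  have n: "standard_res R M j = free_on R (cells R M (Suc n))" "standard_res R M (j - 1) = free_on R (cells R M n)"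
    using True by (auto simp: standard_res_def n_def nat_diff_distrib Suc_nat_eq_nat_zadd1)
  show ?thesis unfolding n
    by (rule module_hom_cong[OF lin_ext_hom standard_diff_eq])
      (use cell_boundary_closed free_on_module in auto)
next
  case False
  interpret F: module R "standard_res R M j" unfolding standard_res_def by (rule free_on_module)
  have "standard_diff R j c = (\<lambda>_. \<zero>)" if c: "c \<in> carrier (standard_res R M j)" for c
  proof -
    have "lin_ext R (free_on R UNIV) (cell_boundary R) c = \<zero>\<^bsub>free_on R UNIV\<^esub>"
      by (rule lin_ext_zero[OF free_on_module c[unfolded standard_res_def]])
        (use False in \<open>auto simp: free_on_simps split: if_splits\<close>)
    then show ?thesis by (simp add: standard_diff_def free_on_simps)
  qed
  moreover have "standard_res R M (j - 1) = free_on R {}" using False by (simp add: standard_res_def)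
  ultimately show ?thesis
    by (auto simp: module_hom_def free_on_simps)
qed

lemma image_standard_diff:
  assumes "module R P" "f \<in> module_hom R (free_on R (cells R M n)) P"
    and "\<And>l. set l \<subseteq> carrier R \<times> cells R M n \<Longrightarrow> Syz l \<in> cells R M (Suc n) \<longleftrightarrow> f (chain_of R l) = \<zero>\<^bsub>P\<^esub>"
  shows "a_kernel (free_on R (cells R M n)) P f = standard_diff R j ` carrier (free_on R (cells R M (Suc n)))"
proof -
  let ?F = "free_on R (cells R M n)" and ?G = "free_on R (cells R M (Suc n))"
  interpret P: module R P by fact
  interpret f: mod_hom R ?F P f using assms(1,2) free_on_module by (simp add: mod_hom_def mod_hom_axioms_def)
  have ker: "a_kernel ?F P f = {v \<in> carrier ?F. f v = \<zero>\<^bsub>P\<^esub>}" by (simp add: a_kernel_def')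
  have d: "lin_ext R ?F (cell_boundary R) \<in> module_hom R ?G ?F"
    by (rule lin_ext_hom) (use cell_boundary_closed free_on_module in auto)
  have "f (lin_ext R ?F (cell_boundary R) c) = \<zero>\<^bsub>P\<^esub>" if c: "c \<in> carrier ?G" for c
  proof -
    have comp: "(\<lambda>c. f (lin_ext R ?F (cell_boundary R) c)) \<in> module_hom R ?G P"
      using d assms(2) by (simp add: module_hom_def Pi_iff)
    show ?thesis
    proof (subst hom_eq_on_free[OF assms(1) comp c], rule lin_ext_zero[OF assms(1) c])
      fix b assume b: "b \<in> cells R M (Suc n)"
      then obtain l where l: "b = Syz l" "set l \<subseteq> carrier R \<times> cells R M n" by auto
      have "lin_ext R ?F (cell_boundary R) (unit_vec R b) = chain_of R l"
        using lin_ext_unit_vec[OF free_on_module, of "cell_boundary R" b] cell_boundary_closed[OF b] l by simp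
      then show "f (lin_ext R ?F (cell_boundary R) (unit_vec R b)) = \<zero>\<^bsub>P\<^esub>"
        using assms(3)[OF l(2)] b l(1) by simp
    qed
  qed
  moreover have "v \<in> lin_ext R ?F (cell_boundary R) ` carrier ?G" if v: "v \<in> carrier ?F" "f v = \<zero>\<^bsub>P\<^esub>" for v
  proof -
    obtain l where l: "set l \<subseteq> carrier R \<times> cells R M n" "chain_of R l = v" using chain_of_surj[OF v(1)] .
    then have b: "Syz l \<in> cells R M (Suc n)" using assms(3) v by blast
    have "lin_ext R ?F (cell_boundary R) (unit_vec R (Syz l)) = v"
      using lin_ext_unit_vec[OF free_on_module, of "cell_boundary R" "Syz l"] cell_boundary_closed[OF b] l by simp
    then show ?thesis using unit_vec_closed[OF b] by blast
  qed
  moreover have "lin_ext R ?F (cell_boundary R) c \<in> carrier ?F" if "c \<in> carrier ?G" for c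
    using d that by (auto simp: module_hom_def)
  moreover have "standard_diff R j ` carrier ?G = lin_ext R ?F (cell_boundary R) ` carrier ?G"
    using standard_diff_eq by (intro image_cong) auto
  ultimately show ?thesis unfolding ker by (auto simp del: cells.simps)
qed

theorem standard_res_free_resolution:
  "free_resolution R M (standard_res R M) (standard_diff R)"
proof -
  have res: "standard_res R M (int n) = free_on R (cells R M n)" for n by (simp add: standard_res_def)
  have mod: "module R M" by unfold_locales
  have "free_module R (standard_res R M j)" for j by (simp add: standard_res_def free_on_free)
  moreover have "zero_module (standard_res R M j)" if "j < 0" for j
    using that by (auto simp: standard_res_def zero_module_def free_on_simps)
  moreover have "a_kernel (standard_res R M j) (standard_res R M (j - 1)) (standard_diff R j)
      = standard_diff R (j + 1) ` carrier (standard_res R M (j + 1))" if "j > 0" for j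
  proof -
    define n where "n = nat j"
    have j: "j = int n" "j + 1 = int (Suc n)" "n \<noteq> 0" using that by (auto simp: n_def)
    have m: "module R (standard_res R M (j - 1))" unfolding standard_res_def by (rule free_on_module)
    have z: "\<zero>\<^bsub>standard_res R M (j - 1)\<^esub> = (\<lambda>_. \<zero>)" by (simp add: standard_res_def free_on_simps)
    have r: "standard_res R M j = free_on R (cells R M n)" "standard_res R M (j + 1) = free_on R (cells R M (Suc n))"
      using j res by metis+
    show ?thesis unfolding r
    proof (rule image_standard_diff[OF m])
      show "standard_diff R j \<in> module_hom R (free_on R (cells R M n)) (standard_res R M (j - 1))"
        using standard_diff_hom[of j] by (simp only: r)
      show "Syz l \<in> cells R M (Suc n) \<longleftrightarrow> standard_diff R j (chain_of R l) = \<zero>\<^bsub>standard_res R M (j - 1)\<^esub>"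
        if "set l \<subseteq> carrier R \<times> cells R M n" for l
        unfolding z using that j(1,3) by simp
    qed
  qed
  moreover have "\<exists>\<epsilon>\<in>module_hom R (standard_res R M 0) M. \<epsilon> ` carrier (standard_res R M 0) = carrier M \<and>
      a_kernel (standard_res R M 0) M \<epsilon> = standard_diff R 1 ` carrier (standard_res R M 1)"
  proof -
    have r: "standard_res R M 0 = free_on R (cells R M 0)" "standard_res R M 1 = free_on R (cells R M (Suc 0))"
      by (simp_all add: standard_res_def)
    have h: "lin_ext R M gen \<in> module_hom R (free_on R (cells R M 0)) M"
      by (rule lin_ext_hom[OF mod]) auto
    have "m \<in> lin_ext R M gen ` carrier (free_on R (cells R M 0))" if m: "m \<in> carrier M" for m
      using lin_ext_unit_vec[OF mod, of gen "Gen m"] unit_vec_closed[of "Gen m" "cells R M 0"] m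
      by (metis cell.sel cells.simps(1) image_eqI)
    then have "lin_ext R M gen ` carrier (free_on R (cells R M 0)) = carrier M"
      using h by (auto simp: module_hom_def)
    moreover have "a_kernel (free_on R (cells R M 0)) M (lin_ext R M gen)
        = standard_diff R 1 ` carrier (free_on R (cells R M (Suc 0)))"
    proof (rule image_standard_diff[OF mod h])
      show "Syz l \<in> cells R M (Suc 0) \<longleftrightarrow> lin_ext R M gen (chain_of R l) = \<zero>\<^bsub>M\<^esub>"
        if "set l \<subseteq> carrier R \<times> cells R M 0" for l
        using that by simp
    qed
    ultimately show ?thesis unfolding r using h by blast
  qed
  ultimately show ?thesis unfolding free_resolution_def using standard_diff_hom by blast
qed

end
end

theory Submission
  imports Defs
begin

text \<open>
  The higher homotopies make \<open>G n = F n \<oplus> F (n - 2) \<oplus> \<dots>\<close> with \<open>D = \<sigma> 0 + \<sigma> 1 + \<dots>\<close> a sequence of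
  projective \<open>Q\<close>-modules in which \<open>D \<circ> D\<close> is \<open>x\<close> times the shift of summands. Modulo \<open>x\<close> it is Shamash's
  resolution of \<open>M\<close> over \<open>R = Q/(x)\<close>: if \<open>D w = x u\<close>, then, \<open>x\<close> being regular, the tail of \<open>w\<close> is \<open>D u\<close>, and
  the remaining component is a boundary because \<open>F\<close> is exact. So \<open>G \<otimes> N\<close> computes \<open>Tor R M N\<close>. By
  pre-rigidity only \<open>\<sigma> 0\<close> contributes to \<open>D \<otimes> N\<close> in degrees above \<open>r\<close>, so \<open>H n (G \<otimes> N)\<close> contains
  \<open>H (n - 2 i) (F \<otimes> N)\<close> whenever \<open>n - 2 i > r\<close>; for \<open>r = 0\<close> this also holds for \<open>n - 2 i = 0\<close>, where the
  differentials involved vanish for degree reasons.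

  Everything is done over \<open>Q\<close>: the standard resolution over \<open>R\<close> is lifted to free \<open>Q\<close>-modules, with a
  differential that squares to zero only modulo \<open>x\<close>, and chain maps and homotopies are constructed
  modulo \<open>x\<close>. Such congruences become equalities after tensoring with \<open>N\<close>, as \<open>x N = 0\<close>.
\<close>

section \<open>Homomorphisms and quotients of modules\<close>

text \<open>Only vanishing has to be transported between resolutions. For this half of a homotopy
  equivalence is enough: maps in both directions with one composite homotopic to the identity modulo
  \<open>x\<close>. Since \<open>G\<close> with \<open>D\<close> is not a complex over
  \<open>Q\<close>, vanishing is expressed elementwise by \<open>tensor_exact\<close>, without
  forming a quotient by boundaries. One comparison theorem with a variable modulus then serves
  twice: with modulus \<open>x\<close> for \<open>G\<close> against the lifted standard resolution
  of \<open>M\<close> over \<open>R\<close>, and with modulus \<open>\<zero>\<close> for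
  \<open>F\<close> against the standard resolution over \<open>Q\<close>.

  The bound in pre-rigidity concerns targets: \<open>\<sigma> i\<close> maps degree \<open>j\<close>
  to \<open>j + 2 i - 1\<close>, so \<open>j > r - (2 i - 1)\<close> says that the target degree
  exceeds \<open>r\<close>. A summand of degree \<open>m > r\<close> is therefore cut off on both
  sides: for \<open>i \<ge> 1\<close>, what enters it through \<open>\<sigma> i\<close> has target
  \<open>m\<close>, and what leaves it has target \<open>m + 2 i - 1\<close>. If
  \<open>m = r = 0\<close>, the maps that leave still have positive target, while those that enter
  come from negative degrees.\<close>

lemma module_homI:
  assumes "\<And>v. v \<in> carrier A \<Longrightarrow> f v \<in> carrier B"
    and "\<And>v w. v \<in> carrier A \<Longrightarrow> w \<in> carrier A \<Longrightarrow> f (v \<oplus>\<^bsub>A\<^esub> w) = f v \<oplus>\<^bsub>B\<^esub> f w"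
    and "\<And>a v. a \<in> carrier R \<Longrightarrow> v \<in> carrier A \<Longrightarrow> f (a \<odot>\<^bsub>A\<^esub> v) = a \<odot>\<^bsub>B\<^esub> f v"
  shows "f \<in> module_hom R A B"
  using assms by (simp add: module_hom_def)

lemma module_hom_in: "f \<in> module_hom R A B \<Longrightarrow> v \<in> carrier A \<Longrightarrow> f v \<in> carrier B"
  by (auto simp: module_hom_def)

lemma module_hom_zero:
  assumes "module R A" "module R B" "f \<in> module_hom R A B"
  shows "f \<zero>\<^bsub>A\<^esub> = \<zero>\<^bsub>B\<^esub>"
proof -
  interpret mod_hom R A B f using assms by (simp add: mod_hom_def mod_hom_axioms_def)
  show ?thesis by simp
qed

lemma module_hom_minus:
  assumes "module R A" "module R B" "f \<in> module_hom R A B" "v \<in> carrier A" "w \<in> carrier A"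
  shows "f (v \<ominus>\<^bsub>A\<^esub> w) = f v \<ominus>\<^bsub>B\<^esub> f w"
proof -
  interpret mod_hom R A B f using assms by (simp add: mod_hom_def mod_hom_axioms_def)
  show ?thesis using assms by simp
qed

lemma module_hom_finsum:
  assumes "module R A" "module R B" "f \<in> module_hom R A B" "finite I" "\<And>i. i \<in> I \<Longrightarrow> g i \<in> carrier A"
  shows "f (\<Oplus>\<^bsub>A\<^esub>i\<in>I. g i) = (\<Oplus>\<^bsub>B\<^esub>i\<in>I. f (g i))"
proof -
  interpret mod_hom R A B f using assms by (simp add: mod_hom_def mod_hom_axioms_def)
  show ?thesis using assms(4,5)
  proof (induction rule: finite_induct)
    case (insert i I)
    then have "g i \<in> carrier A" "g \<in> I \<rightarrow> carrier A" by auto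
    moreover from this have "(\<lambda>i. f (g i)) \<in> I \<rightarrow> carrier B" by auto
    ultimately show ?case using insert by (simp add: M.M.finsum_insert N.M.finsum_insert)
  qed simp
qed

lemma module_hom_compose:
  "f \<in> module_hom R A B \<Longrightarrow> g \<in> module_hom R B C \<Longrightarrow> (\<lambda>v. g (f v)) \<in> module_hom R A C"
  by (auto simp: module_hom_def Pi_iff)

lemma module_hom_id: "(\<lambda>v. v) \<in> module_hom R A A"
  by (auto simp: module_hom_def)

lemma module_hom_const_zero:
  assumes "module R B"
  shows "(\<lambda>v. \<zero>\<^bsub>B\<^esub>) \<in> module_hom R A B"
proof -
  interpret B: module R B by fact
  show ?thesis by (auto simp: module_hom_def)
qed

lemma module_hom_diff:
  assumes "module R B" "f \<in> module_hom R A B" "g \<in> module_hom R A B"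
  shows "(\<lambda>v. f v \<ominus>\<^bsub>B\<^esub> g v) \<in> module_hom R A B"
proof -
  interpret B: module R B by fact
  show ?thesis
  proof (rule module_homI)
    fix v w assume "v \<in> carrier A" "w \<in> carrier A"
    moreover from this have "f v \<in> carrier B" "g v \<in> carrier B" "f w \<in> carrier B" "g w \<in> carrier B"
      using assms by (auto simp: module_hom_def)
    ultimately show "f (v \<oplus>\<^bsub>A\<^esub> w) \<ominus>\<^bsub>B\<^esub> g (v \<oplus>\<^bsub>A\<^esub> w) = f v \<ominus>\<^bsub>B\<^esub> g v \<oplus>\<^bsub>B\<^esub> (f w \<ominus>\<^bsub>B\<^esub> g w)"
      using assms by (simp add: module_hom_def B.M.minus_eq B.M.minus_add B.M.a_ac)
  next
    fix a v assume "a \<in> carrier R" "v \<in> carrier A"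
    moreover from this have "f v \<in> carrier B" "g v \<in> carrier B"
      using assms by (auto simp: module_hom_def)
    ultimately show "f (a \<odot>\<^bsub>A\<^esub> v) \<ominus>\<^bsub>B\<^esub> g (a \<odot>\<^bsub>A\<^esub> v) = a \<odot>\<^bsub>B\<^esub> (f v \<ominus>\<^bsub>B\<^esub> g v)"
      using assms by (simp add: module_hom_def B.M.minus_eq B.smult_r_distr B.smult_r_minus)
  qed (use assms in \<open>auto simp: module_hom_def\<close>)
qed

lemma module_hom_finsum_fun:
  assumes "module R B" "finite I" "\<And>i. i \<in> I \<Longrightarrow> f i \<in> module_hom R A B"
  shows "(\<lambda>v. \<Oplus>\<^bsub>B\<^esub>i\<in>I. f i v) \<in> module_hom R A B"
proof -
  interpret B: module R B by fact
  have cl: "f i v \<in> carrier B" if "i \<in> I" "v \<in> carrier A" for i v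
    using assms(3)[OF that(1)] that(2) by (rule module_hom_in)
  show ?thesis
  proof (rule module_homI)
    fix v assume v: "v \<in> carrier A"
    then show "(\<Oplus>\<^bsub>B\<^esub>i\<in>I. f i v) \<in> carrier B" using cl by (auto intro: B.M.finsum_closed)
    fix w assume w: "w \<in> carrier A"
    have "(\<Oplus>\<^bsub>B\<^esub>i\<in>I. f i (v \<oplus>\<^bsub>A\<^esub> w)) = (\<Oplus>\<^bsub>B\<^esub>i\<in>I. f i v \<oplus>\<^bsub>B\<^esub> f i w)"
      using v w cl by (intro B.M.finsum_cong') (auto simp: module_hom_add[OF assms(3)])
    also have "\<dots> = (\<Oplus>\<^bsub>B\<^esub>i\<in>I. f i v) \<oplus>\<^bsub>B\<^esub> (\<Oplus>\<^bsub>B\<^esub>i\<in>I. f i w)"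
      using v w cl by (intro B.M.finsum_addf) auto
    finally show "(\<Oplus>\<^bsub>B\<^esub>i\<in>I. f i (v \<oplus>\<^bsub>A\<^esub> w)) = (\<Oplus>\<^bsub>B\<^esub>i\<in>I. f i v) \<oplus>\<^bsub>B\<^esub> (\<Oplus>\<^bsub>B\<^esub>i\<in>I. f i w)" .
  next
    fix a v assume a: "a \<in> carrier R" and v: "v \<in> carrier A"
    have "(\<Oplus>\<^bsub>B\<^esub>i\<in>I. f i (a \<odot>\<^bsub>A\<^esub> v)) = (\<Oplus>\<^bsub>B\<^esub>i\<in>I. a \<odot>\<^bsub>B\<^esub> f i v)"
      using a v cl by (intro B.M.finsum_cong') (auto simp: module_hom_smult[OF assms(3)])
    also have "\<dots> = a \<odot>\<^bsub>B\<^esub> (\<Oplus>\<^bsub>B\<^esub>i\<in>I. f i v)"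
      using assms(2) a v cl by (intro B.finsum_smult_ldistr[symmetric]) auto
    finally show "(\<Oplus>\<^bsub>B\<^esub>i\<in>I. f i (a \<odot>\<^bsub>A\<^esub> v)) = a \<odot>\<^bsub>B\<^esub> (\<Oplus>\<^bsub>B\<^esub>i\<in>I. f i v)" .
  qed
qed

lemma (in cring) hom_eq_on_units:
  assumes X: "module R X" and f: "f \<in> module_hom R (free_on R B) X" and g: "g \<in> module_hom R (free_on R B) X"
    and eq: "\<And>b. b \<in> B \<Longrightarrow> f (unit_vec R b) = g (unit_vec R b)" and c: "c \<in> carrier (free_on R B)"
  shows "f c = g c"
proof -
  interpret X: module R X by fact
  have b: "b \<in> B" "c b \<in> carrier R" if "c b \<noteq> \<zero>" for b
    using c that by (auto simp: free_on_simps)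
  have cl: "g (unit_vec R b) \<in> carrier X" if "b \<in> B" for b
    using that by (intro module_hom_in[OF g] unit_vec_closed)
  show ?thesis
    unfolding hom_eq_on_free[OF X f c] hom_eq_on_free[OF X g c] lin_ext_def
    by (rule X.M.finsum_cong') (use b cl eq in auto)
qed

lemma zero_moduleD: "zero_module M \<Longrightarrow> v \<in> carrier M \<Longrightarrow> v = \<zero>\<^bsub>M\<^esub>"
  by (simp add: zero_module_def)

text \<open>Quotients are taken by a \<open>Module.submodule\<close>, which is in particular an
  additive subgroup; scaling by \<open>\<ominus> \<one>\<close> provides the negatives.\<close>

lemma (in module) span_submodule:
  assumes "S \<subseteq> carrier M"
  shows "Module.submodule (span S) R M"
proof -
  interpret S: LinearCombinations.submodule R "span S" M by (rule span_is_submodule[OF assms])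
  show ?thesis
  proof (rule submoduleI)
    fix v assume v: "v \<in> span S"
    then have "(\<ominus> \<one>) \<odot>\<^bsub>M\<^esub> v \<in> span S" by simp
    moreover have "(\<ominus> \<one>) \<odot>\<^bsub>M\<^esub> v = \<ominus>\<^bsub>M\<^esub> v" using v S.subset by (simp add: smult_l_minus subsetD)
    ultimately show "\<ominus>\<^bsub>M\<^esub> v \<in> span S" by simp
  qed (use S.subset in auto)
qed

section \<open>Quotients of modules\<close>

locale quotient = M: module R M for R (structure) and M (structure) and K +
  assumes sub: "Module.submodule K R M"
begin

interpretation K: additive_subgroup K M
  using sub by (intro additive_subgroup.intro) (simp add: Module.submodule_def)

interpretation K: abelian_subgroup K M
  by (rule abelian_subgroupI3) (simp_all add: K.additive_subgroup_axioms M.abelian_group_axioms)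

lemma K_closed: "v \<in> K \<Longrightarrow> v \<in> carrier M"
  using K.a_subset by blast

lemma K_smult: "a \<in> carrier R \<Longrightarrow> v \<in> K \<Longrightarrow> a \<odot>\<^bsub>M\<^esub> v \<in> K"
  using sub by (simp add: Module.submodule_def submodule_axioms_def)

lemma coset_eq_iff:
  assumes "v \<in> carrier M" "w \<in> carrier M"
  shows "K +>\<^bsub>M\<^esub> v = K +>\<^bsub>M\<^esub> w \<longleftrightarrow> v \<ominus>\<^bsub>M\<^esub> w \<in> K"
proof
  assume "K +>\<^bsub>M\<^esub> v = K +>\<^bsub>M\<^esub> w"
  then have "v \<in> K +>\<^bsub>M\<^esub> w" using K.a_rcos_self[OF assms(1)] by simp
  then obtain k where "k \<in> K" "v = k \<oplus>\<^bsub>M\<^esub> w" by (auto simp: a_r_coset_def')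
  then show "v \<ominus>\<^bsub>M\<^esub> w \<in> K" using assms K_closed by (simp add: M.M.minus_eq M.M.a_assoc M.M.r_neg)
next
  assume k: "v \<ominus>\<^bsub>M\<^esub> w \<in> K"
  have "v = (v \<ominus>\<^bsub>M\<^esub> w) \<oplus>\<^bsub>M\<^esub> w" using assms by (simp add: M.M.minus_eq M.M.a_assoc M.M.l_neg)
  then have "v \<in> K +>\<^bsub>M\<^esub> w" using k by (auto simp: a_r_coset_def')
  then show "K +>\<^bsub>M\<^esub> v = K +>\<^bsub>M\<^esub> w" using K.a_repr_independence'[OF _ assms(2)] by metis
qed

lemma coset_self: "v \<in> carrier M \<Longrightarrow> v \<in> K +>\<^bsub>M\<^esub> v"
  by (rule K.a_rcos_self)

lemma quotient_carrier: "carrier (quotient_module M K) = (\<lambda>v. K +>\<^bsub>M\<^esub> v) ` carrier M"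
  by (auto simp: quotient_module_def A_RCOSETS_def')

lemma quotient_zero: "\<zero>\<^bsub>quotient_module M K\<^esub> = K +>\<^bsub>M\<^esub> \<zero>\<^bsub>M\<^esub>"
  using K.a_subset by (auto simp: quotient_module_def a_r_coset_def' subset_iff)

lemma quotient_add:
  "v \<in> carrier M \<Longrightarrow> w \<in> carrier M \<Longrightarrow>
    (K +>\<^bsub>M\<^esub> v) \<oplus>\<^bsub>quotient_module M K\<^esub> (K +>\<^bsub>M\<^esub> w) = K +>\<^bsub>M\<^esub> (v \<oplus>\<^bsub>M\<^esub> w)"
  by (simp add: quotient_module_def K.a_rcos_sum)

text \<open>Representatives of one coset differ by an element of \<open>K\<close>, and
  \<open>K\<close> is closed under scaling. Hence all members of the union by which
  \<open>quotient_module\<close> defines scaling coincide.\<close>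

lemma quotient_smult:
  assumes "a \<in> carrier R" "v \<in> carrier M"
  shows "a \<odot>\<^bsub>quotient_module M K\<^esub> (K +>\<^bsub>M\<^esub> v) = K +>\<^bsub>M\<^esub> (a \<odot>\<^bsub>M\<^esub> v)"
proof -
  have "K +>\<^bsub>M\<^esub> (a \<odot>\<^bsub>M\<^esub> m) = K +>\<^bsub>M\<^esub> (a \<odot>\<^bsub>M\<^esub> v)" if m: "m \<in> K +>\<^bsub>M\<^esub> v" for m
  proof -
    obtain k where k: "k \<in> K" "m = k \<oplus>\<^bsub>M\<^esub> v" using m by (auto simp: a_r_coset_def')
    have "k \<in> carrier M" using k K_closed by blast
    then have "a \<odot>\<^bsub>M\<^esub> m \<ominus>\<^bsub>M\<^esub> a \<odot>\<^bsub>M\<^esub> v = a \<odot>\<^bsub>M\<^esub> k"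
      using assms k by (simp add: M.smult_r_distr M.M.minus_eq M.M.a_assoc M.M.r_neg)
    moreover have "m \<in> carrier M" using k \<open>k \<in> carrier M\<close> assms by simp
    ultimately show ?thesis using assms K_smult[OF assms(1) k(1)] by (subst coset_eq_iff) auto
  qed
  then have "(\<Union>m\<in>K +>\<^bsub>M\<^esub> v. K +>\<^bsub>M\<^esub> (a \<odot>\<^bsub>M\<^esub> m)) = K +>\<^bsub>M\<^esub> (a \<odot>\<^bsub>M\<^esub> v)"
    using coset_self[OF assms(2)] by blast
  then show ?thesis by (simp only: quotient_module_def module.simps)
qed

lemmas quotient_simps = quotient_zero quotient_add quotient_smult

lemma quotient_cases:
  assumes "X \<in> carrier (quotient_module M K)"
  obtains v where "v \<in> carrier M" "X = K +>\<^bsub>M\<^esub> v"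
  using assms unfolding quotient_carrier by blast

lemma quotient_in: "v \<in> carrier M \<Longrightarrow> K +>\<^bsub>M\<^esub> v \<in> carrier (quotient_module M K)"
  unfolding quotient_carrier by blast

lemma quotient_is_module: "module R (quotient_module M K)"
proof (rule moduleI[OF M.R.is_cring])
  show "abelian_group (quotient_module M K)"
  proof (rule abelian_groupI)
    show "\<zero>\<^bsub>quotient_module M K\<^esub> \<in> carrier (quotient_module M K)"
      unfolding quotient_zero by (rule quotient_in) simp
  next
    fix X assume "X \<in> carrier (quotient_module M K)"
    then obtain v where v: "v \<in> carrier M" "X = K +>\<^bsub>M\<^esub> v" by (rule quotient_cases)
    show "\<zero>\<^bsub>quotient_module M K\<^esub> \<oplus>\<^bsub>quotient_module M K\<^esub> X = X"
      unfolding v(2) quotient_zero by (simp only: quotient_add v(1) M.M.zero_closed M.M.l_zero)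
    have "(K +>\<^bsub>M\<^esub> (\<ominus>\<^bsub>M\<^esub> v)) \<oplus>\<^bsub>quotient_module M K\<^esub> X = \<zero>\<^bsub>quotient_module M K\<^esub>"
      unfolding v(2) quotient_zero by (simp only: quotient_add v(1) M.M.a_inv_closed M.M.l_neg)
    then show "\<exists>Y\<in>carrier (quotient_module M K). Y \<oplus>\<^bsub>quotient_module M K\<^esub> X = \<zero>\<^bsub>quotient_module M K\<^esub>"
      using quotient_in[OF M.M.a_inv_closed[OF v(1)]] by blast
    fix Y assume "Y \<in> carrier (quotient_module M K)"
    then obtain w where w: "w \<in> carrier M" "Y = K +>\<^bsub>M\<^esub> w" by (rule quotient_cases)
    show "X \<oplus>\<^bsub>quotient_module M K\<^esub> Y \<in> carrier (quotient_module M K)"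
      unfolding v(2) w(2) quotient_add[OF v(1) w(1)] by (rule quotient_in[OF M.M.a_closed[OF v(1) w(1)]])
    show "X \<oplus>\<^bsub>quotient_module M K\<^esub> Y = Y \<oplus>\<^bsub>quotient_module M K\<^esub> X"
      unfolding v(2) w(2) quotient_add[OF v(1) w(1)] quotient_add[OF w(1) v(1)] M.M.a_comm[OF v(1) w(1)] ..
    fix Z assume "Z \<in> carrier (quotient_module M K)"
    then obtain u where u: "u \<in> carrier M" "Z = K +>\<^bsub>M\<^esub> u" by (rule quotient_cases)
    show "X \<oplus>\<^bsub>quotient_module M K\<^esub> Y \<oplus>\<^bsub>quotient_module M K\<^esub> Z = X \<oplus>\<^bsub>quotient_module M K\<^esub> (Y \<oplus>\<^bsub>quotient_module M K\<^esub> Z)"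
      unfolding v(2) w(2) u(2) by (simp only: quotient_add v(1) w(1) u(1) M.M.a_closed M.M.a_assoc)
  qed
next
  fix a X assume a: "a \<in> carrier R" and "X \<in> carrier (quotient_module M K)"
  then obtain v where v: "v \<in> carrier M" "X = K +>\<^bsub>M\<^esub> v" by (metis quotient_cases)
  show "a \<odot>\<^bsub>quotient_module M K\<^esub> X \<in> carrier (quotient_module M K)"
    unfolding v(2) quotient_smult[OF a v(1)] by (rule quotient_in[OF M.smult_closed[OF a v(1)]])
  fix Y assume "Y \<in> carrier (quotient_module M K)"
  then obtain w where w: "w \<in> carrier M" "Y = K +>\<^bsub>M\<^esub> w" by (rule quotient_cases)
  show "a \<odot>\<^bsub>quotient_module M K\<^esub> (X \<oplus>\<^bsub>quotient_module M K\<^esub> Y) =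
      a \<odot>\<^bsub>quotient_module M K\<^esub> X \<oplus>\<^bsub>quotient_module M K\<^esub> a \<odot>\<^bsub>quotient_module M K\<^esub> Y"
    unfolding v(2) w(2)
    by (simp only: quotient_add quotient_smult a v(1) w(1) M.M.a_closed M.smult_closed M.smult_r_distr)
next
  fix a b X assume a: "a \<in> carrier R" and b: "b \<in> carrier R" and "X \<in> carrier (quotient_module M K)"
  then obtain v where v: "v \<in> carrier M" "X = K +>\<^bsub>M\<^esub> v" by (metis quotient_cases)
  show "(a \<oplus> b) \<odot>\<^bsub>quotient_module M K\<^esub> X = a \<odot>\<^bsub>quotient_module M K\<^esub> X \<oplus>\<^bsub>quotient_module M K\<^esub> b \<odot>\<^bsub>quotient_module M K\<^esub> X"
    unfolding v(2)
    by (simp only: quotient_add quotient_smult a b v(1) M.R.a_closed M.smult_closed M.smult_l_distr)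
  show "(a \<otimes> b) \<odot>\<^bsub>quotient_module M K\<^esub> X = a \<odot>\<^bsub>quotient_module M K\<^esub> (b \<odot>\<^bsub>quotient_module M K\<^esub> X)"
    unfolding v(2)
    by (simp only: quotient_smult a b v(1) M.R.m_closed M.smult_closed M.smult_assoc1)
next
  fix X assume "X \<in> carrier (quotient_module M K)"
  then obtain v where v: "v \<in> carrier M" "X = K +>\<^bsub>M\<^esub> v" by (rule quotient_cases)
  show "\<one> \<odot>\<^bsub>quotient_module M K\<^esub> X = X"
    unfolding v(2) by (simp only: quotient_smult v(1) M.R.one_closed M.smult_one)
qed

lemma quotient_proj_hom: "(\<lambda>v. K +>\<^bsub>M\<^esub> v) \<in> module_hom R M (quotient_module M K)"
  by (rule module_homI) (simp_all only: quotient_in quotient_add quotient_smult)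

end

section \<open>Tensor products\<close>

text \<open>Phrased by \<open>module_hom\<close> in each argument, so that homomorphisms can be
  composed and scalars restricted one argument at a time.\<close>

definition bilinear ::
    "('a, 'c) ring_scheme \<Rightarrow> ('a, 'm, 'd) module_scheme \<Rightarrow> ('a, 'n, 'e) module_scheme
     \<Rightarrow> ('a, 'p, 'f) module_scheme \<Rightarrow> ('m \<Rightarrow> 'n \<Rightarrow> 'p) \<Rightarrow> bool" where
  "bilinear R A N X \<beta> \<longleftrightarrow>
     (\<forall>n\<in>carrier N. (\<lambda>v. \<beta> v n) \<in> module_hom R A X) \<and>
     (\<forall>v\<in>carrier A. \<beta> v \<in> module_hom R N X)"

lemma bilinearD:
  assumes "bilinear R A N X \<beta>"
  shows "v \<in> carrier A \<Longrightarrow> n \<in> carrier N \<Longrightarrow> \<beta> v n \<in> carrier X"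
    and "v \<in> carrier A \<Longrightarrow> v' \<in> carrier A \<Longrightarrow> n \<in> carrier N \<Longrightarrow> \<beta> (v \<oplus>\<^bsub>A\<^esub> v') n = \<beta> v n \<oplus>\<^bsub>X\<^esub> \<beta> v' n"
    and "v \<in> carrier A \<Longrightarrow> n \<in> carrier N \<Longrightarrow> n' \<in> carrier N \<Longrightarrow> \<beta> v (n \<oplus>\<^bsub>N\<^esub> n') = \<beta> v n \<oplus>\<^bsub>X\<^esub> \<beta> v n'"
    and "a \<in> carrier R \<Longrightarrow> v \<in> carrier A \<Longrightarrow> n \<in> carrier N \<Longrightarrow> \<beta> (a \<odot>\<^bsub>A\<^esub> v) n = a \<odot>\<^bsub>X\<^esub> \<beta> v n"
    and "a \<in> carrier R \<Longrightarrow> v \<in> carrier A \<Longrightarrow> n \<in> carrier N \<Longrightarrow> \<beta> v (a \<odot>\<^bsub>N\<^esub> n) = a \<odot>\<^bsub>X\<^esub> \<beta> v n"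
  using assms by (auto simp: bilinear_def module_hom_def Pi_iff)

text \<open>The map of the universal property, by the recipe of \<open>tensor_map\<close> but for an
  arbitrary bilinear map: comparing tensor products over different rings needs more than maps
  induced by a homomorphism of the first factor.\<close>

definition tensor_lift ::
    "('a, 'c) ring_scheme \<Rightarrow> ('a, 'p, 'd) module_scheme \<Rightarrow> ('m \<Rightarrow> 'n \<Rightarrow> 'p)
     \<Rightarrow> ('m \<times> 'n \<Rightarrow> 'a) set \<Rightarrow> 'p" where
  "tensor_lift R X \<beta> Z = the_elem (lin_ext R X (\<lambda>(v, n). \<beta> v n) ` Z)"

locale tensor_product = A: module R A + N: module R N
  for R (structure) and A :: "('a, 'm, 'd) module_scheme" and N :: "('a, 'n, 'e) module_scheme"
begin

abbreviation "pairs \<equiv> free_on R (carrier A \<times> carrier N)"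
abbreviation "kern \<equiv> tensor_kernel R A N"
abbreviation "T \<equiv> tensor R A N"
abbreviation "pt \<equiv> pure_tensor R A N"

sublocale P: module R pairs by (rule A.R.free_on_module)

lemma unit_vec_pairs: "v \<in> carrier A \<Longrightarrow> n \<in> carrier N \<Longrightarrow> unit_vec R (v, n) \<in> carrier pairs"
  by (rule A.R.unit_vec_closed) simp

lemma tensor_relations_closed: "tensor_relations R A N \<subseteq> carrier pairs"
  unfolding tensor_relations_def Let_def
  by (auto intro!: P.M.minus_closed P.M.a_closed P.smult_closed unit_vec_pairs)

lemma tensor_kernel_submodule: "Module.submodule kern R pairs"
  unfolding tensor_kernel_def by (rule P.span_submodule[OF tensor_relations_closed])

sublocale quotient R pairs kern
  by (rule quotient.intro[OF P.module_axioms quotient_axioms.intro[OF tensor_kernel_submodule]])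

lemma relation_in_kernel: "z \<in> tensor_relations R A N \<Longrightarrow> z \<in> kern"
  unfolding tensor_kernel_def using P.in_own_span[OF tensor_relations_closed] by blast

lemma tensor_module: "module R T"
  unfolding tensor_def by (rule quotient_is_module)

sublocale T: module R T by (rule tensor_module)

lemma pure_tensor_closed: "v \<in> carrier A \<Longrightarrow> n \<in> carrier N \<Longrightarrow> pt v n \<in> carrier T"
  unfolding tensor_def quotient_carrier pure_tensor_def using unit_vec_pairs by blast

text \<open>Each of the four families in \<open>tensor_relations\<close> yields one of the four
  laws.\<close>

lemma pure_tensor_bilinear: "bilinear R A N T pt"
proof -
  let ?e = "\<lambda>v n. unit_vec R (v, n)"
  have eq: "kern +>\<^bsub>pairs\<^esub> c = kern +>\<^bsub>pairs\<^esub> c'"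
    if "c \<ominus>\<^bsub>pairs\<^esub> c' \<in> tensor_relations R A N" "c \<in> carrier pairs" "c' \<in> carrier pairs" for c c'
    using relation_in_kernel[OF that(1)] by (simp add: coset_eq_iff that(2,3))
  have "pt (v \<oplus>\<^bsub>A\<^esub> v') n = pt v n \<oplus>\<^bsub>T\<^esub> pt v' n"
    if "v \<in> carrier A" "v' \<in> carrier A" "n \<in> carrier N" for v v' n
  proof -
    have "kern +>\<^bsub>pairs\<^esub> ?e (v \<oplus>\<^bsub>A\<^esub> v') n = kern +>\<^bsub>pairs\<^esub> (?e v n \<oplus>\<^bsub>pairs\<^esub> ?e v' n)"
      by (rule eq) (use that in \<open>auto intro: unit_vec_pairs simp: tensor_relations_def Let_def\<close>)
    then show ?thesis using that
      by (simp add: pure_tensor_def tensor_def quotient_add unit_vec_pairs)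
  qed
  moreover have "pt v (n \<oplus>\<^bsub>N\<^esub> n') = pt v n \<oplus>\<^bsub>T\<^esub> pt v n'"
    if "v \<in> carrier A" "n \<in> carrier N" "n' \<in> carrier N" for v n n'
  proof -
    have "kern +>\<^bsub>pairs\<^esub> ?e v (n \<oplus>\<^bsub>N\<^esub> n') = kern +>\<^bsub>pairs\<^esub> (?e v n \<oplus>\<^bsub>pairs\<^esub> ?e v n')"
      by (rule eq) (use that in \<open>auto intro: unit_vec_pairs simp: tensor_relations_def Let_def\<close>)
    then show ?thesis using that
      by (simp add: pure_tensor_def tensor_def quotient_add unit_vec_pairs)
  qed
  moreover have "pt (a \<odot>\<^bsub>A\<^esub> v) n = a \<odot>\<^bsub>T\<^esub> pt v n"
    if "a \<in> carrier R" "v \<in> carrier A" "n \<in> carrier N" for a v n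
  proof -
    have "kern +>\<^bsub>pairs\<^esub> ?e (a \<odot>\<^bsub>A\<^esub> v) n = kern +>\<^bsub>pairs\<^esub> (a \<odot>\<^bsub>pairs\<^esub> ?e v n)"
      by (rule eq) (use that in \<open>auto intro: unit_vec_pairs simp: tensor_relations_def Let_def\<close>)
    then show ?thesis using that
      by (simp add: pure_tensor_def tensor_def quotient_smult unit_vec_pairs)
  qed
  moreover have "pt v (a \<odot>\<^bsub>N\<^esub> n) = a \<odot>\<^bsub>T\<^esub> pt v n"
    if "a \<in> carrier R" "v \<in> carrier A" "n \<in> carrier N" for a v n
  proof -
    have "kern +>\<^bsub>pairs\<^esub> ?e v (a \<odot>\<^bsub>N\<^esub> n) = kern +>\<^bsub>pairs\<^esub> (a \<odot>\<^bsub>pairs\<^esub> ?e v n)"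
      by (rule eq) (use that in \<open>auto intro: unit_vec_pairs simp: tensor_relations_def Let_def\<close>)
    then show ?thesis using that
      by (simp add: pure_tensor_def tensor_def quotient_smult unit_vec_pairs)
  qed
  ultimately show ?thesis unfolding bilinear_def
    by (auto intro!: module_homI pure_tensor_closed)
qed

lemmas pure_tensor = bilinearD(2-5)[OF pure_tensor_bilinear]

text \<open>Composition with the projection from the free module on pairs turns pure tensors into
  unit vectors, and these determine a homomorphism. Identities between maps of tensor products are
  checked through this lemma.\<close>

lemma hom_eq_on_pure_tensors:
  assumes X: "module R X" and h: "h \<in> module_hom R T X" "h' \<in> module_hom R T X"
    and eq: "\<And>v n. v \<in> carrier A \<Longrightarrow> n \<in> carrier N \<Longrightarrow> h (pt v n) = h' (pt v n)"
    and z: "z \<in> carrier T"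
  shows "h z = h' z"
proof -
  interpret X: module R X by fact
  obtain c where c: "c \<in> carrier pairs" "z = kern +>\<^bsub>pairs\<^esub> c"
    using z by (auto simp: tensor_def quotient_carrier)
  have q: "(\<lambda>c. h (kern +>\<^bsub>pairs\<^esub> c)) \<in> module_hom R pairs X" if "h \<in> module_hom R T X" for h
    using that unfolding tensor_def by (rule module_hom_compose[OF quotient_proj_hom])
  show ?thesis unfolding c(2)
  proof (rule A.R.hom_eq_on_units[OF X q[OF h(1)] q[OF h(2)] _ c(1)])
    show "h (kern +>\<^bsub>pairs\<^esub> unit_vec R b) = h' (kern +>\<^bsub>pairs\<^esub> unit_vec R b)"
      if "b \<in> carrier A \<times> carrier N" for b
      using that eq by (auto simp: pure_tensor_def)
  qed
qed

text \<open>By bilinearity the linear extension of \<open>\<beta>\<close> kills the relations. Its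
  kernel is a submodule, so it kills their span too and is constant on cosets, which is what makes
  \<open>the_elem\<close> meaningful.\<close>

lemma tensor_lift:
  assumes X: "module R X" and \<beta>: "bilinear R A N X \<beta>"
  shows "tensor_lift R X \<beta> \<in> module_hom R T X"
    and "\<And>v n. v \<in> carrier A \<Longrightarrow> n \<in> carrier N \<Longrightarrow> tensor_lift R X \<beta> (pt v n) = \<beta> v n"
proof -
  interpret X: module R X by fact
  let ?g = "\<lambda>(v, n). \<beta> v n"
  let ?h = "lin_ext R X ?g"
  have h: "?h \<in> module_hom R pairs X"
    by (rule A.R.lin_ext_hom[OF X]) (use bilinearD(1)[OF \<beta>] in auto)
  interpret h: mod_hom R pairs X ?h by unfold_locales (rule h)
  have e: "?h (unit_vec R (v, n)) = \<beta> v n" if "v \<in> carrier A" "n \<in> carrier N" for v n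
    using A.R.lin_ext_unit_vec[OF X, of ?g "(v, n)"] bilinearD(1)[OF \<beta> that] by simp
  have rel: "?h z = \<zero>\<^bsub>X\<^esub>" if "z \<in> tensor_relations R A N" for z
    using that bilinearD[OF \<beta>]
    by (auto simp: tensor_relations_def Let_def e unit_vec_pairs X.M.minus_eq X.M.r_neg)
  have "LinearCombinations.submodule R h.ker pairs" by (rule h.ker_is_submodule)
  moreover have "tensor_relations R A N \<subseteq> h.ker"
    using rel tensor_relations_closed by (auto simp: h.ker_def)
  ultimately have "kern \<subseteq> h.ker" unfolding tensor_kernel_def by (intro P.span_is_subset)
  then have k: "?h c = \<zero>\<^bsub>X\<^esub>" if "c \<in> kern" for c using that by (auto simp: h.ker_def)
  have val: "tensor_lift R X \<beta> (kern +>\<^bsub>pairs\<^esub> c) = ?h c" if c: "c \<in> carrier pairs" for c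
  proof -
    have "?h d = ?h c" if d: "d \<in> kern +>\<^bsub>pairs\<^esub> c" for d
    proof -
      obtain k' where k': "k' \<in> kern" "d = k' \<oplus>\<^bsub>pairs\<^esub> c" using d by (auto simp: a_r_coset_def')
      then show ?thesis using c k[OF k'(1)] K_closed[OF k'(1)] by simp
    qed
    then have "?h ` (kern +>\<^bsub>pairs\<^esub> c) = {?h c}" using coset_self[OF c] by blast
    then show ?thesis by (simp add: tensor_lift_def)
  qed
  show "tensor_lift R X \<beta> \<in> module_hom R T X"
    unfolding tensor_def
    by (rule module_homI) (auto simp: quotient_carrier quotient_simps val)
  show "tensor_lift R X \<beta> (pt v n) = \<beta> v n" if "v \<in> carrier A" "n \<in> carrier N" for v n
    using that by (simp add: pure_tensor_def val unit_vec_pairs e)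
qed

end

lemma tensor_map_eq_lift: "tensor_map R B N f = tensor_lift R (tensor R B N) (\<lambda>v n. pure_tensor R B N (f v) n)"
  by (rule ext) (simp add: tensor_map_def tensor_lift_def)

section \<open>Functoriality of the tensor product in its first factor\<close>

context
  fixes R :: "('a, 'c) ring_scheme" and A :: "('a, 'm, 'd) module_scheme"
    and B :: "('a, 'p, 'q) module_scheme" and N :: "('a, 'n, 'e) module_scheme"
  assumes A: "module R A" and B: "module R B" and N: "module R N"
begin

interpretation A: tensor_product R A N using A N by (rule tensor_product.intro)
interpretation B: tensor_product R B N using B N by (rule tensor_product.intro)

lemma tensor_map_bilinear:
  assumes "f \<in> module_hom R A B"
  shows "bilinear R A N (tensor R B N) (\<lambda>v n. pure_tensor R B N (f v) n)"
  using assms B.pure_tensor_bilinear unfolding bilinear_def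
  by (auto intro: module_hom_compose simp: module_hom_in)

lemma tensor_map_hom: "f \<in> module_hom R A B \<Longrightarrow> tensor_map R B N f \<in> module_hom R (tensor R A N) (tensor R B N)"
  unfolding tensor_map_eq_lift by (rule A.tensor_lift(1)[OF B.tensor_module tensor_map_bilinear])

lemma tensor_map_pure:
  "f \<in> module_hom R A B \<Longrightarrow> v \<in> carrier A \<Longrightarrow> n \<in> carrier N \<Longrightarrow>
    tensor_map R B N f (pure_tensor R A N v n) = pure_tensor R B N (f v) n"
  unfolding tensor_map_eq_lift by (rule A.tensor_lift(2)[OF B.tensor_module tensor_map_bilinear])

lemma tensor_map_closed:
  "f \<in> module_hom R A B \<Longrightarrow> z \<in> carrier (tensor R A N) \<Longrightarrow> tensor_map R B N f z \<in> carrier (tensor R B N)"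
  by (rule module_hom_in[OF tensor_map_hom])

lemma tensor_map_zero:
  "f \<in> module_hom R A B \<Longrightarrow> tensor_map R B N f \<zero>\<^bsub>tensor R A N\<^esub> = \<zero>\<^bsub>tensor R B N\<^esub>"
  by (rule module_hom_zero[OF A.tensor_module B.tensor_module tensor_map_hom])

text \<open>On pure tensors the error term \<open>x y\<close> can be moved across: tensored with
  \<open>n\<close>, it is \<open>y\<close> tensored with \<open>x n = 0\<close>. This is the only
  way in which congruences modulo \<open>x\<close> are ever turned into equalities.\<close>

lemma tensor_map_cong_mod:
  assumes f: "f \<in> module_hom R A B" "g \<in> module_hom R A B"
    and x: "x \<in> carrier R" "\<And>n. n \<in> carrier N \<Longrightarrow> x \<odot>\<^bsub>N\<^esub> n = \<zero>\<^bsub>N\<^esub>"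
    and eq: "\<And>v. v \<in> carrier A \<Longrightarrow> \<exists>y\<in>carrier B. f v = g v \<oplus>\<^bsub>B\<^esub> x \<odot>\<^bsub>B\<^esub> y"
    and z: "z \<in> carrier (tensor R A N)"
  shows "tensor_map R B N f z = tensor_map R B N g z"
proof (rule A.hom_eq_on_pure_tensors[OF B.tensor_module tensor_map_hom[OF f(1)] tensor_map_hom[OF f(2)] _ z])
  fix v n assume vn: "v \<in> carrier A" "n \<in> carrier N"
  obtain y where y: "y \<in> carrier B" "f v = g v \<oplus>\<^bsub>B\<^esub> x \<odot>\<^bsub>B\<^esub> y" using eq[OF vn(1)] by blast
  have gv: "g v \<in> carrier B" using f(2) vn(1) by (rule module_hom_in)
  have "pure_tensor R B N (x \<odot>\<^bsub>B\<^esub> y) n = pure_tensor R B N y (x \<odot>\<^bsub>N\<^esub> n)"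
    using x(1) y(1) vn(2) by (simp add: B.pure_tensor)
  also have "\<dots> = pure_tensor R B N y (\<zero>\<^bsub>R\<^esub> \<odot>\<^bsub>N\<^esub> n)" using x(2) vn(2) by simp
  also have "\<dots> = \<zero>\<^bsub>tensor R B N\<^esub>"
    using y(1) vn(2) B.pure_tensor(4)[of "\<zero>\<^bsub>R\<^esub>" y n] by (simp add: B.pure_tensor_closed)
  finally have "pure_tensor R B N (f v) n = pure_tensor R B N (g v) n"
    using y gv vn x by (simp add: B.pure_tensor B.pure_tensor_closed)
  then show "tensor_map R B N f (pure_tensor R A N v n) = tensor_map R B N g (pure_tensor R A N v n)"
    using f vn by (simp add: tensor_map_pure)
qed

lemma tensor_map_cong:
  assumes f: "f \<in> module_hom R A B" "g \<in> module_hom R A B"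
    and eq: "\<And>v. v \<in> carrier A \<Longrightarrow> f v = g v"
    and z: "z \<in> carrier (tensor R A N)"
  shows "tensor_map R B N f z = tensor_map R B N g z"
  by (rule A.hom_eq_on_pure_tensors[OF B.tensor_module tensor_map_hom[OF f(1)] tensor_map_hom[OF f(2)] _ z])
    (use f eq in \<open>simp add: tensor_map_pure\<close>)

lemma tensor_map_diff:
  assumes f: "f \<in> module_hom R A B" "g \<in> module_hom R A B" and z: "z \<in> carrier (tensor R A N)"
  shows "tensor_map R B N (\<lambda>v. f v \<ominus>\<^bsub>B\<^esub> g v) z = tensor_map R B N f z \<ominus>\<^bsub>tensor R B N\<^esub> tensor_map R B N g z"
proof -
  have d: "(\<lambda>v. f v \<ominus>\<^bsub>B\<^esub> g v) \<in> module_hom R A B" by (rule module_hom_diff[OF B f])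
  show ?thesis
  proof (rule A.hom_eq_on_pure_tensors[OF B.tensor_module tensor_map_hom[OF d]
        module_hom_diff[OF B.tensor_module tensor_map_hom[OF f(1)] tensor_map_hom[OF f(2)]] _ z])
    fix v n assume vn: "v \<in> carrier A" "n \<in> carrier N"
    have "(\<lambda>v. pure_tensor R B N v n) \<in> module_hom R B (tensor R B N)"
      using B.pure_tensor_bilinear vn(2) by (simp add: bilinear_def)
    from module_hom_minus[OF B B.tensor_module this, of "f v" "g v"]
    show "tensor_map R B N (\<lambda>v. f v \<ominus>\<^bsub>B\<^esub> g v) (pure_tensor R A N v n) =
        tensor_map R B N f (pure_tensor R A N v n) \<ominus>\<^bsub>tensor R B N\<^esub> tensor_map R B N g (pure_tensor R A N v n)"
      using f d vn by (simp add: tensor_map_pure module_hom_in[OF f(1)] module_hom_in[OF f(2)])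
  qed
qed

lemma tensor_map_finsum:
  assumes I: "finite I" and f: "\<And>i. i \<in> I \<Longrightarrow> f i \<in> module_hom R A B" and z: "z \<in> carrier (tensor R A N)"
  shows "tensor_map R B N (\<lambda>v. \<Oplus>\<^bsub>B\<^esub>i\<in>I. f i v) z = (\<Oplus>\<^bsub>tensor R B N\<^esub>i\<in>I. tensor_map R B N (f i) z)"
proof -
  have d: "(\<lambda>v. \<Oplus>\<^bsub>B\<^esub>i\<in>I. f i v) \<in> module_hom R A B" by (rule module_hom_finsum_fun[OF B I f])
  have d': "(\<lambda>z. \<Oplus>\<^bsub>tensor R B N\<^esub>i\<in>I. tensor_map R B N (f i) z) \<in> module_hom R (tensor R A N) (tensor R B N)"
    by (rule module_hom_finsum_fun[OF B.tensor_module I]) (rule tensor_map_hom[OF f])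
  show ?thesis
  proof (rule A.hom_eq_on_pure_tensors[OF B.tensor_module tensor_map_hom[OF d] d' _ z])
    fix v n assume vn: "v \<in> carrier A" "n \<in> carrier N"
    have "(\<lambda>v. pure_tensor R B N v n) \<in> module_hom R B (tensor R B N)"
      using B.pure_tensor_bilinear vn(2) by (simp add: bilinear_def)
    from module_hom_finsum[OF B B.tensor_module this I, of "\<lambda>i. f i v"]
    have "pure_tensor R B N (\<Oplus>\<^bsub>B\<^esub>i\<in>I. f i v) n = (\<Oplus>\<^bsub>tensor R B N\<^esub>i\<in>I. pure_tensor R B N (f i v) n)"
      using module_hom_in[OF f vn(1)] by simp
    also have "\<dots> = (\<Oplus>\<^bsub>tensor R B N\<^esub>i\<in>I. tensor_map R B N (f i) (pure_tensor R A N v n))"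
      using f vn by (intro B.T.M.finsum_cong')
        (simp_all add: Pi_iff tensor_map_pure B.pure_tensor_closed module_hom_in[OF f])
    finally show "tensor_map R B N (\<lambda>v. \<Oplus>\<^bsub>B\<^esub>i\<in>I. f i v) (pure_tensor R A N v n) =
        (\<Oplus>\<^bsub>tensor R B N\<^esub>i\<in>I. tensor_map R B N (f i) (pure_tensor R A N v n))"
      using d vn by (simp add: tensor_map_pure)
  qed
qed

end

lemma tensor_map_compose:
  assumes mod: "module R A" "module R B" "module R C" "module R N"
    and f: "f \<in> module_hom R A B" and g: "g \<in> module_hom R B C"
    and z: "z \<in> carrier (tensor R A N)"
  shows "tensor_map R C N g (tensor_map R B N f z) = tensor_map R C N (\<lambda>v. g (f v)) z"
proof -
  interpret A: tensor_product R A N using mod by (intro tensor_product.intro)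
  interpret C: tensor_product R C N using mod by (intro tensor_product.intro)
  have gf: "(\<lambda>v. g (f v)) \<in> module_hom R A C" by (rule module_hom_compose[OF f g])
  show ?thesis
    by (rule A.hom_eq_on_pure_tensors[OF C.tensor_module
          module_hom_compose[OF tensor_map_hom tensor_map_hom] tensor_map_hom _ z])
      (use mod f g gf in \<open>simp_all add: tensor_map_pure[of R] module_hom_in[OF f]\<close>)
qed

lemma tensor_map_id:
  assumes mod: "module R A" "module R N" and z: "z \<in> carrier (tensor R A N)"
  shows "tensor_map R A N (\<lambda>v. v) z = z"
proof -
  interpret A: tensor_product R A N using mod by (intro tensor_product.intro)
  show ?thesis
    by (rule A.hom_eq_on_pure_tensors[OF A.tensor_module tensor_map_hom module_hom_id _ z])
      (use mod in \<open>simp_all add: tensor_map_pure[of R] module_hom_id\<close>)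
qed

lemma tensor_zero_module:
  assumes mod: "module R A" "module R N" and A: "zero_module A"
  shows "zero_module (tensor R A N)"
proof -
  interpret A: tensor_product R A N using mod by (intro tensor_product.intro)
  have "z = \<zero>\<^bsub>tensor R A N\<^esub>" if z: "z \<in> carrier (tensor R A N)" for z
  proof (rule A.hom_eq_on_pure_tensors[OF A.tensor_module module_hom_id module_hom_const_zero[OF A.tensor_module] _ z])
    fix v n assume vn: "v \<in> carrier A" "n \<in> carrier N"
    then have "pure_tensor R A N v n = pure_tensor R A N (\<zero>\<^bsub>R\<^esub> \<odot>\<^bsub>A\<^esub> v) n"
      using zero_moduleD[OF A] by simp
    also have "\<dots> = \<zero>\<^bsub>R\<^esub> \<odot>\<^bsub>tensor R A N\<^esub> pure_tensor R A N v n"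
      by (rule A.pure_tensor(3)) (use vn in simp_all)
    finally show "pure_tensor R A N v n = \<zero>\<^bsub>tensor R A N\<^esub>"
      using vn by (simp add: A.pure_tensor_closed)
  qed
  then show ?thesis by (auto simp: zero_module_def)
qed

section \<open>Projective modules\<close>

definition multiples :: "('a, 'c) ring_scheme \<Rightarrow> 'a \<Rightarrow> ('a, 'm, 'd) module_scheme \<Rightarrow> 'm set" where
  "multiples R x M = (\<lambda>y. x \<odot>\<^bsub>M\<^esub> y) ` carrier M"

lemma multiples_hom:
  assumes "f \<in> module_hom R A B" "x \<in> carrier R" "v \<in> multiples R x A"
  shows "f v \<in> multiples R x B"
  using assms by (auto simp: multiples_def module_hom_smult[OF assms(1)] module_hom_in[OF assms(1)])

context module begin

lemma module_M: "module R M"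
  by (rule module_axioms)

lemma multiples_submodule:
  assumes x: "x \<in> carrier R"
  shows "Module.submodule (multiples R x M) R M"
proof (rule submoduleI)
  show "\<zero>\<^bsub>M\<^esub> \<in> multiples R x M"
    unfolding multiples_def using x by (intro image_eqI[of _ _ "\<zero>\<^bsub>M\<^esub>"]) auto
next
  fix v assume "v \<in> multiples R x M"
  then obtain y where y: "y \<in> carrier M" "v = x \<odot>\<^bsub>M\<^esub> y" by (auto simp: multiples_def)
  show "\<ominus>\<^bsub>M\<^esub> v \<in> multiples R x M"
    unfolding multiples_def y(2) using x y(1) by (intro image_eqI[of _ _ "\<ominus>\<^bsub>M\<^esub> y"]) (auto simp: smult_r_minus)
  fix w assume "w \<in> multiples R x M"
  then obtain y' where y': "y' \<in> carrier M" "w = x \<odot>\<^bsub>M\<^esub> y'" by (auto simp: multiples_def)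
  show "v \<oplus>\<^bsub>M\<^esub> w \<in> multiples R x M"
    unfolding multiples_def y(2) y'(2) using x y(1) y'(1)
    by (intro image_eqI[of _ _ "y \<oplus>\<^bsub>M\<^esub> y'"]) (auto simp: smult_r_distr)
next
  fix a v assume a: "a \<in> carrier R" and "v \<in> multiples R x M"
  then obtain y where y: "y \<in> carrier M" "v = x \<odot>\<^bsub>M\<^esub> y" by (auto simp: multiples_def)
  have "a \<odot>\<^bsub>M\<^esub> v = x \<odot>\<^bsub>M\<^esub> (a \<odot>\<^bsub>M\<^esub> y)"
    using a x y by (simp add: smult_assoc1[symmetric] R.m_comm)
  then show "a \<odot>\<^bsub>M\<^esub> v \<in> multiples R x M" using a y(1) by (auto simp: multiples_def)
qed (use x in \<open>auto simp: multiples_def\<close>)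

lemma multiples_zero_in: "x \<in> carrier R \<Longrightarrow> \<zero>\<^bsub>M\<^esub> \<in> multiples R x M"
  using multiples_submodule by (simp add: Module.submodule_def subgroup_def)


lemma multiples_add:
  "x \<in> carrier R \<Longrightarrow> v \<in> multiples R x M \<Longrightarrow> w \<in> multiples R x M \<Longrightarrow> v \<oplus>\<^bsub>M\<^esub> w \<in> multiples R x M"
  using submoduleE(5)[OF multiples_submodule] by blast

lemma multiples_diff:
  "x \<in> carrier R \<Longrightarrow> v \<in> multiples R x M \<Longrightarrow> w \<in> multiples R x M \<Longrightarrow> v \<ominus>\<^bsub>M\<^esub> w \<in> multiples R x M"
  unfolding a_minus_def using submoduleE(3,5)[OF multiples_submodule] by blast

lemma minus_minus_cancel:
  assumes "u \<in> carrier M" "v \<in> carrier M" "w \<in> carrier M"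
  shows "(u \<ominus>\<^bsub>M\<^esub> v) \<oplus>\<^bsub>M\<^esub> (v \<ominus>\<^bsub>M\<^esub> w) = u \<ominus>\<^bsub>M\<^esub> w"
  using assms by (simp add: M.minus_eq M.a_assoc[symmetric]) (simp add: M.a_assoc M.l_neg)

lemma multiples_trans:
  assumes "x \<in> carrier R" "u \<in> carrier M" "v \<in> carrier M" "w \<in> carrier M"
    and "u \<ominus>\<^bsub>M\<^esub> v \<in> multiples R x M" "v \<ominus>\<^bsub>M\<^esub> w \<in> multiples R x M"
  shows "u \<ominus>\<^bsub>M\<^esub> w \<in> multiples R x M"
  using multiples_add[OF assms(1,5,6)] assms(2-4) by (simp add: minus_minus_cancel)


lemma multiples_diff_iff:
  assumes "x \<in> carrier R" "v \<in> carrier M" "w \<in> carrier M"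
  shows "(\<exists>y\<in>carrier M. v = w \<oplus>\<^bsub>M\<^esub> x \<odot>\<^bsub>M\<^esub> y) \<longleftrightarrow> v \<ominus>\<^bsub>M\<^esub> w \<in> multiples R x M"
proof -
  have "v = w \<oplus>\<^bsub>M\<^esub> u \<longleftrightarrow> v \<ominus>\<^bsub>M\<^esub> w = u" if "u \<in> carrier M" for u
    using assms that by (metis M.add.inv_solve_right' M.a_comm M.minus_closed M.minus_eq)
  then show ?thesis using assms(1) by (auto simp: multiples_def)
qed

lemma smult_hom:
  assumes "a \<in> carrier R" "f \<in> module_hom R A M"
  shows "(\<lambda>v. a \<odot>\<^bsub>M\<^esub> f v) \<in> module_hom R A M"
  by (rule module_homI)
    (use assms in \<open>simp_all add: module_hom_in[OF assms(2)] module_hom_add[OF assms(2)]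
      module_hom_smult[OF assms(2)] smult_r_distr smult_assoc1[symmetric] R.m_comm\<close>)

end

text \<open>The splitting of one particular cover, the free module on all elements of
  \<open>P\<close>. The usual lifting property ranges over modules of every type, which a predicate
  cannot quantify over; it is recovered in \<open>projective_lift\<close>. Projectivity is preferred
  to freeness because a finite direct sum inherits a splitting without a basis being
  assembled.\<close>

definition projective :: "('a, 'c) ring_scheme \<Rightarrow> ('a, 'm, 'd) module_scheme \<Rightarrow> bool" where
  "projective R P \<longleftrightarrow> module R P \<and>
     (\<exists>s\<in>module_hom R P (free_on R (carrier P)). \<forall>v\<in>carrier P. lin_ext R P (\<lambda>u. u) (s v) = v)"

text \<open>A basis \<open>B\<close> makes \<open>lin_ext\<close> an isomorphism from the free
  module on \<open>B\<close>: spanning gives surjectivity, linear independence injectivity. Its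
  inverse is the splitting.\<close>

lemma free_module_projective:
  assumes "free_module R P"
  shows "projective R P"
proof -
  interpret P: module R P using assms by (simp add: free_module_def)
  obtain B where B: "B \<subseteq> carrier P" "\<not> P.lin_dep B" "P.span B = carrier P"
    using assms by (auto simp: free_module_def)
  let ?e = "lin_ext R P (\<lambda>u. u)"
  interpret F: module R "free_on R B" by (rule P.R.free_on_module)
  have e: "?e \<in> module_hom R (free_on R B) P"
    by (rule P.R.lin_ext_hom[OF P.module_axioms]) (use B(1) in auto)
  have sum: "?e c = P.lincomb c {b. c b \<noteq> \<zero>\<^bsub>R\<^esub>}" for c
    by (simp add: lin_ext_def P.lincomb_def)
  have surj: "\<exists>c\<in>carrier (free_on R B). ?e c = v" if v: "v \<in> carrier P" for v
  proof -
    obtain A a where a: "finite A" "A \<subseteq> B" "a \<in> A \<rightarrow> carrier R" "v = P.lincomb a A"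
      using v[folded B(3)] unfolding P.span_def by blast
    let ?c = "\<lambda>b. if b \<in> A then a b else \<zero>\<^bsub>R\<^esub>"
    have "finite {b. ?c b \<noteq> \<zero>\<^bsub>R\<^esub>}" by (rule finite_subset[OF _ a(1)]) auto
    then have c: "?c \<in> carrier (free_on R B)" using a(2,3) by (auto simp: free_on_simps)
    have A: "A \<subseteq> carrier P" using a(2) B(1) by simp
    have "?e ?c = (\<Oplus>\<^bsub>P\<^esub>b\<in>A. ?c b \<odot>\<^bsub>P\<^esub> b)"
      by (rule P.R.lin_ext_superset[OF P.module_axioms a(1)]) (use A a(3) in auto)
    also have "\<dots> = P.lincomb a A" unfolding P.lincomb_def
      by (rule P.M.finsum_cong') (use A a(3) in auto)
    finally show ?thesis using c a(4) by blast
  qed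
  have inj: "c = \<zero>\<^bsub>free_on R B\<^esub>" if c: "c \<in> carrier (free_on R B)" "?e c = \<zero>\<^bsub>P\<^esub>" for c
  proof (rule ccontr)
    assume "c \<noteq> \<zero>\<^bsub>free_on R B\<^esub>"
    then obtain b where b: "c b \<noteq> \<zero>\<^bsub>R\<^esub>" by (auto simp: free_on_simps)
    have "P.lin_dep B" unfolding P.lin_dep_def
      using c b sum[of c]
      by (intro exI[of _ "{b. c b \<noteq> \<zero>\<^bsub>R\<^esub>}"] exI[of _ c] exI[of _ b]) (auto simp: free_on_simps)
    then show False using B(2) by simp
  qed
  define s where "s v = (SOME c. c \<in> carrier (free_on R B) \<and> ?e c = v)" for v
  have s: "s v \<in> carrier (free_on R B)" "?e (s v) = v" if "v \<in> carrier P" for v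
    using someI_ex[of "\<lambda>c. c \<in> carrier (free_on R B) \<and> ?e c = v"] surj[OF that]
    by (auto simp: s_def)
  \<comment> \<open>Uniqueness of coordinates is what makes \<open>s\<close>, defined by an
    arbitrary choice, linear.\<close>
  have uniq: "c = c'" if "c \<in> carrier (free_on R B)" "c' \<in> carrier (free_on R B)" "?e c = ?e c'" for c c'
  proof -
    have "?e (c \<ominus>\<^bsub>free_on R B\<^esub> c') = \<zero>\<^bsub>P\<^esub>"
      using that module_hom_in[OF e that(2)]
      by (simp add: module_hom_minus[OF F.module_axioms P.module_axioms e] P.M.minus_eq P.M.r_neg)
    then have "c \<ominus>\<^bsub>free_on R B\<^esub> c' = \<zero>\<^bsub>free_on R B\<^esub>"
      using inj that by (simp add: F.M.minus_closed)
    then show ?thesis using that by simp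
  qed
  have s_hom: "s \<in> module_hom R P (free_on R B)"
  proof (rule module_homI)
    fix v w assume vw: "v \<in> carrier P" "w \<in> carrier P"
    show "s (v \<oplus>\<^bsub>P\<^esub> w) = s v \<oplus>\<^bsub>free_on R B\<^esub> s w"
      by (rule uniq) (use vw s in \<open>simp_all add: module_hom_add[OF e]\<close>)
  next
    fix a v assume av: "a \<in> carrier R" "v \<in> carrier P"
    show "s (a \<odot>\<^bsub>P\<^esub> v) = a \<odot>\<^bsub>free_on R B\<^esub> s v"
      by (rule uniq) (use av s in \<open>simp_all add: module_hom_smult[OF e]\<close>)
  qed (use s in auto)
  \<comment> \<open>The splitting has to land in the free module on the whole carrier. The
    operations of \<open>free_on\<close> do not depend on the index set, so enlarging it preserves
    linearity.\<close>
  have "carrier (free_on R B) \<subseteq> carrier (free_on R (carrier P))"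
    using B(1) by (fastforce simp: free_on_simps)
  then have "s \<in> module_hom R P (free_on R (carrier P))"
    using s_hom by (auto simp: module_hom_def free_on_simps)
  then show ?thesis unfolding projective_def using P.module_axioms s(2) by blast
qed

text \<open>Lifting against \<open>f\<close> when \<open>g\<close> takes values in the image of
  \<open>f\<close> only modulo \<open>x\<close>. The lift is defined on the free cover, where it is
  prescribed on basis vectors, and then pulled back along the splitting. Modulus
  \<open>\<zero>\<close> gives the usual lifting property.\<close>

lemma projective_lift:
  assumes P: "projective R P" and A: "module R A" and B: "module R B"
    and f: "f \<in> module_hom R A B" and g: "g \<in> module_hom R P B" and x: "x \<in> carrier R"
    and ex: "\<And>v. v \<in> carrier P \<Longrightarrow> \<exists>u\<in>carrier A. g v \<ominus>\<^bsub>B\<^esub> f u \<in> multiples R x B"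
  obtains h where "h \<in> module_hom R P A" "\<And>v. v \<in> carrier P \<Longrightarrow> g v \<ominus>\<^bsub>B\<^esub> f (h v) \<in> multiples R x B"
proof -
  interpret P: module R P using P by (simp add: projective_def)
  interpret A: module R A by fact
  interpret B: module R B by fact
  let ?F = "free_on R (carrier P)"
  obtain s where s: "s \<in> module_hom R P ?F" "\<And>v. v \<in> carrier P \<Longrightarrow> lin_ext R P (\<lambda>u. u) (s v) = v"
    using P by (auto simp: projective_def)
  have "\<forall>v\<in>carrier P. \<exists>u. u \<in> carrier A \<and> (\<exists>y\<in>carrier B. g v \<ominus>\<^bsub>B\<^esub> f u = x \<odot>\<^bsub>B\<^esub> y)"
    using ex unfolding multiples_def by blast
  then obtain u where u: "\<And>v. v \<in> carrier P \<Longrightarrow> u v \<in> carrier A"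
      "\<And>v. v \<in> carrier P \<Longrightarrow> \<exists>y\<in>carrier B. g v \<ominus>\<^bsub>B\<^esub> f (u v) = x \<odot>\<^bsub>B\<^esub> y" by metis
  \<comment> \<open>The cofactor \<open>y v\<close> is chosen along with \<open>u v\<close>:
    extended linearly, it turns the congruence into an equation between homomorphisms, which needs
    checking on basis vectors only.\<close>
  then obtain y where y: "\<And>v. v \<in> carrier P \<Longrightarrow> y v \<in> carrier B"
      "\<And>v. v \<in> carrier P \<Longrightarrow> g v \<ominus>\<^bsub>B\<^esub> f (u v) = x \<odot>\<^bsub>B\<^esub> y v" by metis
  let ?u = "lin_ext R A u" and ?y = "lin_ext R B y" and ?i = "lin_ext R P (\<lambda>u. u)"
  have hu: "?u \<in> module_hom R ?F A" by (rule P.R.lin_ext_hom[OF A]) (use u in auto)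
  have hy: "?y \<in> module_hom R ?F B" by (rule P.R.lin_ext_hom[OF B]) (use y in auto)
  have hi: "?i \<in> module_hom R ?F P" by (rule P.R.lin_ext_hom[OF P.module_M]) auto
  have d: "(\<lambda>c. g (?i c) \<ominus>\<^bsub>B\<^esub> f (?u c)) \<in> module_hom R ?F B"
    by (rule module_hom_diff[OF B module_hom_compose[OF hi g] module_hom_compose[OF hu f]])
  have eq: "g (?i c) \<ominus>\<^bsub>B\<^esub> f (?u c) = x \<odot>\<^bsub>B\<^esub> ?y c" if c: "c \<in> carrier ?F" for c
    by (rule P.R.hom_eq_on_units[OF B d B.smult_hom[OF x hy] _ c])
      (use u(1) y in \<open>simp add: P.R.lin_ext_unit_vec[OF A] P.R.lin_ext_unit_vec[OF B]
        P.R.lin_ext_unit_vec[OF P.module_M]\<close>)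
  show thesis
  proof (rule that)
    show "(\<lambda>v. ?u (s v)) \<in> module_hom R P A" by (rule module_hom_compose[OF s(1) hu])
    fix v assume v: "v \<in> carrier P"
    have sv: "s v \<in> carrier ?F" by (rule module_hom_in[OF s(1) v])
    show "g v \<ominus>\<^bsub>B\<^esub> f (?u (s v)) \<in> multiples R x B"
      using eq[OF sv] s(2)[OF v] module_hom_in[OF hy sv] by (auto simp: multiples_def)
  qed
qed

text \<open>The splitting embeds \<open>P\<close> into a free module, where \<open>x\<close> acts
  coordinatewise.\<close>

lemma projective_torsionfree:
  assumes P: "projective R P" and x: "nonzerodivisor R x"
    and v: "v \<in> carrier P" "x \<odot>\<^bsub>P\<^esub> v = \<zero>\<^bsub>P\<^esub>"
  shows "v = \<zero>\<^bsub>P\<^esub>"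
proof -
  interpret P: module R P using P by (simp add: projective_def)
  let ?F = "free_on R (carrier P)"
  interpret F: module R ?F by (rule P.R.free_on_module)
  obtain s where s: "s \<in> module_hom R P ?F" "\<And>v. v \<in> carrier P \<Longrightarrow> lin_ext R P (\<lambda>u. u) (s v) = v"
    using P by (auto simp: projective_def)
  have x': "x \<in> carrier R" using x by (simp add: nonzerodivisor_def)
  have s0: "s \<zero>\<^bsub>P\<^esub> = \<zero>\<^bsub>?F\<^esub>" by (rule module_hom_zero[OF P.module_M F.module_M s(1)])
  have "x \<odot>\<^bsub>?F\<^esub> s v = \<zero>\<^bsub>?F\<^esub>" using module_hom_smult[OF s(1) x' v(1)] v(2) s0 by simp
  then have "x \<otimes>\<^bsub>R\<^esub> s v b = \<zero>\<^bsub>R\<^esub>" for b by (simp add: free_on_simps fun_eq_iff)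
  moreover have "s v b \<in> carrier R" for b using module_hom_in[OF s(1) v(1)] by (simp add: free_on_simps)
  ultimately have "s v b = \<zero>\<^bsub>R\<^esub>" for b using x P.R.m_comm[OF x'] by (simp add: nonzerodivisor_def)
  then have "s v = \<zero>\<^bsub>?F\<^esub>" by (simp add: free_on_simps fun_eq_iff)
  then show ?thesis using s(2)[OF v(1)] s(2)[OF P.M.zero_closed] s0 by simp
qed

text \<open>The sum decomposition enters only through the identity \<open>sum\<close>. Sections of
  the covers of the summands are carried by \<open>?E\<close> into the cover of \<open>P\<close> and
  added up.\<close>

lemma projective_finite_sum:
  assumes P: "module R P" and I: "finite I" and F: "\<And>i. i \<in> I \<Longrightarrow> projective R (F i)"
    and \<iota>: "\<And>i. i \<in> I \<Longrightarrow> \<iota> i \<in> module_hom R (F i) P"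
    and p: "\<And>i. i \<in> I \<Longrightarrow> p i \<in> module_hom R P (F i)"
    and sum: "\<And>v. v \<in> carrier P \<Longrightarrow> (\<Oplus>\<^bsub>P\<^esub>i\<in>I. \<iota> i (p i v)) = v"
  shows "projective R P"
proof -
  interpret P: module R P by fact
  let ?G = "free_on R (carrier P)"
  interpret G: module R ?G by (rule P.R.free_on_module)
  have "\<forall>i\<in>I. \<exists>s. s \<in> module_hom R (F i) (free_on R (carrier (F i))) \<and> (\<forall>v\<in>carrier (F i). lin_ext R (F i) (\<lambda>u. u) (s v) = v)"
    using F by (auto simp: projective_def)
  then obtain s where s: "\<And>i. i \<in> I \<Longrightarrow> s i \<in> module_hom R (F i) (free_on R (carrier (F i)))"
      "\<And>i v. i \<in> I \<Longrightarrow> v \<in> carrier (F i) \<Longrightarrow> lin_ext R (F i) (\<lambda>u. u) (s i v) = v" by metis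
  let ?E = "\<lambda>i. lin_ext R ?G (\<lambda>u. unit_vec R (\<iota> i u))"
  let ?e = "lin_ext R P (\<lambda>u. u)"
  have E: "?E i \<in> module_hom R (free_on R (carrier (F i))) ?G" if i: "i \<in> I" for i
    by (rule P.R.lin_ext_hom[OF G.module_M]) (use module_hom_in[OF \<iota>[OF i]] in \<open>auto intro: P.R.unit_vec_closed\<close>)
  have e: "?e \<in> module_hom R ?G P" by (rule P.R.lin_ext_hom[OF P.module_M]) auto
  have E_e: "?e (?E i c) = \<iota> i (lin_ext R (F i) (\<lambda>u. u) c)" if i: "i \<in> I" and c: "c \<in> carrier (free_on R (carrier (F i)))" for i c
  proof (rule P.R.hom_eq_on_units[OF P module_hom_compose[OF E[OF i] e] module_hom_compose[OF _ \<iota>[OF i]] _ c])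
    have Fi: "module R (F i)" using F[OF i] by (simp add: projective_def)
    show "lin_ext R (F i) (\<lambda>u. u) \<in> module_hom R (free_on R (carrier (F i))) (F i)"
      by (rule P.R.lin_ext_hom[OF Fi]) auto
    fix u assume u: "u \<in> carrier (F i)"
    have "\<iota> i u \<in> carrier P" by (rule module_hom_in[OF \<iota>[OF i] u])
    then show "?e (?E i (unit_vec R u)) = \<iota> i (lin_ext R (F i) (\<lambda>u. u) (unit_vec R u))"
      using u by (simp add: P.R.lin_ext_unit_vec[OF G.module_M] P.R.lin_ext_unit_vec[OF Fi]
          P.R.lin_ext_unit_vec[OF P.module_M] P.R.unit_vec_closed)
  qed
  let ?s = "\<lambda>v. \<Oplus>\<^bsub>?G\<^esub>i\<in>I. ?E i (s i (p i v))"
  have h: "(\<lambda>v. ?E i (s i (p i v))) \<in> module_hom R P ?G" if i: "i \<in> I" for i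
    by (rule module_hom_compose[OF module_hom_compose[OF p[OF i] s(1)[OF i]] E[OF i]])
  have s_hom: "?s \<in> module_hom R P ?G" by (rule module_hom_finsum_fun[OF G.module_M I h])
  have "?e (?s v) = v" if v: "v \<in> carrier P" for v
  proof -
    have "?e (?s v) = (\<Oplus>\<^bsub>P\<^esub>i\<in>I. ?e (?E i (s i (p i v))))"
      by (rule module_hom_finsum[OF G.module_M P e I]) (rule module_hom_in[OF h v])
    also have "\<dots> = (\<Oplus>\<^bsub>P\<^esub>i\<in>I. \<iota> i (p i v))"
    proof (rule P.M.finsum_cong'[OF refl])
      show "(\<lambda>i. \<iota> i (p i v)) \<in> I \<rightarrow> carrier P"
        using module_hom_in[OF \<iota> module_hom_in[OF p v]] by blast
      fix i assume i: "i \<in> I"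
      have "p i v \<in> carrier (F i)" by (rule module_hom_in[OF p[OF i] v])
      then show "?e (?E i (s i (p i v))) = \<iota> i (p i v)"
        using E_e[OF i module_hom_in[OF s(1)[OF i]]] s(2)[OF i] by simp
    qed
    finally show ?thesis using sum[OF v] by simp
  qed
  then show ?thesis unfolding projective_def by (intro conjI P bexI[OF _ s_hom] ballI)
qed

section \<open>Resolutions modulo an element\<close>

text \<open>Cycles and boundaries are taken modulo multiples of \<open>x\<close>, so that \<open>\<delta> \<circ> \<delta>\<close> only has to
  vanish modulo \<open>x\<close>. For \<open>x = 0\<close> this is an ordinary projective resolution; in general it is a
  lift to \<open>R\<close> of a projective resolution over \<open>R/(x)\<close>.\<close>

locale resolution_mod = M: module R M
  for R (structure) and x and M :: "('a, 'm, 'd) module_scheme"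
    and K :: "nat \<Rightarrow> ('a, 'k, 'e) module_scheme" and \<delta> and \<epsilon> +
  assumes x: "x \<in> carrier R"
    and proj: "projective R (K n)"
    and \<delta>: "\<delta> n \<in> module_hom R (K (Suc n)) (K n)"
    and \<epsilon>: "\<epsilon> \<in> module_hom R (K 0) M"
    and surj: "\<epsilon> ` carrier (K 0) = carrier M"
    and exact_0: "v \<in> carrier (K 0) \<Longrightarrow>
      \<epsilon> v = \<zero>\<^bsub>M\<^esub> \<longleftrightarrow> (\<exists>u\<in>carrier (K 1). v \<ominus>\<^bsub>K 0\<^esub> \<delta> 0 u \<in> multiples R x (K 0))"
    and exact_Suc: "v \<in> carrier (K (Suc n)) \<Longrightarrow>
      \<delta> n v \<in> multiples R x (K n) \<longleftrightarrow>
        (\<exists>u\<in>carrier (K (Suc (Suc n))). v \<ominus>\<^bsub>K (Suc n)\<^esub> \<delta> (Suc n) u \<in> multiples R x (K (Suc n)))"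
begin

lemma K_module: "module R (K n)"
  using proj by (simp add: projective_def)

sublocale K: module R "K n" for n
  by (rule K_module)

text \<open>The augmentation acts as the differential out of degree 0, and there the condition is an
  equality in \<open>M\<close>. With this convention \<open>exact_0\<close> and
  \<open>exact_Suc\<close> become the single statement \<open>cycles_iff\<close>.\<close>

definition cycles :: "nat \<Rightarrow> 'k set" where
  "cycles n = {v \<in> carrier (K n).
     case n of 0 \<Rightarrow> \<epsilon> v = \<zero>\<^bsub>M\<^esub> | Suc k \<Rightarrow> \<delta> k v \<in> multiples R x (K k)}"

lemma cycles_iff:
  assumes "v \<in> carrier (K n)"
  shows "v \<in> cycles n \<longleftrightarrow> (\<exists>u\<in>carrier (K (Suc n)). v \<ominus>\<^bsub>K n\<^esub> \<delta> n u \<in> multiples R x (K n))"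
  using assms exact_0 exact_Suc by (cases n) (simp_all add: cycles_def)

lemma \<delta>_in: "v \<in> carrier (K (Suc n)) \<Longrightarrow> \<delta> n v \<in> carrier (K n)"
  using \<delta> by (rule module_hom_in)

lemma boundary_cycle: "v \<in> carrier (K (Suc n)) \<Longrightarrow> \<delta> n v \<in> cycles n"
  by (subst cycles_iff)
    (auto simp: \<delta>_in x K.M.minus_eq K.M.r_neg K.multiples_zero_in intro!: bexI[of _ v])

lemma \<delta>_\<delta>: "v \<in> carrier (K (Suc (Suc n))) \<Longrightarrow> \<delta> n (\<delta> (Suc n) v) \<in> multiples R x (K n)"
  using boundary_cycle[of v "Suc n"] by (simp add: cycles_def)

text \<open>Exactness makes a map into cycles pointwise liftable through \<open>\<delta> n\<close>
  modulo \<open>x\<close>, and projectivity makes the lift linear. This is the inductive step of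
  both the comparison maps and the homotopies.\<close>

lemma lift_cycles:
  assumes P: "projective R P" and g: "g \<in> module_hom R P (K n)"
    and "\<And>v. v \<in> carrier P \<Longrightarrow> g v \<in> cycles n"
  obtains h where "h \<in> module_hom R P (K (Suc n))"
    "\<And>v. v \<in> carrier P \<Longrightarrow> g v \<ominus>\<^bsub>K n\<^esub> \<delta> n (h v) \<in> multiples R x (K n)"
  by (rule projective_lift[OF P K_module K_module \<delta> g x])
    (use assms(3) cycles_iff[OF module_hom_in[OF g]] in auto)

text \<open>The classical argument that a chain map lifting the zero map of \<open>M\<close> is
  null-homotopic, with every equation between differentials weakened to a congruence modulo
  \<open>x\<close>.\<close>

lemma null_homotopy:
  assumes \<theta>: "\<And>n. \<theta> n \<in> module_hom R (K n) (K n)"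
    and \<theta>_0: "\<And>v. v \<in> carrier (K 0) \<Longrightarrow> \<epsilon> (\<theta> 0 v) = \<zero>\<^bsub>M\<^esub>"
    and \<theta>_\<delta>: "\<And>n v. v \<in> carrier (K (Suc n)) \<Longrightarrow>
      \<delta> n (\<theta> (Suc n) v) \<ominus>\<^bsub>K n\<^esub> \<theta> n (\<delta> n v) \<in> multiples R x (K n)"
  obtains s where "\<And>n. s n \<in> module_hom R (K n) (K (Suc n))"
    and "\<And>v. v \<in> carrier (K 0) \<Longrightarrow> \<theta> 0 v \<ominus>\<^bsub>K 0\<^esub> \<delta> 0 (s 0 v) \<in> multiples R x (K 0)"
    and "\<And>n v. v \<in> carrier (K (Suc n)) \<Longrightarrow>
      (\<theta> (Suc n) v \<ominus>\<^bsub>K (Suc n)\<^esub> s n (\<delta> n v)) \<ominus>\<^bsub>K (Suc n)\<^esub> \<delta> (Suc n) (s (Suc n) v) \<in> multiples R x (K (Suc n))"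
proof -
  have \<theta>_in: "\<theta> n v \<in> carrier (K n)" if "v \<in> carrier (K n)" for n v
    by (rule module_hom_in[OF \<theta> that])
  \<comment> \<open>\<open>step n s\<close> is the part of \<open>\<theta> (Suc n)\<close> left over
    by the homotopy built so far; the next component of the homotopy lifts it through
    \<open>\<delta> (Suc n)\<close>.\<close>
  define step where "step n s v = \<theta> (Suc n) v \<ominus>\<^bsub>K (Suc n)\<^esub> s (\<delta> n v)" for n s v
  \<comment> \<open>Besides linearity, \<open>P\<close> records that the leftover consists of
    cycles: this is exactly what the next choice needs. \<open>E\<close> relates consecutive
    choices.\<close>
  define P where "P n s \<longleftrightarrow> s \<in> module_hom R (K n) (K (Suc n)) \<and>
      (n = 0 \<longrightarrow> (\<forall>v\<in>carrier (K 0). \<theta> 0 v \<ominus>\<^bsub>K 0\<^esub> \<delta> 0 (s v) \<in> multiples R x (K 0))) \<and>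
      (\<forall>v\<in>carrier (K (Suc n)). step n s v \<in> cycles (Suc n))" for n s
  define E where "E n s s' \<longleftrightarrow> (\<forall>v\<in>carrier (K (Suc n)).
      step n s v \<ominus>\<^bsub>K (Suc n)\<^esub> \<delta> (Suc n) (s' v) \<in> multiples R x (K (Suc n)))" for n s s'
  have step_hom: "step n s \<in> module_hom R (K (Suc n)) (K (Suc n))" if "s \<in> module_hom R (K n) (K (Suc n))" for n s
    unfolding step_def by (rule module_hom_diff[OF K_module \<theta> module_hom_compose[OF \<delta> that]])
  have cyc: "step n s v \<in> cycles (Suc n)"
    if s: "s \<in> module_hom R (K n) (K (Suc n))" and v: "v \<in> carrier (K (Suc n))"
      and m: "\<theta> n (\<delta> n v) \<ominus>\<^bsub>K n\<^esub> \<delta> n (s (\<delta> n v)) \<in> multiples R x (K n)" for n s v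
  proof -
    have cl: "\<theta> (Suc n) v \<in> carrier (K (Suc n))" "\<delta> n v \<in> carrier (K n)" "s (\<delta> n v) \<in> carrier (K (Suc n))"
      using v \<theta>_in \<delta>_in module_hom_in[OF s] by auto
    have "\<delta> n (step n s v) = \<delta> n (\<theta> (Suc n) v) \<ominus>\<^bsub>K n\<^esub> \<delta> n (s (\<delta> n v))"
      unfolding step_def by (rule module_hom_minus[OF K_module K_module \<delta> cl(1,3)])
    also have "\<dots> \<in> multiples R x (K n)"
      using K.multiples_trans[OF x _ _ _ \<theta>_\<delta>[OF v] m] cl \<theta>_in \<delta>_in by simp
    finally show ?thesis using module_hom_in[OF step_hom[OF s] v] by (simp add: cycles_def)
  qed
  have "\<exists>s. \<forall>n. P n (s n) \<and> E n (s n) (s (Suc n))"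
  proof (rule dependent_nat_choice)
    obtain s where s: "s \<in> module_hom R (K 0) (K (Suc 0))"
        "\<And>v. v \<in> carrier (K 0) \<Longrightarrow> \<theta> 0 v \<ominus>\<^bsub>K 0\<^esub> \<delta> 0 (s v) \<in> multiples R x (K 0)"
      using lift_cycles[OF proj \<theta>, of 0] \<theta>_0 \<theta>_in by (auto simp: cycles_def)
    then have "P 0 s" unfolding P_def using cyc[OF s(1)] \<delta>_in by simp
    then show "\<exists>s. P 0 s" by blast
  next
    fix s n assume s: "P n s"
    then have sh: "s \<in> module_hom R (K n) (K (Suc n))" by (simp add: P_def)
    obtain s' where s': "s' \<in> module_hom R (K (Suc n)) (K (Suc (Suc n)))"
        "\<And>v. v \<in> carrier (K (Suc n)) \<Longrightarrow> step n s v \<ominus>\<^bsub>K (Suc n)\<^esub> \<delta> (Suc n) (s' v) \<in> multiples R x (K (Suc n))"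
      using lift_cycles[OF proj step_hom[OF sh]] s by (auto simp: P_def)
    have "step (Suc n) s' v \<in> cycles (Suc (Suc n))" if v: "v \<in> carrier (K (Suc (Suc n)))" for v
    proof (rule cyc[OF s'(1) v])
      let ?w = "\<delta> (Suc n) v"
      have w: "?w \<in> carrier (K (Suc n))" using v by (rule \<delta>_in)
      have cl: "\<theta> (Suc n) ?w \<in> carrier (K (Suc n))" "s (\<delta> n ?w) \<in> carrier (K (Suc n))"
          "\<delta> (Suc n) (s' ?w) \<in> carrier (K (Suc n))"
        using w \<theta>_in \<delta>_in module_hom_in[OF sh] module_hom_in[OF s'(1)] by auto
      \<comment> \<open>In a complex this term would be zero. Here
        \<open>\<delta> \<circ> \<delta>\<close> is only a multiple of \<open>x\<close>, and
        linearity of \<open>s\<close> keeps it one.\<close>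
      have "s (\<delta> n ?w) \<in> multiples R x (K (Suc n))"
        by (rule multiples_hom[OF sh x \<delta>_\<delta>[OF v]])
      moreover have "\<theta> (Suc n) ?w \<ominus>\<^bsub>K (Suc n)\<^esub> step n s ?w = s (\<delta> n ?w)"
        unfolding step_def using cl by (simp add: K.M.minus_eq K.M.minus_add K.M.minus_minus K.M.r_neg K.M.a_assoc[symmetric])
      ultimately show "\<theta> (Suc n) ?w \<ominus>\<^bsub>K (Suc n)\<^esub> \<delta> (Suc n) (s' ?w) \<in> multiples R x (K (Suc n))"
        using K.multiples_trans[OF x cl(1) module_hom_in[OF step_hom[OF sh] w] cl(3) _ s'(2)[OF w]] by simp
    qed
    then have "P (Suc n) s'" using s'(1) by (simp add: P_def)
    moreover have "E n s s'" using s'(2) by (simp add: E_def)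
    ultimately show "\<exists>s'. P (Suc n) s' \<and> E n s s'" by blast
  qed
  then obtain s where "\<And>n. P n (s n)" "\<And>n. E n (s n) (s (Suc n))" by blast
  then show thesis using that[of s] by (simp add: P_def E_def step_def)
qed

end

text \<open>No homology module is formed, so the notion makes sense for sequences that are not
  complexes. For \<open>n = 0\<close> the premise on \<open>k\<close> is vacuous: every element of
  degree 0 is a cycle.\<close>

definition tensor_exact ::
    "('a, 'c) ring_scheme \<Rightarrow> ('a, 'n, 'e) module_scheme \<Rightarrow> (nat \<Rightarrow> ('a, 'm, 'd) module_scheme)
     \<Rightarrow> (nat \<Rightarrow> 'm \<Rightarrow> 'm) \<Rightarrow> nat \<Rightarrow> bool" where
  "tensor_exact R N K \<delta> n \<longleftrightarrow>
     (\<forall>z\<in>carrier (tensor R (K n) N).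
        (\<forall>k. n = Suc k \<longrightarrow> tensor_map R (K k) N (\<delta> k) z = \<zero>\<^bsub>tensor R (K k) N\<^esub>) \<longrightarrow>
        (\<exists>w\<in>carrier (tensor R (K (Suc n)) N). z = tensor_map R (K n) N (\<delta> n) w))"

section \<open>Comparison of two resolutions of the same module\<close>

locale resolution_mod_pair =
  K: resolution_mod R x M K \<delta> \<epsilon> + L: resolution_mod R x M L \<delta>' \<epsilon>'
  for R (structure) and x and M :: "('a, 'm, 'd) module_scheme"
    and K :: "nat \<Rightarrow> ('a, 'k, 'e) module_scheme" and \<delta> and \<epsilon>
    and L :: "nat \<Rightarrow> ('a, 'l, 'f) module_scheme" and \<delta>' and \<epsilon>'
begin

text \<open>The comparison theorem over the identity of \<open>M\<close>. The invariant of the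
  recursion is that cycles go to cycles, since a lift through \<open>\<delta>' n\<close> exists only
  for cycles.\<close>

lemma chain_map:
  obtains \<phi> where "\<And>n. \<phi> n \<in> module_hom R (K n) (L n)"
    and "\<And>v. v \<in> carrier (K 0) \<Longrightarrow> \<epsilon>' (\<phi> 0 v) = \<epsilon> v"
    and "\<And>n v. v \<in> carrier (K (Suc n)) \<Longrightarrow>
      \<phi> n (\<delta> n v) \<ominus>\<^bsub>L n\<^esub> \<delta>' n (\<phi> (Suc n) v) \<in> multiples R x (L n)"
proof -
  define P where "P n \<phi> \<longleftrightarrow> \<phi> \<in> module_hom R (K n) (L n) \<and>
      (n = 0 \<longrightarrow> (\<forall>v\<in>carrier (K 0). \<epsilon>' (\<phi> v) = \<epsilon> v)) \<and>
      (\<forall>v\<in>K.cycles n. \<phi> v \<in> L.cycles n)" for n \<phi>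
  define E where "E n \<phi> \<phi>' \<longleftrightarrow> (\<forall>v\<in>carrier (K (Suc n)).
      \<phi> (\<delta> n v) \<ominus>\<^bsub>L n\<^esub> \<delta>' n (\<phi>' v) \<in> multiples R x (L n))" for n \<phi> \<phi>'
  have "\<exists>\<phi>. \<forall>n. P n (\<phi> n) \<and> E n (\<phi> n) (\<phi> (Suc n))"
  proof (rule dependent_nat_choice)
    \<comment> \<open>The modulus is \<open>\<zero>\<close> here: compatibility with the
      augmentations is an equality in \<open>M\<close>, so the lift in degree 0 has to be
      exact.\<close>
    have "\<exists>u\<in>carrier (L 0). \<epsilon> v \<ominus>\<^bsub>M\<^esub> \<epsilon>' u \<in> multiples R \<zero> M" if v: "v \<in> carrier (K 0)" for v
    proof -
      have ev: "\<epsilon> v \<in> carrier M" by (rule module_hom_in[OF K.\<epsilon> v])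
      then obtain u where "u \<in> carrier (L 0)" "\<epsilon>' u = \<epsilon> v" using L.surj by (metis imageE)
      then show ?thesis using ev by (intro bexI[of _ u]) (auto simp: K.M.M.minus_eq K.M.M.r_neg K.M.multiples_zero_in)
    qed
    then obtain \<phi> where \<phi>: "\<phi> \<in> module_hom R (K 0) (L 0)"
        "\<And>v. v \<in> carrier (K 0) \<Longrightarrow> \<epsilon> v \<ominus>\<^bsub>M\<^esub> \<epsilon>' (\<phi> v) \<in> multiples R \<zero> M"
      using projective_lift[OF K.proj L.K_module K.M.module_M L.\<epsilon> K.\<epsilon> K.M.R.zero_closed] by blast
    have eq: "\<epsilon>' (\<phi> v) = \<epsilon> v" if v: "v \<in> carrier (K 0)" for v
    proof -
      have "\<epsilon> v \<in> carrier M" "\<epsilon>' (\<phi> v) \<in> carrier M"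
        using module_hom_in[OF K.\<epsilon> v] module_hom_in[OF L.\<epsilon> module_hom_in[OF \<phi>(1) v]] .
      then show ?thesis using \<phi>(2)[OF v] by (auto simp: multiples_def)
    qed
    have "P 0 \<phi>" using \<phi>(1) eq by (auto simp: P_def K.cycles_def L.cycles_def module_hom_in[OF \<phi>(1)])
    then show "\<exists>\<phi>. P 0 \<phi>" by blast
  next
    fix \<phi> n assume \<phi>: "P n \<phi>"
    then have h: "\<phi> \<in> module_hom R (K n) (L n)" by (simp add: P_def)
    have g: "(\<lambda>v. \<phi> (\<delta> n v)) \<in> module_hom R (K (Suc n)) (L n)"
      by (rule module_hom_compose[OF K.\<delta> h])
    obtain \<phi>' where \<phi>': "\<phi>' \<in> module_hom R (K (Suc n)) (L (Suc n))"
        "\<And>v. v \<in> carrier (K (Suc n)) \<Longrightarrow> \<phi> (\<delta> n v) \<ominus>\<^bsub>L n\<^esub> \<delta>' n (\<phi>' v) \<in> multiples R x (L n)"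
      using L.lift_cycles[OF K.proj g] \<phi> K.boundary_cycle by (auto simp: P_def)
    have "\<phi>' v \<in> L.cycles (Suc n)" if v: "v \<in> K.cycles (Suc n)" for v
    proof -
      have v': "v \<in> carrier (K (Suc n))" "\<delta> n v \<in> multiples R x (K n)" using v by (auto simp: K.cycles_def)
      have cl: "\<phi>' v \<in> carrier (L (Suc n))" "\<phi> (\<delta> n v) \<in> carrier (L n)"
        using module_hom_in[OF \<phi>'(1) v'(1)] module_hom_in[OF g v'(1)] by auto
      \<comment> \<open>Both terms are multiples of \<open>x\<close>: the first because
        \<open>\<delta> n v\<close> is one, the second by the choice of \<open>\<phi>'\<close>.
        Their difference is \<open>\<delta>' n (\<phi>' v)\<close>.\<close>
      have "\<phi> (\<delta> n v) \<ominus>\<^bsub>L n\<^esub> (\<phi> (\<delta> n v) \<ominus>\<^bsub>L n\<^esub> \<delta>' n (\<phi>' v)) \<in> multiples R x (L n)"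
        by (rule L.K.multiples_diff[OF L.x multiples_hom[OF h L.x v'(2)] \<phi>'(2)[OF v'(1)]])
      moreover have "\<phi> (\<delta> n v) \<ominus>\<^bsub>L n\<^esub> (\<phi> (\<delta> n v) \<ominus>\<^bsub>L n\<^esub> \<delta>' n (\<phi>' v)) = \<delta>' n (\<phi>' v)"
        using cl L.\<delta>_in by (simp add: L.K.M.minus_eq L.K.M.minus_add L.K.M.minus_minus L.K.M.r_neg L.K.M.a_assoc[symmetric])
      ultimately show ?thesis using cl(1) by (simp add: L.cycles_def)
    qed
    then have "P (Suc n) \<phi>'" using \<phi>'(1) by (simp add: P_def)
    moreover have "E n \<phi> \<phi>'" using \<phi>'(2) by (simp add: E_def)
    ultimately show "\<exists>\<phi>'. P (Suc n) \<phi>' \<and> E n \<phi> \<phi>'" by blast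
  qed
  then obtain \<phi> where "\<And>n. P n (\<phi> n)" "\<And>n. E n (\<phi> n) (\<phi> (Suc n))" by blast
  then show thesis using that[of \<phi>] by (simp add: P_def E_def)
qed

end

text \<open>A cycle \<open>z\<close> is the sum of \<open>z - \<psi> \<phi> z\<close> and
  \<open>\<psi> \<phi> z\<close>. The first is a boundary by a homotopy from
  \<open>\<psi> \<phi>\<close> to the identity of \<open>K\<close>; the second is the image under
  \<open>\<psi>\<close> of a boundary of \<open>L\<close>. Only this one homotopy is
  constructed.\<close>

theorem (in resolution_mod_pair) tensor_exact_transfer:
  assumes N: "module R N" and xN: "\<And>a. a \<in> carrier N \<Longrightarrow> x \<odot>\<^bsub>N\<^esub> a = \<zero>\<^bsub>N\<^esub>"
    and L: "tensor_exact R N L \<delta>' n"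
  shows "tensor_exact R N K \<delta> n"
proof -
  \<comment> \<open>The locale with the two resolutions exchanged provides the map back.\<close>
  interpret LK: resolution_mod_pair R x M L \<delta>' \<epsilon>' K \<delta> \<epsilon> by unfold_locales
  have mod: "module R (K n)" "module R (L n)" for n by (rule K.K_module L.K_module)+
  obtain \<phi> where \<phi>: "\<And>n. \<phi> n \<in> module_hom R (K n) (L n)"
      "\<And>v. v \<in> carrier (K 0) \<Longrightarrow> \<epsilon>' (\<phi> 0 v) = \<epsilon> v"
      "\<And>n v. v \<in> carrier (K (Suc n)) \<Longrightarrow>
        \<phi> n (\<delta> n v) \<ominus>\<^bsub>L n\<^esub> \<delta>' n (\<phi> (Suc n) v) \<in> multiples R x (L n)"
    using chain_map by metis
  obtain \<psi> where \<psi>: "\<And>n. \<psi> n \<in> module_hom R (L n) (K n)"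
      "\<And>v. v \<in> carrier (L 0) \<Longrightarrow> \<epsilon> (\<psi> 0 v) = \<epsilon>' v"
      "\<And>n v. v \<in> carrier (L (Suc n)) \<Longrightarrow>
        \<psi> n (\<delta>' n v) \<ominus>\<^bsub>K n\<^esub> \<delta> n (\<psi> (Suc n) v) \<in> multiples R x (K n)"
    using LK.chain_map by metis
  have in_K: "\<psi> n v \<in> carrier (K n)" if "v \<in> carrier (L n)" for n v by (rule module_hom_in[OF \<psi>(1) that])
  have in_L: "\<phi> n v \<in> carrier (L n)" if "v \<in> carrier (K n)" for n v by (rule module_hom_in[OF \<phi>(1) that])
  note cl = in_K in_L K.\<delta>_in L.\<delta>_in
  have \<psi>\<phi>: "(\<lambda>v. \<psi> n (\<phi> n v)) \<in> module_hom R (K n) (K n)" for n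
    by (rule module_hom_compose[OF \<phi>(1) \<psi>(1)])
  define \<theta> where "\<theta> n v = v \<ominus>\<^bsub>K n\<^esub> \<psi> n (\<phi> n v)" for n v
  have \<theta>: "\<theta> n \<in> module_hom R (K n) (K n)" for n
    unfolding \<theta>_def by (rule module_hom_diff[OF mod(1) module_hom_id \<psi>\<phi>])
  have "\<epsilon> (\<theta> 0 v) = \<zero>\<^bsub>M\<^esub>" if v: "v \<in> carrier (K 0)" for v
  proof -
    have "\<epsilon> (\<theta> 0 v) = \<epsilon> v \<ominus>\<^bsub>M\<^esub> \<epsilon> (\<psi> 0 (\<phi> 0 v))" unfolding \<theta>_def
      by (rule module_hom_minus[OF mod(1) K.M.module_M K.\<epsilon> v]) (simp add: v cl)
    then show ?thesis using v module_hom_in[OF K.\<epsilon> v] by (simp add: cl \<phi>(2) \<psi>(2) K.M.M.minus_eq K.M.M.r_neg)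
  qed
  moreover have "\<delta> n (\<theta> (Suc n) v) \<ominus>\<^bsub>K n\<^esub> \<theta> n (\<delta> n v) \<in> multiples R x (K n)"
    if v: "v \<in> carrier (K (Suc n))" for n v
  proof -
    let ?a = "\<delta> n v" and ?b = "\<delta> n (\<psi> (Suc n) (\<phi> (Suc n) v))" and ?c = "\<psi> n (\<phi> n (\<delta> n v))"
    let ?d = "\<psi> n (\<delta>' n (\<phi> (Suc n) v))"
    have abc: "?a \<in> carrier (K n)" "?b \<in> carrier (K n)" "?c \<in> carrier (K n)" "?d \<in> carrier (K n)"
      using v by (simp_all add: cl)
    have "\<psi> n (\<phi> n (\<delta> n v) \<ominus>\<^bsub>L n\<^esub> \<delta>' n (\<phi> (Suc n) v)) \<in> multiples R x (K n)"
      by (rule multiples_hom[OF \<psi>(1) K.x \<phi>(3)[OF v]])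
    then have "?c \<ominus>\<^bsub>K n\<^esub> ?d \<in> multiples R x (K n)"
      using v by (simp add: module_hom_minus[OF mod(2,1) \<psi>(1)] cl)
    moreover have "?d \<ominus>\<^bsub>K n\<^esub> ?b \<in> multiples R x (K n)" using v by (intro \<psi>(3)) (simp add: cl)
    \<comment> \<open>Composites of chain maps modulo \<open>x\<close> commute with the
      differentials modulo \<open>x\<close>, with \<open>?d\<close> as intermediate term. The
      summand \<open>\<delta> n v\<close> common to both sides cancels below.\<close>
    ultimately have cb: "?c \<ominus>\<^bsub>K n\<^esub> ?b \<in> multiples R x (K n)"
      by (rule K.K.multiples_trans[OF K.x abc(3,4,2)])
    have "\<delta> n (\<theta> (Suc n) v) = ?a \<ominus>\<^bsub>K n\<^esub> ?b" unfolding \<theta>_def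
      by (rule module_hom_minus[OF mod(1) mod(1) K.\<delta> v]) (simp add: v cl)
    then have "\<delta> n (\<theta> (Suc n) v) \<ominus>\<^bsub>K n\<^esub> \<theta> n (\<delta> n v) = ?c \<ominus>\<^bsub>K n\<^esub> ?b" unfolding \<theta>_def
      using abc(1-3) by (simp add: K.K.M.minus_eq K.K.M.minus_add K.K.M.minus_minus)
        (simp add: K.K.M.a_ac K.K.M.r_neg1 K.K.M.r_neg2)
    then show ?thesis using cb by simp
  qed
  ultimately obtain s where s: "\<And>n. s n \<in> module_hom R (K n) (K (Suc n))"
      "\<And>v. v \<in> carrier (K 0) \<Longrightarrow> \<theta> 0 v \<ominus>\<^bsub>K 0\<^esub> \<delta> 0 (s 0 v) \<in> multiples R x (K 0)"
      "\<And>n v. v \<in> carrier (K (Suc n)) \<Longrightarrow>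
        (\<theta> (Suc n) v \<ominus>\<^bsub>K (Suc n)\<^esub> s n (\<delta> n v)) \<ominus>\<^bsub>K (Suc n)\<^esub> \<delta> (Suc n) (s (Suc n) v) \<in> multiples R x (K (Suc n))"
    using K.null_homotopy[of \<theta>, OF \<theta>] by metis
  show ?thesis unfolding tensor_exact_def
  proof (intro ballI impI)
    fix z assume z: "z \<in> carrier (tensor R (K n) N)"
      and cyc: "\<forall>k. n = Suc k \<longrightarrow> tensor_map R (K k) N (\<delta> k) z = \<zero>\<^bsub>tensor R (K k) N\<^esub>"
    interpret Tn: tensor_product R "K n" N using mod(1) N by (rule tensor_product.intro)
    interpret Tn': tensor_product R "K (Suc n)" N using mod(1) N by (rule tensor_product.intro)
    have sz: "tensor_map R (K (Suc n)) N (s n) z \<in> carrier (tensor R (K (Suc n)) N)"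
      by (rule tensor_map_closed[OF mod(1) mod(1) N s(1) z])
    have \<phi>z: "tensor_map R (L n) N (\<phi> n) z \<in> carrier (tensor R (L n) N)"
      by (rule tensor_map_closed[OF mod(1) mod(2) N \<phi>(1) z])
    have "tensor_map R (L k) N (\<delta>' k) (tensor_map R (L n) N (\<phi> n) z) = \<zero>\<^bsub>tensor R (L k) N\<^esub>" if n: "n = Suc k" for k
    proof -
      have z': "z \<in> carrier (tensor R (K (Suc k)) N)" using z n by simp
      have "tensor_map R (L k) N (\<delta>' k) (tensor_map R (L (Suc k)) N (\<phi> (Suc k)) z)
          = tensor_map R (L k) N (\<lambda>v. \<delta>' k (\<phi> (Suc k) v)) z"
        by (rule tensor_map_compose[OF mod(1,2,2) N \<phi>(1) L.\<delta> z'])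
      also have "\<dots> = tensor_map R (L k) N (\<lambda>v. \<phi> k (\<delta> k v)) z"
        by (rule tensor_map_cong_mod[OF mod(1,2) N _ _ K.x xN _ z', symmetric])
          (use \<phi>(3) cl in \<open>auto simp: L.K.multiples_diff_iff[OF L.x] intro: module_hom_compose \<phi>(1) K.\<delta> L.\<delta>\<close>)
      also have "\<dots> = tensor_map R (L k) N (\<phi> k) (tensor_map R (K k) N (\<delta> k) z)"
        by (rule tensor_map_compose[OF mod(1,1,2) N K.\<delta> \<phi>(1) z', symmetric])
      also have "\<dots> = \<zero>\<^bsub>tensor R (L k) N\<^esub>"
        using cyc n tensor_map_zero[OF mod(1,2) N \<phi>(1)] by simp
      finally show ?thesis using n by simp
    qed
    then obtain w where w: "w \<in> carrier (tensor R (L (Suc n)) N)"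
        "tensor_map R (L n) N (\<phi> n) z = tensor_map R (L n) N (\<delta>' n) w"
      using L \<phi>z unfolding tensor_exact_def by blast
    have \<psi>w: "tensor_map R (K (Suc n)) N (\<psi> (Suc n)) w \<in> carrier (tensor R (K (Suc n)) N)"
      by (rule tensor_map_closed[OF mod(2) mod(1) N \<psi>(1) w(1)])
    have "tensor_map R (K n) N (\<lambda>v. \<psi> n (\<phi> n v)) z = tensor_map R (K n) N (\<psi> n) (tensor_map R (L n) N (\<phi> n) z)"
      by (rule tensor_map_compose[OF mod(1,2,1) N \<phi>(1) \<psi>(1) z, symmetric])
    also have "\<dots> = tensor_map R (K n) N (\<lambda>v. \<psi> n (\<delta>' n v)) w"
      unfolding w(2) by (rule tensor_map_compose[OF mod(2,2,1) N L.\<delta> \<psi>(1) w(1)])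
    also have "\<dots> = tensor_map R (K n) N (\<lambda>v. \<delta> n (\<psi> (Suc n) v)) w"
      by (rule tensor_map_cong_mod[OF mod(2,1) N module_hom_compose[OF L.\<delta> \<psi>(1)] module_hom_compose[OF \<psi>(1) K.\<delta>] K.x xN _ w(1)])
        (use \<psi>(3) cl in \<open>auto simp: K.K.multiples_diff_iff[OF K.x]\<close>)
    also have "\<dots> = tensor_map R (K n) N (\<delta> n) (tensor_map R (K (Suc n)) N (\<psi> (Suc n)) w)"
      by (rule tensor_map_compose[OF mod(2,1,1) N \<psi>(1) K.\<delta> w(1), symmetric])
    finally have 1: "tensor_map R (K n) N (\<lambda>v. \<psi> n (\<phi> n v)) z = \<dots>" .
    have "tensor_map R (K n) N (\<theta> n) z = tensor_map R (K n) N (\<lambda>v. \<delta> n (s n v)) z"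
    proof (cases n)
      case 0
      show ?thesis
        by (rule tensor_map_cong_mod[OF mod(1,1) N \<theta> module_hom_compose[OF s(1) K.\<delta>] K.x xN _ z])
          (use s(2) 0 module_hom_in[OF \<theta>] module_hom_in[OF s(1)] cl in \<open>auto simp: K.K.multiples_diff_iff[OF K.x]\<close>)
    next
      case (Suc k)
      have z': "z \<in> carrier (tensor R (K (Suc k)) N)" using z Suc by simp
      interpret Tk: tensor_product R "K (Suc k)" N using mod(1) N by (rule tensor_product.intro)
      have h: "(\<lambda>v. s k (\<delta> k v)) \<in> module_hom R (K (Suc k)) (K (Suc k))"
        by (rule module_hom_compose[OF K.\<delta> s(1)])
      have "tensor_map R (K (Suc k)) N (\<lambda>v. s k (\<delta> k v)) z
          = tensor_map R (K (Suc k)) N (s k) (tensor_map R (K k) N (\<delta> k) z)"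
        by (rule tensor_map_compose[OF mod(1,1,1) N K.\<delta> s(1) z', symmetric])
      also have "\<dots> = \<zero>\<^bsub>tensor R (K (Suc k)) N\<^esub>"
        using cyc Suc tensor_map_zero[OF mod(1,1) N s(1)] by simp
      \<comment> \<open>The homotopy has two terms; the one that starts with the differential
        disappears because \<open>z\<close> is a cycle. In degree 0 this term is absent
        altogether.\<close>
      finally have 0: "tensor_map R (K (Suc k)) N (\<lambda>v. s k (\<delta> k v)) z = \<dots>" .
      have "tensor_map R (K (Suc k)) N (\<theta> (Suc k)) z
          = tensor_map R (K (Suc k)) N (\<theta> (Suc k)) z \<ominus>\<^bsub>tensor R (K (Suc k)) N\<^esub> \<zero>\<^bsub>tensor R (K (Suc k)) N\<^esub>"
        using tensor_map_closed[OF mod(1,1) N \<theta> z'] by (simp add: Tk.T.M.minus_eq)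
      also have "\<dots> = tensor_map R (K (Suc k)) N (\<lambda>v. \<theta> (Suc k) v \<ominus>\<^bsub>K (Suc k)\<^esub> s k (\<delta> k v)) z"
        unfolding 0[symmetric] by (rule tensor_map_diff[OF mod(1,1) N \<theta> h z', symmetric])
      also have "\<dots> = tensor_map R (K (Suc k)) N (\<lambda>v. \<delta> (Suc k) (s (Suc k) v)) z"
        by (rule tensor_map_cong_mod[OF mod(1,1) N module_hom_diff[OF mod(1) \<theta> h] module_hom_compose[OF s(1) K.\<delta>] K.x xN _ z'])
          (use s(3) module_hom_in[OF \<theta>] module_hom_in[OF s(1)] cl in \<open>auto simp: K.K.multiples_diff_iff[OF K.x]\<close>)
      finally show ?thesis using Suc by simp
    qed
    also have "\<dots> = tensor_map R (K n) N (\<delta> n) (tensor_map R (K (Suc n)) N (s n) z)"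
      by (rule tensor_map_compose[OF mod(1,1,1) N s(1) K.\<delta> z, symmetric])
    finally have 2: "tensor_map R (K n) N (\<theta> n) z = \<dots>" .
    let ?a = "tensor_map R (K n) N (\<lambda>v. \<psi> n (\<phi> n v)) z"
    have a: "?a \<in> carrier (tensor R (K n) N)" by (rule tensor_map_closed[OF mod(1,1) N \<psi>\<phi> z])
    have "tensor_map R (K n) N (\<theta> n) z = tensor_map R (K n) N (\<lambda>v. v) z \<ominus>\<^bsub>tensor R (K n) N\<^esub> ?a"
      unfolding \<theta>_def by (rule tensor_map_diff[OF mod(1,1) N module_hom_id \<psi>\<phi> z])
    then have "tensor_map R (K n) N (\<theta> n) z \<oplus>\<^bsub>tensor R (K n) N\<^esub> ?a = z"
      using a z by (simp add: tensor_map_id[OF mod(1) N] Tn.T.M.minus_eq Tn.T.M.a_assoc Tn.T.M.l_neg)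
    then have "z = tensor_map R (K n) N (\<delta> n) (tensor_map R (K (Suc n)) N (s n) z
        \<oplus>\<^bsub>tensor R (K (Suc n)) N\<^esub> tensor_map R (K (Suc n)) N (\<psi> (Suc n)) w)"
      unfolding 1 2 module_hom_add[OF tensor_map_hom[OF mod(1,1) N K.\<delta>] sz \<psi>w] ..
    moreover have "tensor_map R (K (Suc n)) N (s n) z \<oplus>\<^bsub>tensor R (K (Suc n)) N\<^esub> tensor_map R (K (Suc n)) N (\<psi> (Suc n)) w
        \<in> carrier (tensor R (K (Suc n)) N)" using sz \<psi>w by (rule Tn'.T.M.a_closed)
    ultimately show "\<exists>w\<in>carrier (tensor R (K (Suc n)) N). z = tensor_map R (K n) N (\<delta> n) w" by blast
  qed
qed

section \<open>Free resolutions and Tor\<close>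

lemma (in module) multiples_0: "multiples R \<zero> M = {\<zero>\<^bsub>M\<^esub>}"
  by (auto simp: multiples_def image_iff intro: bexI[of _ "\<zero>\<^bsub>M\<^esub>"])

text \<open>Modulus \<open>\<zero>\<close> turns congruences into equalities. The index shift comes
  from naming conventions: \<open>d j\<close> is indexed by the degree of its source,
  \<open>\<delta> n\<close> by that of its target.\<close>

lemma free_resolution_resolution_mod:
  assumes M: "module R M" and F: "free_resolution R M F d"
  obtains \<epsilon> where "resolution_mod R \<zero>\<^bsub>R\<^esub> M (\<lambda>n. F (int n)) (\<lambda>n. d (int (Suc n))) \<epsilon>"
proof -
  interpret M: module R M by fact
  have F_proj: "projective R (F j)" for j
    using F free_module_projective by (auto simp: free_resolution_def)
  then have F_mod: "module R (F j)" for j by (simp add: projective_def)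
  interpret F: module R "F j" for j by (rule F_mod)
  have d: "d j \<in> module_hom R (F j) (F (j - 1))" for j
    using F by (simp add: free_resolution_def)
  have d': "d (int (Suc n)) \<in> module_hom R (F (int (Suc n))) (F (int n))" for n
    using d[of "int (Suc n)"] by simp
  obtain \<epsilon> where \<epsilon>: "\<epsilon> \<in> module_hom R (F 0) M" "\<epsilon> ` carrier (F 0) = carrier M"
      "a_kernel (F 0) M \<epsilon> = d 1 ` carrier (F 1)"
    using F by (auto simp: free_resolution_def)
  have eq: "v \<ominus>\<^bsub>F j\<^esub> u \<in> multiples R \<zero>\<^bsub>R\<^esub> (F j) \<longleftrightarrow> v = u"
    if "v \<in> carrier (F j)" "u \<in> carrier (F j)" for j v u
    using that by (simp add: F.multiples_0)
  show thesis
  proof (rule that, unfold_locales)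
    fix v assume v: "v \<in> carrier (F (int 0))"
    have "\<epsilon> v = \<zero>\<^bsub>M\<^esub> \<longleftrightarrow> (\<exists>u\<in>carrier (F 1). v = d 1 u)"
      using v \<epsilon>(3) by (auto simp: a_kernel_def' set_eq_iff image_iff)
    then show "\<epsilon> v = \<zero>\<^bsub>M\<^esub> \<longleftrightarrow>
        (\<exists>u\<in>carrier (F (int 1)). v \<ominus>\<^bsub>F (int 0)\<^esub> d (int (Suc 0)) u \<in> multiples R \<zero>\<^bsub>R\<^esub> (F (int 0)))"
      using v module_hom_in[OF d'[of 0]] by (simp add: eq)
  next
    fix n v assume v: "v \<in> carrier (F (int (Suc n)))"
    have "a_kernel (F (int (Suc n))) (F (int n)) (d (int (Suc n))) = d (int (Suc (Suc n))) ` carrier (F (int (Suc (Suc n))))"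
    proof -
      have "\<forall>j>0. a_kernel (F j) (F (j - 1)) (d j) = d (j + 1) ` carrier (F (j + 1))"
        using F by (simp add: free_resolution_def)
      from this[rule_format, of "int (Suc n)"] show ?thesis by (simp add: add.commute add.left_commute)
    qed
    then have "d (int (Suc n)) v = \<zero>\<^bsub>F (int n)\<^esub> \<longleftrightarrow> (\<exists>u\<in>carrier (F (int (Suc (Suc n)))). v = d (int (Suc (Suc n))) u)"
      using v by (auto simp: a_kernel_def' set_eq_iff image_iff)
    then show "d (int (Suc n)) v \<in> multiples R \<zero>\<^bsub>R\<^esub> (F (int n)) \<longleftrightarrow>
        (\<exists>u\<in>carrier (F (int (Suc (Suc n)))).
           v \<ominus>\<^bsub>F (int (Suc n))\<^esub> d (int (Suc (Suc n))) u \<in> multiples R \<zero>\<^bsub>R\<^esub> (F (int (Suc n))))"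
      using v module_hom_in[OF d'[of "Suc n"]] by (simp add: eq F.multiples_0 del: of_nat_Suc)
  qed (use F_proj d' \<epsilon> in simp_all)
qed

section \<open>Homology of a tensored complex\<close>

lemma module_hom_image_submodule:
  assumes A: "module R A" and B: "module R B" and f: "f \<in> module_hom R A B"
  shows "Module.submodule (f ` carrier A) R B"
proof -
  interpret A: module R A by fact
  interpret B: module R B by fact
  interpret f: mod_hom R A B f by unfold_locales (rule f)
  show ?thesis
  proof (rule B.submoduleI)
    show "\<zero>\<^bsub>B\<^esub> \<in> f ` carrier A" using f.f0_is_0 A.M.zero_closed by (metis imageI)
  next
    fix v assume "v \<in> f ` carrier A"
    then obtain a where a: "a \<in> carrier A" "v = f a" by blast
    then have "\<ominus>\<^bsub>B\<^esub> v = f (\<ominus>\<^bsub>A\<^esub> a)" by simp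
    then show "\<ominus>\<^bsub>B\<^esub> v \<in> f ` carrier A" using a(1) by blast
    fix w assume "w \<in> f ` carrier A"
    then obtain b where b: "b \<in> carrier A" "w = f b" by blast
    have "v \<oplus>\<^bsub>B\<^esub> w = f (a \<oplus>\<^bsub>A\<^esub> b)" using a b by simp
    then show "v \<oplus>\<^bsub>B\<^esub> w \<in> f ` carrier A" using a(1) b(1) by blast
  next
    fix r v assume r: "r \<in> carrier R" and "v \<in> f ` carrier A"
    then obtain a where a: "a \<in> carrier A" "v = f a" by blast
    then have "r \<odot>\<^bsub>B\<^esub> v = f (r \<odot>\<^bsub>A\<^esub> a)" using r by simp
    then show "r \<odot>\<^bsub>B\<^esub> v \<in> f ` carrier A" using a(1) r by blast
  qed auto
qed

text \<open>A coset depends only on the addition, so replacing the carrier by \<open>Z\<close>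
  leaves the cosets those of \<open>M\<close>. In \<open>homology\<close> the set \<open>Z\<close>
  is a kernel and \<open>K\<close> the image of the incoming map.\<close>

lemma zero_quotient_iff:
  assumes M: "module R M" and K: "Module.submodule K R M" and Z: "Z \<subseteq> carrier M" "\<zero>\<^bsub>M\<^esub> \<in> Z"
  shows "zero_module (quotient_module (M\<lparr>carrier := Z\<rparr>) K) \<longleftrightarrow> Z \<subseteq> K"
proof -
  interpret quotient R M K using M K by (simp add: quotient_def quotient_axioms_def)
  have coset: "K +>\<^bsub>M\<lparr>carrier := Z\<rparr>\<^esub> z = K +>\<^bsub>M\<^esub> z" for z
    by (simp add: a_r_coset_def')
  have K0: "K = K +>\<^bsub>M\<^esub> \<zero>\<^bsub>M\<^esub>" using quotient_zero by (simp add: quotient_module_def)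
  have K_iff: "K +>\<^bsub>M\<^esub> z = K \<longleftrightarrow> z \<in> K" if "z \<in> carrier M" for z
  proof -
    have "z \<ominus>\<^bsub>M\<^esub> \<zero>\<^bsub>M\<^esub> = z"
      using that by (metis M.M.minus_equality M.M.minus_eq M.M.r_zero M.M.zero_closed)
    then show ?thesis using coset_eq_iff[OF that M.M.zero_closed] K0 by metis
  qed
  have c: "carrier (quotient_module (M\<lparr>carrier := Z\<rparr>) K) = (\<lambda>z. K +>\<^bsub>M\<^esub> z) ` Z"
    by (auto simp: quotient_module_def A_RCOSETS_def' coset)
  have z: "\<zero>\<^bsub>quotient_module (M\<lparr>carrier := Z\<rparr>) K\<^esub> = K" by (simp add: quotient_module_def)
  have "(\<lambda>z. K +>\<^bsub>M\<^esub> z) ` Z = {K} \<longleftrightarrow> (\<forall>z\<in>Z. K +>\<^bsub>M\<^esub> z = K)"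
    using Z(2) by blast
  also have "\<dots> \<longleftrightarrow> Z \<subseteq> K" using K_iff Z(1) by (meson subset_iff)
  finally show ?thesis unfolding zero_module_def c z .
qed

context
  fixes R :: "('a, 'c) ring_scheme" and N :: "('a, 'n, 'e) module_scheme"
    and F :: "int \<Rightarrow> ('a, 'm, 'd) module_scheme" and d :: "int \<Rightarrow> 'm \<Rightarrow> 'm"
  assumes N: "module R N" and F: "\<And>j. module R (F j)" and F_neg: "\<And>j. j < 0 \<Longrightarrow> zero_module (F j)"
    and d: "\<And>j. d j \<in> module_hom R (F j) (F (j - 1))"
begin

abbreviation "tensor_homology \<equiv>
  homology (\<lambda>j. tensor R (F j) N) (\<lambda>j. tensor_map R (F (j - 1)) N (d j))"

interpretation T: tensor_product R "F j" N for j
  using F N by (rule tensor_product.intro)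

lemma tensor_homology_zero_iff:
  "zero_module (tensor_homology j) \<longleftrightarrow>
     (\<forall>z\<in>carrier (tensor R (F j) N).
        tensor_map R (F (j - 1)) N (d j) z = \<zero>\<^bsub>tensor R (F (j - 1)) N\<^esub> \<longrightarrow>
        z \<in> tensor_map R (F j) N (d (j + 1)) ` carrier (tensor R (F (j + 1)) N))"
proof -
  have d': "d (j + 1) \<in> module_hom R (F (j + 1)) (F j)" using d[of "j + 1"] by simp
  have "\<zero>\<^bsub>tensor R (F j) N\<^esub> \<in> a_kernel (tensor R (F j) N) (tensor R (F (j - 1)) N) (tensor_map R (F (j - 1)) N (d j))"
    using tensor_map_zero[OF F F N d] by (simp add: a_kernel_def')
  then show ?thesis unfolding homology_def
    by (subst zero_quotient_iff[OF T.tensor_module])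
      (auto simp: a_kernel_def' intro!: module_hom_image_submodule[OF T.tensor_module T.tensor_module] tensor_map_hom F N d')
qed

lemma tensor_homology_neg: "j < 0 \<Longrightarrow> zero_module (tensor_homology j)"
  unfolding tensor_homology_zero_iff
proof (intro ballI impI)
  fix z assume j: "j < 0" and z: "z \<in> carrier (tensor R (F j) N)"
  have d': "d (j + 1) \<in> module_hom R (F (j + 1)) (F j)" using d[of "j + 1"] by simp
  have "z = tensor_map R (F j) N (d (j + 1)) \<zero>\<^bsub>tensor R (F (j + 1)) N\<^esub>"
    using zero_moduleD[OF tensor_zero_module[OF F N F_neg[OF j]] z] tensor_map_zero[OF F F N d'] by simp
  then show "z \<in> tensor_map R (F j) N (d (j + 1)) ` carrier (tensor R (F (j + 1)) N)" by simp
qed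

text \<open>In degree 0 the outgoing map of the integer-indexed complex ends in a zero module, so
  its cycle condition holds automatically. This matches the vacuous premise in
  \<open>tensor_exact\<close>.\<close>

lemma tensor_homology_nat:
  "zero_module (tensor_homology (int n)) \<longleftrightarrow>
     tensor_exact R N (\<lambda>n. F (int n)) (\<lambda>n. d (int (Suc n))) n"
proof -
  have "tensor_map R (F (int n - 1)) N (d (int n)) z = \<zero>\<^bsub>tensor R (F (int n - 1)) N\<^esub> \<longleftrightarrow>
      (\<forall>k. n = Suc k \<longrightarrow> tensor_map R (F (int k)) N (d (int (Suc k))) z = \<zero>\<^bsub>tensor R (F (int k)) N\<^esub>)"
    if z: "z \<in> carrier (tensor R (F (int n)) N)" for z
  proof (cases n)
    case 0
    have zm: "zero_module (tensor R (F (int n - 1)) N)" using tensor_zero_module[OF F N F_neg] 0 by simp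
    have "tensor_map R (F (int n - 1)) N (d (int n)) z \<in> carrier (tensor R (F (int n - 1)) N)"
      by (rule tensor_map_closed[OF F F N d z])
    from zero_moduleD[OF zm this] show ?thesis using 0 by simp
  qed simp
  moreover have "int n + 1 = int (Suc n)" by simp
  ultimately show ?thesis unfolding tensor_homology_zero_iff tensor_exact_def image_iff by metis
qed

end

section \<open>Reduction modulo an element\<close>

lemma restrict_scalars_simps [simp]:
  "carrier (restrict_scalars \<phi> M) = carrier M"
  "\<zero>\<^bsub>restrict_scalars \<phi> M\<^esub> = \<zero>\<^bsub>M\<^esub>"
  "v \<oplus>\<^bsub>restrict_scalars \<phi> M\<^esub> w = v \<oplus>\<^bsub>M\<^esub> w"
  "a \<odot>\<^bsub>restrict_scalars \<phi> M\<^esub> v = \<phi> a \<odot>\<^bsub>M\<^esub> v"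
  by (simp_all add: restrict_scalars_def)

lemma restrict_scalars_minus:
  assumes "abelian_group M" "abelian_group (restrict_scalars \<phi> M)" "v \<in> carrier M" "w \<in> carrier M"
  shows "v \<ominus>\<^bsub>restrict_scalars \<phi> M\<^esub> w = v \<ominus>\<^bsub>M\<^esub> w"
proof -
  interpret M: abelian_group M by fact
  interpret M': abelian_group "restrict_scalars \<phi> M" by fact
  have "(\<ominus>\<^bsub>M\<^esub> w) \<oplus>\<^bsub>restrict_scalars \<phi> M\<^esub> w = \<zero>\<^bsub>restrict_scalars \<phi> M\<^esub>"
    using assms by (simp add: M.l_neg)
  then have "\<ominus>\<^bsub>restrict_scalars \<phi> M\<^esub> w = \<ominus>\<^bsub>M\<^esub> w"
    using assms by (intro M'.minus_equality) auto
  then show ?thesis by (simp add: a_minus_def)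
qed

text \<open>An abstract form of \<open>R = Q/(x)\<close>. The map \<open>\<rho>\<close> is a
  set-theoretic section of \<open>\<pi>\<close>, hence also witnesses that \<open>\<pi>\<close> is
  onto. Normalizing \<open>\<rho>\<close> at zero ensures that lifting coordinates keeps supports
  finite.\<close>

locale reduction = Q: cring Q + R: cring R
  for Q :: "('a, 'c) ring_scheme" and R :: "('b, 'd) ring_scheme" and x and \<pi> and \<rho> +
  assumes x: "x \<in> carrier Q"
    and \<pi>: "\<pi> \<in> ring_hom Q R"
    and kernel: "q \<in> carrier Q \<Longrightarrow> \<pi> q = \<zero>\<^bsub>R\<^esub> \<longleftrightarrow> (\<exists>y\<in>carrier Q. q = x \<otimes>\<^bsub>Q\<^esub> y)"
    and \<rho>: "a \<in> carrier R \<Longrightarrow> \<rho> a \<in> carrier Q" "a \<in> carrier R \<Longrightarrow> \<pi> (\<rho> a) = a"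
    and \<rho>_zero: "\<rho> \<zero>\<^bsub>R\<^esub> = \<zero>\<^bsub>Q\<^esub>"
begin

lemma \<pi>_closed [simp]: "q \<in> carrier Q \<Longrightarrow> \<pi> q \<in> carrier R"
  by (rule ring_hom_closed[OF \<pi>])

lemma \<pi>_simps [simp]:
  "q \<in> carrier Q \<Longrightarrow> q' \<in> carrier Q \<Longrightarrow> \<pi> (q \<oplus>\<^bsub>Q\<^esub> q') = \<pi> q \<oplus>\<^bsub>R\<^esub> \<pi> q'"
  "q \<in> carrier Q \<Longrightarrow> q' \<in> carrier Q \<Longrightarrow> \<pi> (q \<otimes>\<^bsub>Q\<^esub> q') = \<pi> q \<otimes>\<^bsub>R\<^esub> \<pi> q'"
  "\<pi> \<one>\<^bsub>Q\<^esub> = \<one>\<^bsub>R\<^esub>" "\<pi> \<zero>\<^bsub>Q\<^esub> = \<zero>\<^bsub>R\<^esub>"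
  using ring_hom_zero[OF \<pi> Q.ring_axioms R.ring_axioms]
  by (simp_all add: ring_hom_add[OF \<pi>] ring_hom_mult[OF \<pi>] ring_hom_one[OF \<pi>])

lemma \<pi>_minus: "q \<in> carrier Q \<Longrightarrow> q' \<in> carrier Q \<Longrightarrow> \<pi> (q \<ominus>\<^bsub>Q\<^esub> q') = \<pi> q \<ominus>\<^bsub>R\<^esub> \<pi> q'"
proof -
  interpret \<pi>: ring_hom_cring Q R \<pi> by unfold_locales (rule \<pi>)
  show "q \<in> carrier Q \<Longrightarrow> q' \<in> carrier Q \<Longrightarrow> \<pi> (q \<ominus>\<^bsub>Q\<^esub> q') = \<pi> q \<ominus>\<^bsub>R\<^esub> \<pi> q'"
    by (simp add: a_minus_def)
qed

lemma \<pi>_x: "\<pi> x = \<zero>\<^bsub>R\<^esub>"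
  using kernel[OF x] x by (auto intro!: bexI[of _ "\<one>\<^bsub>Q\<^esub>"])

section \<open>Modules over \<open>R\<close> as modules over \<open>Q\<close> killed by
  \<open>x\<close>\<close>

lemma restrict_module:
  assumes "module R M"
  shows "module Q (restrict_scalars \<pi> M)"
proof -
  interpret M: module R M by fact
  have "\<exists>w\<in>carrier M. w \<oplus>\<^bsub>M\<^esub> v = \<zero>\<^bsub>M\<^esub>" if "v \<in> carrier M" for v
    using that by (intro bexI[of _ "\<ominus>\<^bsub>M\<^esub> v"]) (simp_all add: M.M.l_neg)
  then have "abelian_group (restrict_scalars \<pi> M)"
    by (intro abelian_groupI) (auto simp: M.M.a_ac)
  then show ?thesis
    by (intro moduleI Q.is_cring) (auto simp: M.smult_l_distr M.smult_r_distr M.smult_assoc1)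
qed

lemma restrict_hom: "f \<in> module_hom R A B \<Longrightarrow> f \<in> module_hom Q (restrict_scalars \<pi> A) (restrict_scalars \<pi> B)"
  by (auto simp: module_hom_def)

lemma restrict_kill:
  assumes "module R M" "v \<in> carrier M"
  shows "x \<odot>\<^bsub>restrict_scalars \<pi> M\<^esub> v = \<zero>\<^bsub>restrict_scalars \<pi> M\<^esub>"
proof -
  interpret M: module R M by fact
  show ?thesis using assms(2) by (simp add: \<pi>_x)
qed

text \<open>A \<open>Q\<close>-module killed by \<open>x\<close> becomes an \<open>R\<close>-module by restriction along \<open>\<rho>\<close>, although
  \<open>\<rho>\<close> is not a homomorphism.\<close>

context
  fixes X :: "('a, 'm) module"
  assumes X: "module Q X" and xX: "\<And>v. v \<in> carrier X \<Longrightarrow> x \<odot>\<^bsub>X\<^esub> v = \<zero>\<^bsub>X\<^esub>"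
begin

interpretation X: module Q X by (rule X)

text \<open>Elements of \<open>Q\<close> with the same image differ by a multiple of
  \<open>x\<close>, which acts as zero on \<open>X\<close>. The failure of \<open>\<rho>\<close> to
  respect sums and products is thus invisible on \<open>X\<close>.\<close>

lemma smult_cong:
  assumes q: "q \<in> carrier Q" "q' \<in> carrier Q" "\<pi> q = \<pi> q'" and v: "v \<in> carrier X"
  shows "q \<odot>\<^bsub>X\<^esub> v = q' \<odot>\<^bsub>X\<^esub> v"
proof -
  have "\<pi> (q \<ominus>\<^bsub>Q\<^esub> q') = \<zero>\<^bsub>R\<^esub>"
    using q by (simp add: \<pi>_minus R.minus_eq R.r_neg)
  then obtain y where y: "y \<in> carrier Q" "q \<ominus>\<^bsub>Q\<^esub> q' = x \<otimes>\<^bsub>Q\<^esub> y"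
    using kernel q Q.minus_closed by blast
  have "q = (q \<ominus>\<^bsub>Q\<^esub> q') \<oplus>\<^bsub>Q\<^esub> q'"
    using q by (simp add: Q.minus_eq Q.a_assoc Q.l_neg)
  then have "q \<odot>\<^bsub>X\<^esub> v = (x \<otimes>\<^bsub>Q\<^esub> y \<oplus>\<^bsub>Q\<^esub> q') \<odot>\<^bsub>X\<^esub> v" using y(2) by simp
  also have "\<dots> = x \<odot>\<^bsub>X\<^esub> (y \<odot>\<^bsub>X\<^esub> v) \<oplus>\<^bsub>X\<^esub> q' \<odot>\<^bsub>X\<^esub> v"
    using x y(1) q v by (simp add: X.smult_l_distr X.smult_assoc1)
  also have "\<dots> = q' \<odot>\<^bsub>X\<^esub> v" using xX y(1) q v by simp
  finally show ?thesis .
qed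

lemma induced_module: "module R (restrict_scalars \<rho> X)"
proof -
  have "\<exists>w\<in>carrier X. w \<oplus>\<^bsub>X\<^esub> v = \<zero>\<^bsub>X\<^esub>" if "v \<in> carrier X" for v
    using that by (intro bexI[of _ "\<ominus>\<^bsub>X\<^esub> v"]) (simp_all add: X.M.l_neg)
  then have "abelian_group (restrict_scalars \<rho> X)"
    by (intro abelian_groupI) (auto simp: X.M.a_ac)
  moreover have "\<rho> (a \<oplus>\<^bsub>R\<^esub> b) \<odot>\<^bsub>X\<^esub> v = \<rho> a \<odot>\<^bsub>X\<^esub> v \<oplus>\<^bsub>X\<^esub> \<rho> b \<odot>\<^bsub>X\<^esub> v"
    if "a \<in> carrier R" "b \<in> carrier R" "v \<in> carrier X" for a b v
  proof -
    have "\<rho> (a \<oplus>\<^bsub>R\<^esub> b) \<odot>\<^bsub>X\<^esub> v = (\<rho> a \<oplus>\<^bsub>Q\<^esub> \<rho> b) \<odot>\<^bsub>X\<^esub> v"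
      by (rule smult_cong) (use that \<rho> in simp_all)
    then show ?thesis using that \<rho> by (simp add: X.smult_l_distr)
  qed
  moreover have "\<rho> (a \<otimes>\<^bsub>R\<^esub> b) \<odot>\<^bsub>X\<^esub> v = \<rho> a \<odot>\<^bsub>X\<^esub> (\<rho> b \<odot>\<^bsub>X\<^esub> v)"
    if "a \<in> carrier R" "b \<in> carrier R" "v \<in> carrier X" for a b v
  proof -
    have "\<rho> (a \<otimes>\<^bsub>R\<^esub> b) \<odot>\<^bsub>X\<^esub> v = (\<rho> a \<otimes>\<^bsub>Q\<^esub> \<rho> b) \<odot>\<^bsub>X\<^esub> v"
      by (rule smult_cong) (use that \<rho> in simp_all)
    then show ?thesis using that \<rho> by (simp add: X.smult_assoc1)
  qed
  moreover have "\<rho> \<one>\<^bsub>R\<^esub> \<odot>\<^bsub>X\<^esub> v = v" if "v \<in> carrier X" for v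
    using smult_cong[of "\<rho> \<one>\<^bsub>R\<^esub>" "\<one>\<^bsub>Q\<^esub>" v] \<rho> that by simp
  ultimately show ?thesis
    by (intro moduleI R.is_cring) (simp_all add: \<rho> X.smult_r_distr)
qed

text \<open>The scalars \<open>\<rho> (\<pi> q)\<close> and \<open>q\<close> have the same image in
  \<open>R\<close>, so they act alike on \<open>X\<close>.\<close>

lemma induced_hom:
  assumes "f \<in> module_hom R A (restrict_scalars \<rho> X)" "module R A"
  shows "f \<in> module_hom Q (restrict_scalars \<pi> A) X"
proof (rule module_homI)
  fix q v assume q: "q \<in> carrier Q" and v: "v \<in> carrier (restrict_scalars \<pi> A)"
  have fv: "f v \<in> carrier X" using module_hom_in[OF assms(1)] v by simp
  have "f (\<pi> q \<odot>\<^bsub>A\<^esub> v) = \<rho> (\<pi> q) \<odot>\<^bsub>X\<^esub> f v"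
    using module_hom_smult[OF assms(1)] q v by simp
  also have "\<dots> = q \<odot>\<^bsub>X\<^esub> f v" by (rule smult_cong) (use q fv \<rho> in simp_all)
  finally show "f (q \<odot>\<^bsub>restrict_scalars \<pi> A\<^esub> v) = q \<odot>\<^bsub>X\<^esub> f v" by simp
qed (use module_hom_in[OF assms(1)] module_hom_add[OF assms(1)] in auto)

end

lemma section_hom: "f \<in> module_hom Q A B \<Longrightarrow> f \<in> module_hom R (restrict_scalars \<rho> A) (restrict_scalars \<rho> B)"
  by (auto simp: module_hom_def \<rho>)

section \<open>Reduction and lifting of free modules\<close>

definition red :: "('i \<Rightarrow> 'a) \<Rightarrow> 'i \<Rightarrow> 'b" where
  "red c = (\<lambda>b. \<pi> (c b))"

text \<open>A section of \<open>red\<close> on elements, linear only up to multiples of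
  \<open>x\<close>.\<close>

definition lft :: "('i \<Rightarrow> 'b) \<Rightarrow> 'i \<Rightarrow> 'a" where
  "lft c = (\<lambda>b. \<rho> (c b))"

lemma red_closed:
  assumes "c \<in> carrier (free_on Q B)"
  shows "red c \<in> carrier (free_on R B)"
proof -
  have "finite {b. \<pi> (c b) \<noteq> \<zero>\<^bsub>R\<^esub>}"
    by (rule finite_subset[of _ "{b. c b \<noteq> \<zero>\<^bsub>Q\<^esub>}"]) (use assms in \<open>auto simp: free_on_simps\<close>)
  moreover have "b \<in> B" if "\<pi> (c b) \<noteq> \<zero>\<^bsub>R\<^esub>" for b
  proof -
    have "c b \<noteq> \<zero>\<^bsub>Q\<^esub>" using that by auto
    then show ?thesis using assms by (simp add: free_on_simps)
  qed
  ultimately show ?thesis using assms by (simp add: red_def free_on_simps)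
qed

lemma lft_closed:
  assumes "c \<in> carrier (free_on R B)"
  shows "lft c \<in> carrier (free_on Q B)"
proof -
  have "finite {b. \<rho> (c b) \<noteq> \<zero>\<^bsub>Q\<^esub>}"
    by (rule finite_subset[of _ "{b. c b \<noteq> \<zero>\<^bsub>R\<^esub>}"]) (use assms in \<open>auto simp: free_on_simps \<rho>_zero\<close>)
  moreover have "b \<in> B" if "\<rho> (c b) \<noteq> \<zero>\<^bsub>Q\<^esub>" for b
  proof -
    have "c b \<noteq> \<zero>\<^bsub>R\<^esub>" using that by (auto simp: \<rho>_zero)
    then show ?thesis using assms by (simp add: free_on_simps)
  qed
  ultimately show ?thesis using assms by (simp add: lft_def free_on_simps \<rho>)
qed

lemma red_lft: "c \<in> carrier (free_on R B) \<Longrightarrow> red (lft c) = c"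
  by (auto simp: red_def lft_def free_on_simps \<rho>)

lemma red_hom: "red \<in> module_hom Q (free_on Q B) (restrict_scalars \<pi> (free_on R B))"
  by (rule module_homI) (simp_all add: red_closed, auto simp: red_def free_on_simps)

lemma red_unit_vec: "red (unit_vec Q b) = unit_vec R b"
  by (auto simp: red_def unit_vec_def)

lemma red_zero_iff:
  assumes c: "c \<in> carrier (free_on Q B)"
  shows "red c = \<zero>\<^bsub>free_on R B\<^esub> \<longleftrightarrow> c \<in> multiples Q x (free_on Q B)"
proof
  assume "red c = \<zero>\<^bsub>free_on R B\<^esub>"
  then have "\<pi> (c b) = \<zero>\<^bsub>R\<^esub>" for b by (simp add: red_def free_on_simps fun_eq_iff)
  then have "\<exists>y\<in>carrier Q. c b = x \<otimes>\<^bsub>Q\<^esub> y" for b using c kernel by (simp add: free_on_simps)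
  \<comment> \<open>The cofactor is taken to be zero wherever \<open>c\<close> is, so that the
    cofactors together have finite support.\<close>
  then have "\<exists>y\<in>carrier Q. c b = x \<otimes>\<^bsub>Q\<^esub> y \<and> (c b = \<zero>\<^bsub>Q\<^esub> \<longrightarrow> y = \<zero>\<^bsub>Q\<^esub>)" for b
    using x by (cases "c b = \<zero>\<^bsub>Q\<^esub>") auto
  then obtain y where y: "\<And>b. y b \<in> carrier Q" "\<And>b. c b = x \<otimes>\<^bsub>Q\<^esub> y b" "\<And>b. c b = \<zero>\<^bsub>Q\<^esub> \<Longrightarrow> y b = \<zero>\<^bsub>Q\<^esub>"
    by metis
  have "finite {b. y b \<noteq> \<zero>\<^bsub>Q\<^esub>}"
    by (rule finite_subset[of _ "{b. c b \<noteq> \<zero>\<^bsub>Q\<^esub>}"]) (use c y(3) in \<open>auto simp: free_on_simps\<close>)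
  then have "y \<in> carrier (free_on Q B)" using c y(1,3) by (auto simp: free_on_simps)
  moreover have "c = x \<odot>\<^bsub>free_on Q B\<^esub> y" using y(2) by (simp add: free_on_simps fun_eq_iff)
  ultimately show "c \<in> multiples Q x (free_on Q B)" by (simp add: multiples_def)
next
  assume "c \<in> multiples Q x (free_on Q B)"
  then obtain y where "y \<in> carrier (free_on Q B)" "c = x \<odot>\<^bsub>free_on Q B\<^esub> y" by (auto simp: multiples_def)
  then show "red c = \<zero>\<^bsub>free_on R B\<^esub>" using x by (simp add: red_def free_on_simps \<pi>_x)
qed

text \<open>The dictionary between equality over \<open>R\<close> and congruence modulo
  \<open>x\<close> over \<open>Q\<close>; exactness is carried across by it.\<close>

lemma red_eq_iff:
  assumes c: "c \<in> carrier (free_on Q B)" "c' \<in> carrier (free_on Q B)"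
  shows "red c = red c' \<longleftrightarrow> c \<ominus>\<^bsub>free_on Q B\<^esub> c' \<in> multiples Q x (free_on Q B)"
proof -
  interpret F: module Q "free_on Q B" by (rule Q.free_on_module)
  interpret F': module R "free_on R B" by (rule R.free_on_module)
  have m: "module Q (restrict_scalars \<pi> (free_on R B))" by (rule restrict_module[OF F'.module_M])
  then interpret G: module Q "restrict_scalars \<pi> (free_on R B)" .
  have "red (c \<ominus>\<^bsub>free_on Q B\<^esub> c') = red c \<ominus>\<^bsub>free_on R B\<^esub> red c'"
    using module_hom_minus[OF F.module_M m red_hom c]
      restrict_scalars_minus[OF F'.M.abelian_group_axioms G.M.abelian_group_axioms red_closed[OF c(1)] red_closed[OF c(2)]] by simp
  then have "red c = red c' \<longleftrightarrow> red (c \<ominus>\<^bsub>free_on Q B\<^esub> c') = \<zero>\<^bsub>free_on R B\<^esub>"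
    using red_closed[OF c(1)] red_closed[OF c(2)] by simp
  also have "\<dots> \<longleftrightarrow> c \<ominus>\<^bsub>free_on Q B\<^esub> c' \<in> multiples Q x (free_on Q B)"
    by (rule red_zero_iff[OF F.M.minus_closed[OF c]])
  finally show ?thesis .
qed

text \<open>Only the values on basis vectors are lifted and then extended linearly. The result is a
  genuine homomorphism over \<open>Q\<close>, which \<open>lft\<close> composed with
  \<open>f\<close> would not give.\<close>

definition lft_hom :: "'j set \<Rightarrow> (('i \<Rightarrow> 'b) \<Rightarrow> 'j \<Rightarrow> 'b) \<Rightarrow> ('i \<Rightarrow> 'a) \<Rightarrow> 'j \<Rightarrow> 'a" where
  "lft_hom B' f = lin_ext Q (free_on Q B') (\<lambda>b. lft (f (unit_vec R b)))"

context
  fixes f :: "('i \<Rightarrow> 'b) \<Rightarrow> 'j \<Rightarrow> 'b" and B :: "'i set" and B' :: "'j set"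
  assumes f: "f \<in> module_hom R (free_on R B) (free_on R B')"
begin

lemma lft_unit_closed: "b \<in> B \<Longrightarrow> lft (f (unit_vec R b)) \<in> carrier (free_on Q B')"
  by (rule lft_closed[OF module_hom_in[OF f R.unit_vec_closed]])

lemma lft_hom_hom: "lft_hom B' f \<in> module_hom Q (free_on Q B) (free_on Q B')"
  unfolding lft_hom_def by (rule Q.lin_ext_hom[OF Q.free_on_module]) (use lft_unit_closed in blast)

lemma red_lft_hom:
  assumes c: "c \<in> carrier (free_on Q B)"
  shows "red (lft_hom B' f c) = f (red c)"
proof (rule Q.hom_eq_on_units[OF restrict_module[OF R.free_on_module] module_hom_compose[OF lft_hom_hom red_hom]
      module_hom_compose[OF red_hom restrict_hom[OF f]] _ c])
  fix b assume b: "b \<in> B"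
  have "lft_hom B' f (unit_vec Q b) = lft (f (unit_vec R b))"
    unfolding lft_hom_def by (rule Q.lin_ext_unit_vec[OF Q.free_on_module]) (rule lft_unit_closed[OF b])
  then show "red (lft_hom B' f (unit_vec Q b)) = f (red (unit_vec Q b))"
    using red_lft[OF module_hom_in[OF f R.unit_vec_closed[OF b]]] by (simp add: red_unit_vec)
qed

end

text \<open>Exactness over \<open>R\<close> and exactness modulo \<open>x\<close> over
  \<open>Q\<close> are one statement read through \<open>red\<close>: reduction is onto, intertwines
  the lifted and the original differentials, and vanishes precisely on multiples of
  \<open>x\<close>.\<close>

lemma lift_resolution:
  assumes res: "resolution_mod R \<zero>\<^bsub>R\<^esub> M (\<lambda>n. free_on R (B n)) \<delta> \<epsilon>"
  shows "resolution_mod Q x (restrict_scalars \<pi> M) (\<lambda>n. free_on Q (B n))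
           (\<lambda>n. lft_hom (B n) (\<delta> n)) (\<lambda>c. \<epsilon> (red c))"
proof -
  interpret P: resolution_mod R "\<zero>\<^bsub>R\<^esub>" M "\<lambda>n. free_on R (B n)" \<delta> \<epsilon> by fact
  interpret M': module Q "restrict_scalars \<pi> M" by (rule restrict_module[OF P.M.module_M])
  interpret F: module Q "free_on Q (B n)" for n by (rule Q.free_on_module)
  have eq: "v \<ominus>\<^bsub>free_on R (B n)\<^esub> u \<in> multiples R \<zero>\<^bsub>R\<^esub> (free_on R (B n)) \<longleftrightarrow> v = u"
    if "v \<in> carrier (free_on R (B n))" "u \<in> carrier (free_on R (B n))" for n u v
    using that by (simp add: P.K.multiples_0)
  have ex: "(\<exists>u\<in>carrier (free_on R (B (Suc n))). red v \<ominus>\<^bsub>free_on R (B n)\<^esub> \<delta> n u \<in> multiples R \<zero>\<^bsub>R\<^esub> (free_on R (B n))) \<longleftrightarrow>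
      (\<exists>u\<in>carrier (free_on Q (B (Suc n))). v \<ominus>\<^bsub>free_on Q (B n)\<^esub> lft_hom (B n) (\<delta> n) u \<in> multiples Q x (free_on Q (B n)))"
    if v: "v \<in> carrier (free_on Q (B n))" for v n
  proof -
    have "(\<exists>u\<in>carrier (free_on R (B (Suc n))). red v \<ominus>\<^bsub>free_on R (B n)\<^esub> \<delta> n u \<in> multiples R \<zero>\<^bsub>R\<^esub> (free_on R (B n)))
        \<longleftrightarrow> (\<exists>u\<in>carrier (free_on R (B (Suc n))). red v = \<delta> n u)"
      using eq[OF red_closed[OF v] P.\<delta>_in] by blast
    also have "\<dots> \<longleftrightarrow> (\<exists>u\<in>carrier (free_on Q (B (Suc n))). red v = \<delta> n (red u))"
      by (metis red_lft lft_closed red_closed)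
    also have "\<dots> \<longleftrightarrow> (\<exists>u\<in>carrier (free_on Q (B (Suc n))). red v = red (lft_hom (B n) (\<delta> n) u))"
      by (rule bex_cong) (simp_all add: red_lft_hom[OF P.\<delta>])
    also have "\<dots> \<longleftrightarrow> (\<exists>u\<in>carrier (free_on Q (B (Suc n))). v \<ominus>\<^bsub>free_on Q (B n)\<^esub> lft_hom (B n) (\<delta> n) u \<in> multiples Q x (free_on Q (B n)))"
      by (rule bex_cong) (simp_all add: red_eq_iff[OF v module_hom_in[OF lft_hom_hom[OF P.\<delta>]]])
    finally show ?thesis .
  qed
  show ?thesis
  proof unfold_locales
    show "x \<in> carrier Q" by (rule x)
    show "projective Q (free_on Q (B n))" for n by (rule free_module_projective[OF Q.free_on_free])
    show "lft_hom (B n) (\<delta> n) \<in> module_hom Q (free_on Q (B (Suc n))) (free_on Q (B n))" for n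
      by (rule lft_hom_hom[OF P.\<delta>])
    show "(\<lambda>c. \<epsilon> (red c)) \<in> module_hom Q (free_on Q (B 0)) (restrict_scalars \<pi> M)"
      by (rule module_hom_compose[OF red_hom restrict_hom[OF P.\<epsilon>]])
    show "(\<lambda>c. \<epsilon> (red c)) ` carrier (free_on Q (B 0)) = carrier (restrict_scalars \<pi> M)"
    proof -
      have "red ` carrier (free_on Q (B 0)) = carrier (free_on R (B 0))"
      proof (intro equalityI subsetI)
        fix c assume c: "c \<in> carrier (free_on R (B 0))"
        show "c \<in> red ` carrier (free_on Q (B 0))"
          using red_lft[OF c] lft_closed[OF c] by (metis imageI)
      qed (auto intro: red_closed)
      then show ?thesis using P.surj by (simp add: image_image[symmetric])
    qed
  next
    fix v assume v: "v \<in> carrier (free_on Q (B 0))"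
    show "\<epsilon> (red v) = \<zero>\<^bsub>restrict_scalars \<pi> M\<^esub> \<longleftrightarrow>
        (\<exists>u\<in>carrier (free_on Q (B 1)). v \<ominus>\<^bsub>free_on Q (B 0)\<^esub> lft_hom (B 0) (\<delta> 0) u \<in> multiples Q x (free_on Q (B 0)))"
      using P.exact_0[OF red_closed[OF v]] ex[OF v] by simp
  next
    fix v n assume v: "v \<in> carrier (free_on Q (B (Suc n)))"
    have dv: "lft_hom (B n) (\<delta> n) v \<in> carrier (free_on Q (B n))"
      by (rule module_hom_in[OF lft_hom_hom[OF P.\<delta>] v])
    have "lft_hom (B n) (\<delta> n) v \<in> multiples Q x (free_on Q (B n)) \<longleftrightarrow>
        \<delta> n (red v) \<in> multiples R \<zero>\<^bsub>R\<^esub> (free_on R (B n))"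
      unfolding red_zero_iff[OF dv, symmetric] red_lft_hom[OF P.\<delta> v] P.K.multiples_0 by simp
    then show "lft_hom (B n) (\<delta> n) v \<in> multiples Q x (free_on Q (B n)) \<longleftrightarrow>
        (\<exists>u\<in>carrier (free_on Q (B (Suc (Suc n)))).
           v \<ominus>\<^bsub>free_on Q (B (Suc n))\<^esub> lft_hom (B (Suc n)) (\<delta> (Suc n)) u \<in> multiples Q x (free_on Q (B (Suc n))))"
      using P.exact_Suc[OF red_closed[OF v]] ex[OF v] by simp
  qed
qed

section \<open>Tensor products over \<open>Q\<close> and over \<open>R\<close>\<close>

context
  fixes N :: "('b, 'n) module" and B :: "'i set"
  assumes N: "module R N"
begin

abbreviation (input) "N' \<equiv> restrict_scalars \<pi> N"
abbreviation (input) "TQ \<equiv> tensor Q (free_on Q B) N'"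
abbreviation (input) "TR \<equiv> tensor R (free_on R B) N"

interpretation N: module R N by (rule N)
interpretation N': module Q "N'" by (rule restrict_module[OF N])
interpretation TR: tensor_product R "free_on R B" N
  using R.free_on_module N by (rule tensor_product.intro)
interpretation TQ: tensor_product Q "free_on Q B" "N'"
  using Q.free_on_module N'.module_M by (rule tensor_product.intro)

lemma kill_tensor: "z \<in> carrier TQ \<Longrightarrow> x \<odot>\<^bsub>TQ\<^esub> z = \<zero>\<^bsub>TQ\<^esub>"
proof (rule TQ.hom_eq_on_pure_tensors[OF TQ.tensor_module TQ.T.smult_hom[OF x module_hom_id] module_hom_const_zero[OF TQ.tensor_module]])
  fix c n assume cn: "c \<in> carrier (free_on Q B)" "n \<in> carrier N'"
  have "x \<odot>\<^bsub>TQ\<^esub> pure_tensor Q (free_on Q B) N' c n = pure_tensor Q (free_on Q B) N' c (x \<odot>\<^bsub>N'\<^esub> n)"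
    using cn x TQ.pure_tensor(4) by simp
  also have "\<dots> = pure_tensor Q (free_on Q B) N' c (\<zero>\<^bsub>Q\<^esub> \<odot>\<^bsub>N'\<^esub> n)"
    using cn by (simp add: \<pi>_x)
  also have "\<dots> = \<zero>\<^bsub>Q\<^esub> \<odot>\<^bsub>TQ\<^esub> pure_tensor Q (free_on Q B) N' c n"
    by (rule TQ.pure_tensor(4)[OF Q.zero_closed cn])
  also have "\<dots> = \<zero>\<^bsub>TQ\<^esub>" using cn by (simp add: TQ.pure_tensor_closed)
  finally show "x \<odot>\<^bsub>TQ\<^esub> pure_tensor Q (free_on Q B) N' c n = \<zero>\<^bsub>TQ\<^esub>" .
qed

lemmas TQ_induced = induced_module[OF TQ.tensor_module kill_tensor]

text \<open>The two elements differ by \<open>x y\<close>, whose pure tensor with \<open>n\<close>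
  is zero. Hence pure tensors over \<open>Q\<close> depend on the first factor only through its
  reduction.\<close>

lemma pure_tensor_red_cong:
  assumes c: "c \<in> carrier (free_on Q B)" "c' \<in> carrier (free_on Q B)" "red c = red c'" and n: "n \<in> carrier N"
  shows "pure_tensor Q (free_on Q B) N' c n = pure_tensor Q (free_on Q B) N' c' n"
proof -
  let ?t = "pure_tensor Q (free_on Q B) N'"
  have n': "n \<in> carrier N'" using n by simp
  have "c \<ominus>\<^bsub>free_on Q B\<^esub> c' \<in> multiples Q x (free_on Q B)" using red_eq_iff[OF c(1,2)] c(3) by simp
  then obtain y where y: "y \<in> carrier (free_on Q B)" "c = c' \<oplus>\<^bsub>free_on Q B\<^esub> x \<odot>\<^bsub>free_on Q B\<^esub> y"
    using TQ.A.multiples_diff_iff[OF x c(1,2)] by blast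
  have "?t c n = ?t c' n \<oplus>\<^bsub>TQ\<^esub> x \<odot>\<^bsub>TQ\<^esub> ?t y n"
    unfolding y(2) using TQ.pure_tensor(1)[OF c(2) TQ.A.smult_closed[OF x y(1)] n'] TQ.pure_tensor(3)[OF x y(1) n'] by simp
  then show ?thesis
    using kill_tensor[OF TQ.pure_tensor_closed[OF y(1) n']] TQ.pure_tensor_closed[OF c(2) n'] by simp
qed

definition "tensor_red =
  tensor_lift Q (restrict_scalars \<pi> TR) (\<lambda>c n. pure_tensor R (free_on R B) N (red c) n)"

text \<open>The inverse direction of \<open>tensor_red\<close>. Its target is killed by
  \<open>x\<close>, so it is a module over \<open>R\<close> through \<open>\<rho>\<close>, and the
  universal property over \<open>R\<close> applies.\<close>

definition "tensor_lft =
  tensor_lift R (restrict_scalars \<rho> TQ) (\<lambda>c n. pure_tensor Q (free_on Q B) N' (lft c) n)"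

lemma tensor_red:
  "tensor_red \<in> module_hom Q TQ (restrict_scalars \<pi> TR)"
  "c \<in> carrier (free_on Q B) \<Longrightarrow> n \<in> carrier N \<Longrightarrow>
     tensor_red (pure_tensor Q (free_on Q B) N' c n) = pure_tensor R (free_on R B) N (red c) n"
proof -
  have "bilinear Q (free_on Q B) N' (restrict_scalars \<pi> TR) (\<lambda>c n. pure_tensor R (free_on R B) N (red c) n)"
    unfolding bilinear_def
  proof (intro conjI ballI)
    fix n assume "n \<in> carrier N'"
    then have "(\<lambda>c. pure_tensor R (free_on R B) N c n) \<in> module_hom R (free_on R B) TR"
      using TR.pure_tensor_bilinear by (simp add: bilinear_def)
    then show "(\<lambda>c. pure_tensor R (free_on R B) N (red c) n) \<in> module_hom Q (free_on Q B) (restrict_scalars \<pi> TR)"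
      by (intro module_hom_compose[OF red_hom] restrict_hom)
  next
    fix c assume c: "c \<in> carrier (free_on Q B)"
    then have "pure_tensor R (free_on R B) N (red c) \<in> module_hom R N TR"
      using TR.pure_tensor_bilinear red_closed[OF c] by (simp add: bilinear_def)
    then show "pure_tensor R (free_on R B) N (red c) \<in> module_hom Q N' (restrict_scalars \<pi> TR)"
      by (rule restrict_hom)
  qed
  from TQ.tensor_lift[OF restrict_module[OF TR.tensor_module] this]
  show "tensor_red \<in> module_hom Q TQ (restrict_scalars \<pi> TR)"
    "c \<in> carrier (free_on Q B) \<Longrightarrow> n \<in> carrier N \<Longrightarrow>
      tensor_red (pure_tensor Q (free_on Q B) N' c n) = pure_tensor R (free_on R B) N (red c) n"
    by (simp_all add: tensor_red_def)
qed

text \<open>Although \<open>lft\<close> is linear only modulo \<open>x\<close>, the assignment is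
  bilinear: both sides of each law in the first argument have the same reduction, so
  \<open>pure_tensor_red_cong\<close> identifies their pure tensors.\<close>

lemma tensor_lft:
  "tensor_lft \<in> module_hom R TR (restrict_scalars \<rho> TQ)"
  "c \<in> carrier (free_on R B) \<Longrightarrow> n \<in> carrier N \<Longrightarrow>
     tensor_lft (pure_tensor R (free_on R B) N c n) = pure_tensor Q (free_on Q B) N' (lft c) n"
proof -
  let ?t = "pure_tensor Q (free_on Q B) N'"
  have t: "?t c n \<in> carrier TQ" if "c \<in> carrier (free_on Q B)" "n \<in> carrier N" for c n
    using TQ.pure_tensor_closed that by simp
  have red: "red \<in> module_hom Q (free_on Q B) (restrict_scalars \<pi> (free_on R B))" by (rule red_hom)
  have "bilinear R (free_on R B) N (restrict_scalars \<rho> TQ) (\<lambda>c n. ?t (lft c) n)"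
    unfolding bilinear_def
  proof (intro conjI ballI)
    fix n assume n: "n \<in> carrier N"
    then have n': "n \<in> carrier N'" by simp
    show "(\<lambda>c. ?t (lft c) n) \<in> module_hom R (free_on R B) (restrict_scalars \<rho> TQ)"
    proof (rule module_homI)
      fix c c' assume c: "c \<in> carrier (free_on R B)" "c' \<in> carrier (free_on R B)"
      have "?t (lft (c \<oplus>\<^bsub>free_on R B\<^esub> c')) n = ?t (lft c \<oplus>\<^bsub>free_on Q B\<^esub> lft c') n"
        by (rule pure_tensor_red_cong)
          (use c n in \<open>simp_all add: lft_closed red_lft[OF TR.A.M.a_closed] red_lft module_hom_add[OF red]\<close>)
      then show "?t (lft (c \<oplus>\<^bsub>free_on R B\<^esub> c')) n = ?t (lft c) n \<oplus>\<^bsub>restrict_scalars \<rho> TQ\<^esub> ?t (lft c') n"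
        using TQ.pure_tensor(1)[OF lft_closed[OF c(1)] lft_closed[OF c(2)] n'] by simp
    next
      fix a c assume a: "a \<in> carrier R" and c: "c \<in> carrier (free_on R B)"
      have "?t (lft (a \<odot>\<^bsub>free_on R B\<^esub> c)) n = ?t (\<rho> a \<odot>\<^bsub>free_on Q B\<^esub> lft c) n"
        by (rule pure_tensor_red_cong)
          (use a c n in \<open>simp_all add: lft_closed red_lft[OF TR.A.smult_closed] red_lft module_hom_smult[OF red] \<rho>\<close>)
      then show "?t (lft (a \<odot>\<^bsub>free_on R B\<^esub> c)) n = a \<odot>\<^bsub>restrict_scalars \<rho> TQ\<^esub> ?t (lft c) n"
        using TQ.pure_tensor(3)[OF \<rho>(1)[OF a] lft_closed[OF c] n'] by simp
    qed (simp add: t[OF lft_closed n])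
  next
    fix c assume c: "c \<in> carrier (free_on R B)"
    show "?t (lft c) \<in> module_hom R N (restrict_scalars \<rho> TQ)"
    proof (rule module_homI)
      fix n n' assume "n \<in> carrier N" "n' \<in> carrier N"
      then show "?t (lft c) (n \<oplus>\<^bsub>N\<^esub> n') = ?t (lft c) n \<oplus>\<^bsub>restrict_scalars \<rho> TQ\<^esub> ?t (lft c) n'"
        using TQ.pure_tensor(2)[OF lft_closed[OF c], of n n'] by simp
    next
      fix a n assume "a \<in> carrier R" "n \<in> carrier N"
      then show "?t (lft c) (a \<odot>\<^bsub>N\<^esub> n) = a \<odot>\<^bsub>restrict_scalars \<rho> TQ\<^esub> ?t (lft c) n"
        using TQ.pure_tensor(4)[OF _ lft_closed[OF c], of "\<rho> a" n] by (simp add: \<rho>)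
    qed (use t lft_closed[OF c] in simp)
  qed
  from TR.tensor_lift[OF TQ_induced this]
  show "tensor_lft \<in> module_hom R TR (restrict_scalars \<rho> TQ)"
    "c \<in> carrier (free_on R B) \<Longrightarrow> n \<in> carrier N \<Longrightarrow>
      tensor_lft (pure_tensor R (free_on R B) N c n) = ?t (lft c) n"
    by (simp_all add: tensor_lft_def)
qed

lemma tensor_lft_red:
  assumes z: "z \<in> carrier TQ"
  shows "tensor_lft (tensor_red z) = z"
proof (rule TQ.hom_eq_on_pure_tensors[OF TQ.tensor_module module_hom_compose[OF tensor_red(1)] module_hom_id _ z])
  show "tensor_lft \<in> module_hom Q (restrict_scalars \<pi> TR) TQ"
    by (rule induced_hom[OF TQ.tensor_module kill_tensor tensor_lft(1) TR.tensor_module])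
  fix c n assume c: "c \<in> carrier (free_on Q B)" and n: "n \<in> carrier N'"
  have "pure_tensor Q (free_on Q B) N' (lft (red c)) n = pure_tensor Q (free_on Q B) N' c n"
    by (rule pure_tensor_red_cong) (use c n in \<open>simp_all add: red_closed lft_closed red_lft[OF red_closed[OF c]]\<close>)
  then show "tensor_lft (tensor_red (pure_tensor Q (free_on Q B) N' c n)) = pure_tensor Q (free_on Q B) N' c n"
    using c n by (simp add: tensor_red(2) tensor_lft(2) red_closed)
qed

end

lemma tensor_red_closed:
  "module R N \<Longrightarrow> z \<in> carrier (tensor Q (free_on Q B) (restrict_scalars \<pi> N)) \<Longrightarrow>
    tensor_red N B z \<in> carrier (tensor R (free_on R B) N)"
  using module_hom_in[OF tensor_red(1)] by simp

lemma tensor_lft_closed: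
  "module R N \<Longrightarrow> z \<in> carrier (tensor R (free_on R B) N) \<Longrightarrow>
    tensor_lft N B z \<in> carrier (tensor Q (free_on Q B) (restrict_scalars \<pi> N))"
  using module_hom_in[OF tensor_lft(1)] by simp

text \<open>\<open>tensor_red\<close> and \<open>tensor_lft\<close> commute with the differentials.
  A cycle over \<open>Q\<close> is reduced, bounded over \<open>R\<close>, and the bounding chain is
  lifted; \<open>tensor_lft_red\<close> returns the original cycle.\<close>

lemma lift_tensor_exact:
  assumes N: "module R N" and \<delta>: "\<And>n. \<delta> n \<in> module_hom R (free_on R (B (Suc n))) (free_on R (B n))"
    and ex: "tensor_exact R N (\<lambda>n. free_on R (B n)) \<delta> n"
  shows "tensor_exact Q (restrict_scalars \<pi> N) (\<lambda>n. free_on Q (B n)) (\<lambda>n. lft_hom (B n) (\<delta> n)) n"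
proof -
  let ?N = "restrict_scalars \<pi> N"
  interpret N: module R N by (rule N)
  interpret N': module Q "?N" by (rule restrict_module[OF N])
  interpret TR: tensor_product R "free_on R (B k)" N for k
    using R.free_on_module N by (rule tensor_product.intro)
  interpret TQ: tensor_product Q "free_on Q (B k)" "?N" for k
    using Q.free_on_module N'.module_M by (rule tensor_product.intro)
  let ?\<delta> = "\<lambda>n. lft_hom (B n) (\<delta> n)"
  have \<delta>': "?\<delta> n \<in> module_hom Q (free_on Q (B (Suc n))) (free_on Q (B n))" for n
    by (rule lft_hom_hom[OF \<delta>])
  have \<delta>R: "tensor_map R (free_on R (B k)) N (\<delta> k) \<in> module_hom R (tensor R (free_on R (B (Suc k))) N) (tensor R (free_on R (B k)) N)" for k
    by (rule tensor_map_hom[OF R.free_on_module R.free_on_module N \<delta>])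
  have \<delta>Q: "tensor_map Q (free_on Q (B k)) ?N (?\<delta> k) \<in> module_hom Q (tensor Q (free_on Q (B (Suc k))) ?N) (tensor Q (free_on Q (B k)) ?N)" for k
    by (rule tensor_map_hom[OF Q.free_on_module Q.free_on_module N'.module_M \<delta>'])
  have red: "tensor_map R (free_on R (B k)) N (\<delta> k) (tensor_red N (B (Suc k)) z)
      = tensor_red N (B k) (tensor_map Q (free_on Q (B k)) ?N (?\<delta> k) z)"
    if z: "z \<in> carrier (tensor Q (free_on Q (B (Suc k))) ?N)" for k z
  proof (rule TQ.hom_eq_on_pure_tensors[OF restrict_module[OF TR.tensor_module]
        module_hom_compose[OF tensor_red(1)[OF N] restrict_hom[OF \<delta>R]]
        module_hom_compose[OF \<delta>Q tensor_red(1)[OF N]] _ z])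
    fix c m assume c: "c \<in> carrier (free_on Q (B (Suc k)))" and m: "m \<in> carrier ?N"
    have dc: "?\<delta> k c \<in> carrier (free_on Q (B k))" by (rule module_hom_in[OF \<delta>' c])
    have m': "m \<in> carrier N" using m by simp
    show "tensor_map R (free_on R (B k)) N (\<delta> k) (tensor_red N (B (Suc k)) (pure_tensor Q (free_on Q (B (Suc k))) ?N c m))
        = tensor_red N (B k) (tensor_map Q (free_on Q (B k)) ?N (?\<delta> k) (pure_tensor Q (free_on Q (B (Suc k))) ?N c m))"
      by (simp add: tensor_red(2)[OF N c m'] tensor_red(2)[OF N dc m']
          tensor_map_pure[OF R.free_on_module R.free_on_module N \<delta> red_closed[OF c] m']
          tensor_map_pure[OF Q.free_on_module Q.free_on_module N'.module_M \<delta>' c m] red_lft_hom[OF \<delta> c])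
  qed
  have lft: "tensor_lft N (B k) (tensor_map R (free_on R (B k)) N (\<delta> k) w)
      = tensor_map Q (free_on Q (B k)) ?N (?\<delta> k) (tensor_lft N (B (Suc k)) w)"
    if w: "w \<in> carrier (tensor R (free_on R (B (Suc k))) N)" for k w
  proof (rule TR.hom_eq_on_pure_tensors[OF TQ_induced[OF N]
        module_hom_compose[OF \<delta>R tensor_lft(1)[OF N]]
        module_hom_compose[OF tensor_lft(1)[OF N] section_hom[OF \<delta>Q]] _ w])
    fix c m assume c: "c \<in> carrier (free_on R (B (Suc k)))" and m: "m \<in> carrier N"
    have m': "m \<in> carrier ?N" using m by simp
    have dc: "\<delta> k c \<in> carrier (free_on R (B k))" by (rule module_hom_in[OF \<delta> c])
    have "pure_tensor Q (free_on Q (B k)) ?N (lft (\<delta> k c)) m = pure_tensor Q (free_on Q (B k)) ?N (?\<delta> k (lft c)) m"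
      by (rule pure_tensor_red_cong[OF N lft_closed[OF dc] module_hom_in[OF \<delta>' lft_closed[OF c]] _ m])
        (simp add: red_lft[OF dc] red_lft_hom[OF \<delta> lft_closed[OF c]] red_lft[OF c])
    then show "tensor_lft N (B k) (tensor_map R (free_on R (B k)) N (\<delta> k) (pure_tensor R (free_on R (B (Suc k))) N c m))
        = tensor_map Q (free_on Q (B k)) ?N (?\<delta> k) (tensor_lft N (B (Suc k)) (pure_tensor R (free_on R (B (Suc k))) N c m))"
      by (simp add: tensor_lft(2)[OF N c m] tensor_lft(2)[OF N dc m]
          tensor_map_pure[OF R.free_on_module R.free_on_module N \<delta> c m]
          tensor_map_pure[OF Q.free_on_module Q.free_on_module N'.module_M \<delta>' lft_closed[OF c] m'])
  qed
  show ?thesis unfolding tensor_exact_def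
  proof (intro ballI impI)
    fix z assume z: "z \<in> carrier (tensor Q (free_on Q (B n)) ?N)"
      and cyc: "\<forall>k. n = Suc k \<longrightarrow> tensor_map Q (free_on Q (B k)) ?N (?\<delta> k) z = \<zero>\<^bsub>tensor Q (free_on Q (B k)) ?N\<^esub>"
    have "tensor_map R (free_on R (B k)) N (\<delta> k) (tensor_red N (B n) z) = \<zero>\<^bsub>tensor R (free_on R (B k)) N\<^esub>"
      if n: "n = Suc k" for k
    proof -
      have "tensor_map R (free_on R (B k)) N (\<delta> k) (tensor_red N (B n) z)
          = tensor_red N (B k) \<zero>\<^bsub>tensor Q (free_on Q (B k)) ?N\<^esub>"
        using red[of z k] z cyc n by simp
      also have "\<dots> = \<zero>\<^bsub>tensor R (free_on R (B k)) N\<^esub>"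
        using module_hom_zero[OF TQ.tensor_module restrict_module[OF TR.tensor_module] tensor_red(1)[OF N]] by simp
      finally show ?thesis .
    qed
    then obtain w where w: "w \<in> carrier (tensor R (free_on R (B (Suc n))) N)"
        "tensor_red N (B n) z = tensor_map R (free_on R (B n)) N (\<delta> n) w"
      using ex[unfolded tensor_exact_def, rule_format, OF tensor_red_closed[OF N z]] by metis
    have "z = tensor_lft N (B n) (tensor_red N (B n) z)" by (rule tensor_lft_red[OF N z, symmetric])
    also have "\<dots> = tensor_map Q (free_on Q (B n)) ?N (?\<delta> n) (tensor_lft N (B (Suc n)) w)"
      unfolding w(2) by (rule lft[OF w(1)])
    finally show "\<exists>w\<in>carrier (tensor Q (free_on Q (B (Suc n))) ?N). z = tensor_map Q (free_on Q (B n)) ?N (?\<delta> n) w"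
      by (rule bexI[OF _ tensor_lft_closed[OF N w(1)]])
  qed
qed

end

section \<open>The complex of a system of higher homotopies\<close>

text \<open>Summation along diagonals \<open>p = j + k\<close>. In the square of \<open>D\<close>
  one diagonal collects exactly the products \<open>\<sigma> j \<sigma> k\<close> that occur in one
  relation of the higher homotopies.\<close>

lemma (in abelian_monoid) finsum_triangle:
  fixes K :: nat
  assumes "\<And>j k. t j k \<in> carrier G"
  shows "(\<Oplus>j\<in>{..K}. \<Oplus>k\<in>{..K - j}. t j k) = (\<Oplus>p\<in>{..K}. \<Oplus>j\<in>{..p}. t j (p - j))"
proof (induction K)
  case 0
  then show ?case using assms by simp
next
  case (Suc K)
  have "(\<Oplus>j\<in>{..K}. \<Oplus>k\<in>{..Suc K - j}. t j k) = (\<Oplus>j\<in>{..K}. (\<Oplus>k\<in>{..K - j}. t j k) \<oplus> t j (Suc K - j))"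
  proof (rule finsum_cong')
    fix j assume "j \<in> {..K}"
    then have "Suc K - j = Suc (K - j)" by auto
    then show "(\<Oplus>k\<in>{..Suc K - j}. t j k) = (\<Oplus>k\<in>{..K - j}. t j k) \<oplus> t j (Suc K - j)"
      using assms by (simp add: a_comm)
  qed (use assms in auto)
  also have "\<dots> = (\<Oplus>j\<in>{..K}. \<Oplus>k\<in>{..K - j}. t j k) \<oplus> (\<Oplus>j\<in>{..K}. t j (Suc K - j))"
    by (rule finsum_addf) (use assms in auto)
  finally have *: "(\<Oplus>j\<in>{..K}. \<Oplus>k\<in>{..Suc K - j}. t j k) = \<dots>" .
  have "(\<Oplus>j\<in>{..Suc K}. \<Oplus>k\<in>{..Suc K - j}. t j k)
      = t (Suc K) 0 \<oplus> ((\<Oplus>j\<in>{..K}. \<Oplus>k\<in>{..K - j}. t j k) \<oplus> (\<Oplus>j\<in>{..K}. t j (Suc K - j)))"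
    unfolding *[symmetric] using assms by simp
  also have "\<dots> = (t (Suc K) 0 \<oplus> (\<Oplus>j\<in>{..K}. t j (Suc K - j))) \<oplus> (\<Oplus>j\<in>{..K}. \<Oplus>k\<in>{..K - j}. t j k)"
    using assms by (simp add: a_ac)
  also have "t (Suc K) 0 \<oplus> (\<Oplus>j\<in>{..K}. t j (Suc K - j)) = (\<Oplus>j\<in>{..Suc K}. t j (Suc K - j))"
    using assms by simp
  finally show ?case using Suc.IH assms by simp
qed

text \<open>The degree of the summand with index \<open>l\<close> in the term of degree
  \<open>n\<close>. It is an integer because \<open>l\<close> runs over all natural numbers; beyond
  \<open>n div 2\<close> it is negative and the summand is zero.\<close>

definition hh_deg :: "nat \<Rightarrow> nat \<Rightarrow> int" where
  "hh_deg n l = int n - 2 * int l"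

lemma hh_deg_simps:
  "hh_deg (Suc (Suc n)) (Suc l) = hh_deg n l" "hh_deg n 0 = int n" "hh_deg (m + 2 * i) i = int m"
  by (simp_all add: hh_deg_def)

text \<open>The term of degree \<open>n\<close> is \<open>F n \<oplus> F (n - 2) \<oplus> F (n - 4) \<oplus> \<dots>\<close>, a finite sum as \<open>F\<close> is zero
  in negative degrees.\<close>

definition hh_module :: "(int \<Rightarrow> ('a, 'f, 'e) module_scheme) \<Rightarrow> nat \<Rightarrow> ('a, nat \<Rightarrow> 'f) module" where
  "hh_module F n =
     \<lparr>carrier = {w. \<forall>l. w l \<in> carrier (F (hh_deg n l))},
      monoid.mult = (\<lambda>w _. w), one = (\<lambda>l. \<zero>\<^bsub>F (hh_deg n l)\<^esub>), zero = (\<lambda>l. \<zero>\<^bsub>F (hh_deg n l)\<^esub>),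
      add = (\<lambda>w w' l. w l \<oplus>\<^bsub>F (hh_deg n l)\<^esub> w' l), smult = (\<lambda>a w l. a \<odot>\<^bsub>F (hh_deg n l)\<^esub> w l)\<rparr>"

lemma hh_module_simps [simp]:
  "w \<in> carrier (hh_module F n) \<longleftrightarrow> (\<forall>l. w l \<in> carrier (F (hh_deg n l)))"
  "\<zero>\<^bsub>hh_module F n\<^esub> = (\<lambda>l. \<zero>\<^bsub>F (hh_deg n l)\<^esub>)"
  "w \<oplus>\<^bsub>hh_module F n\<^esub> w' = (\<lambda>l. w l \<oplus>\<^bsub>F (hh_deg n l)\<^esub> w' l)"
  "a \<odot>\<^bsub>hh_module F n\<^esub> w = (\<lambda>l. a \<odot>\<^bsub>F (hh_deg n l)\<^esub> w l)"
  by (simp_all add: hh_module_def)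

locale hh_resolution = M: module Q M
  for Q :: "('a, 'c) ring_scheme" and x and M :: "('a, 'm, 'd) module_scheme"
    and F :: "int \<Rightarrow> ('a, 'f, 'e) module_scheme" and d and \<sigma> and \<epsilon> +
  assumes x: "nonzerodivisor Q x"
    and xM: "v \<in> carrier M \<Longrightarrow> x \<odot>\<^bsub>M\<^esub> v = \<zero>\<^bsub>M\<^esub>"
    and F: "resolution_mod Q \<zero>\<^bsub>Q\<^esub> M (\<lambda>n. F (int n)) (\<lambda>n. d (int (Suc n))) \<epsilon>"
    and F_module: "module Q (F j)"
    and F_neg: "j < 0 \<Longrightarrow> zero_module (F j)"
    and hh: "higher_homotopies Q x F d \<sigma>"
begin

abbreviation "G \<equiv> hh_module F"

text \<open>\<open>\<sigma> j\<close> raises the degree by \<open>2 j - 1\<close>, so it goes from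
  summand \<open>l + j\<close> of the term of degree \<open>n + 1\<close> to summand
  \<open>l\<close> of the term of degree \<open>n\<close>. For \<open>j > n\<close> the source has
  negative degree and nothing is lost by stopping the sum at \<open>n\<close>.\<close>

definition D :: "nat \<Rightarrow> (nat \<Rightarrow> 'f) \<Rightarrow> nat \<Rightarrow> 'f" where
  "D n w l = (\<Oplus>\<^bsub>F (hh_deg n l)\<^esub>j\<in>{..n}. \<sigma> j (hh_deg (Suc n) (l + j)) (w (l + j)))"

definition incl :: "nat \<Rightarrow> nat \<Rightarrow> 'f \<Rightarrow> nat \<Rightarrow> 'f" where
  "incl n i v = (\<lambda>l. if l = i then v else \<zero>\<^bsub>F (hh_deg n l)\<^esub>)"

lemma x_closed: "x \<in> carrier Q"
  using x by (simp add: nonzerodivisor_def)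

sublocale F: module Q "F j" for j
  by (rule F_module)

sublocale FR: resolution_mod Q "\<zero>\<^bsub>Q\<^esub>" M "\<lambda>n. F (int n)" "\<lambda>n. d (int (Suc n))" \<epsilon>
  by (rule F)

lemma F_zero: "j < 0 \<Longrightarrow> v \<in> carrier (F j) \<Longrightarrow> v = \<zero>\<^bsub>F j\<^esub>"
  using zero_moduleD[OF F_neg] .

lemma F_torsionfree:
  assumes "v \<in> carrier (F j)" "x \<odot>\<^bsub>F j\<^esub> v = \<zero>\<^bsub>F j\<^esub>"
  shows "v = \<zero>\<^bsub>F j\<^esub>"
proof (cases "j < 0")
  case True
  then show ?thesis using assms(1) by (rule F_zero)
next
  case False
  then have "projective Q (F j)" using FR.proj[of "nat j"] by simp
  then show ?thesis using x assms by (rule projective_torsionfree)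
qed

lemma \<sigma>_hom: "\<sigma> j (hh_deg (Suc n) (l + j)) \<in> module_hom Q (F (hh_deg (Suc n) (l + j))) (F (hh_deg n l))"
proof -
  have "\<sigma> j (hh_deg (Suc n) (l + j)) \<in> module_hom Q (F (hh_deg (Suc n) (l + j))) (F (hh_deg (Suc n) (l + j) + 2 * int j - 1))"
    using hh by (simp add: higher_homotopies_def)
  moreover have "hh_deg (Suc n) (l + j) + 2 * int j - 1 = hh_deg n l" by (simp add: hh_deg_def)
  ultimately show ?thesis by simp
qed

lemma \<sigma>_0: "v \<in> carrier (F j) \<Longrightarrow> \<sigma> 0 j v = d j v"
  using hh by (simp add: higher_homotopies_def)

lemma G_module: "module Q (G n)"
proof (rule moduleI[OF M.R.is_cring])
  show "abelian_group (G n)"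
  proof (rule abelian_groupI)
    fix w assume "w \<in> carrier (G n)"
    then show "\<exists>w'\<in>carrier (G n). w' \<oplus>\<^bsub>G n\<^esub> w = \<zero>\<^bsub>G n\<^esub>"
      by (intro bexI[of _ "\<lambda>l. \<ominus>\<^bsub>F (hh_deg n l)\<^esub> w l"]) (simp_all add: F.M.l_neg)
  qed (simp_all add: F.M.a_ac)
qed (simp_all add: F.smult_l_distr F.smult_r_distr F.smult_assoc1)

sublocale G: module Q "G n" for n
  by (rule G_module)

lemma G_zero: "w \<in> carrier (G n) \<Longrightarrow> hh_deg n l < 0 \<Longrightarrow> w l = \<zero>\<^bsub>F (hh_deg n l)\<^esub>"
  using F_zero by simp

lemma hom_into_G:
  assumes "\<And>l. (\<lambda>v. f v l) \<in> module_hom Q A (F (hh_deg n l))"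
  shows "f \<in> module_hom Q A (G n)"
  by (rule module_homI)
    (simp_all add: module_hom_in[OF assms] module_hom_add[OF assms] module_hom_smult[OF assms] fun_eq_iff)

lemma proj_hom: "(\<lambda>w. w l) \<in> module_hom Q (G n) (F (hh_deg n l))"
  by (rule module_homI) simp_all

lemma incl_hom: "incl n i \<in> module_hom Q (F (hh_deg n i)) (G n)"
  by (rule hom_into_G, rule module_homI) (simp_all add: incl_def)

lemma G_minus: "w \<in> carrier (G n) \<Longrightarrow> w' \<in> carrier (G n) \<Longrightarrow> (w \<ominus>\<^bsub>G n\<^esub> w') l = w l \<ominus>\<^bsub>F (hh_deg n l)\<^esub> w' l"
  by (rule module_hom_minus[OF G_module F_module proj_hom])

lemma G_finsum:
  assumes "finite I" "\<And>i. i \<in> I \<Longrightarrow> f i \<in> carrier (G n)"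
  shows "(\<Oplus>\<^bsub>G n\<^esub>i\<in>I. f i) l = (\<Oplus>\<^bsub>F (hh_deg n l)\<^esub>i\<in>I. f i l)"
  by (rule module_hom_finsum[OF G_module F_module proj_hom assms])

lemma term_hom: "(\<lambda>w. \<sigma> j (hh_deg (Suc n) (l + j)) (w (l + j))) \<in> module_hom Q (G (Suc n)) (F (hh_deg n l))"
  by (rule module_hom_compose[OF proj_hom \<sigma>_hom])

lemma term_in: "w \<in> carrier (G (Suc n)) \<Longrightarrow> \<sigma> j (hh_deg (Suc n) (l + j)) (w (l + j)) \<in> carrier (F (hh_deg n l))"
  by (rule module_hom_in[OF term_hom])

lemma D_hom: "D n \<in> module_hom Q (G (Suc n)) (G n)"
proof (rule hom_into_G)
  show "(\<lambda>v. D n v l) \<in> module_hom Q (G (Suc n)) (F (hh_deg n l))" for l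
    unfolding D_def by (rule module_hom_finsum_fun[OF F_module finite_atMost term_hom])
qed

lemma D_in: "w \<in> carrier (G (Suc n)) \<Longrightarrow> D n w \<in> carrier (G n)"
  by (rule module_hom_in[OF D_hom])

lemma term_zero:
  assumes "w \<in> carrier (G (Suc n))" "j > n"
  shows "\<sigma> j (hh_deg (Suc n) (l + j)) (w (l + j)) = \<zero>\<^bsub>F (hh_deg n l)\<^esub>"
proof -
  have "hh_deg (Suc n) (l + j) < 0" using assms(2) by (simp add: hh_deg_def)
  then have "w (l + j) = \<zero>\<^bsub>F (hh_deg (Suc n) (l + j))\<^esub>" by (rule G_zero[OF assms(1)])
  then show ?thesis using module_hom_zero[OF F_module F_module \<sigma>_hom] by simp
qed

text \<open>The added terms are zero for degree reasons. This brings sums belonging to different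
  \<open>n\<close> to a common range.\<close>

lemma D_eq:
  assumes w: "w \<in> carrier (G (Suc n))" and K: "K \<ge> n"
  shows "D n w l = (\<Oplus>\<^bsub>F (hh_deg n l)\<^esub>j\<in>{..K}. \<sigma> j (hh_deg (Suc n) (l + j)) (w (l + j)))"
  unfolding D_def
  by (rule F.M.add.finprod_mono_neutral_cong_left)
    (use K term_zero[OF w] term_in[OF w] in auto)

lemma D_incl:
  assumes v: "v \<in> carrier (F (hh_deg (Suc n) i))"
  shows "D n (incl (Suc n) i v) l = (if l \<le> i then \<sigma> (i - l) (hh_deg (Suc n) i) v else \<zero>\<^bsub>F (hh_deg n l)\<^esub>)"
proof -
  have w: "incl (Suc n) i v \<in> carrier (G (Suc n))" by (rule module_hom_in[OF incl_hom v])
  have z: "\<sigma> j (hh_deg (Suc n) (l + j)) (incl (Suc n) i v (l + j)) = \<zero>\<^bsub>F (hh_deg n l)\<^esub>" if "l + j \<noteq> i" for j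
    using that module_hom_zero[OF F_module F_module \<sigma>_hom] by (simp add: incl_def)
  show ?thesis
  proof (cases "l \<le> i")
    case True
    let ?f = "\<lambda>j. \<sigma> j (hh_deg (Suc n) (l + j)) (incl (Suc n) i v (l + j))"
    \<comment> \<open>The range is enlarged to be certain that it contains \<open>i - l\<close>, the
      only index that contributes.\<close>
    have "D n (incl (Suc n) i v) l = (\<Oplus>\<^bsub>F (hh_deg n l)\<^esub>j\<in>{..n + i}. ?f j)"
      by (rule D_eq[OF w]) simp
    also have "\<dots> = (\<Oplus>\<^bsub>F (hh_deg n l)\<^esub>j\<in>{..n + i}. if i - l = j then ?f j else \<zero>\<^bsub>F (hh_deg n l)\<^esub>)"
      by (rule F.M.finsum_cong') (use z term_in[OF w] in auto)
    also have "\<dots> = ?f (i - l)"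
      by (rule F.M.add.finprod_singleton) (use term_in[OF w] in auto)
    finally show ?thesis using True by (simp add: incl_def)
  next
    case False
    then have "l + j \<noteq> i" for j by auto
    then have "D n (incl (Suc n) i v) l = \<zero>\<^bsub>F (hh_deg n l)\<^esub>"
      unfolding D_def by (intro F.M.add.finprod_one_eqI) (rule z)
    then show ?thesis using False by simp
  qed
qed

section \<open>The square of the differential\<close>

lemma d_d:
  assumes v: "v \<in> carrier (F (j + 1))"
  shows "d j (d (j + 1) v) = \<zero>\<^bsub>F (j - 1)\<^esub>"
proof (cases "j \<ge> 1")
  case True
  define n where "n = nat (j - 1)"
  have j: "j = int (Suc n)" "j + 1 = int (Suc (Suc n))" "j - 1 = int n"
    using True by (simp_all add: n_def)
  have "v \<in> carrier (F (int (Suc (Suc n))))" using v unfolding j(2) .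
  from FR.\<delta>_\<delta>[OF this] have "d (int (Suc n)) (d (int (Suc (Suc n))) v) = \<zero>\<^bsub>F (int n)\<^esub>"
    unfolding F.multiples_0 by (rule singletonD)
  then show ?thesis by (simp only: j(1)[symmetric] j(2)[symmetric] j(3)[symmetric])
next
  case False
  have h: "\<forall>i j. \<sigma> i j \<in> module_hom Q (F j) (F (j + 2 * int i - 1))"
    using hh unfolding higher_homotopies_def by (elim conjE)
  have h0: "\<sigma> 0 i \<in> module_hom Q (F i) (F (i - 1))" for i
    using h[rule_format, of 0 i] by simp
  have a: "\<sigma> 0 (j + 1) v \<in> carrier (F j)"
    using module_hom_in[OF h0[of "j + 1"] v] by simp
  have "\<sigma> 0 j (\<sigma> 0 (j + 1) v) = \<zero>\<^bsub>F (j - 1)\<^esub>"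
    by (rule F_zero[OF _ module_hom_in[OF h0 a]]) (use False in simp)
  then show ?thesis using \<sigma>_0[OF v] \<sigma>_0[OF a] by simp
qed

text \<open>The relations in uniform shape: \<open>p = 0\<close> is the vanishing of the square of
  \<open>d\<close>, \<open>p = 1\<close> the homotopy for multiplication by \<open>x\<close>, and
  \<open>p > 1\<close> the remaining identities. For \<open>p = 1\<close> the degrees of
  \<open>v\<close> and of the sum agree, so that \<open>x v\<close> lies in the right
  module.\<close>

lemma hh_sum:
  assumes v: "v \<in> carrier (F (hh_deg (Suc (Suc n)) (l + p)))"
  shows "(\<Oplus>\<^bsub>F (hh_deg n l)\<^esub>j\<in>{..p}. \<sigma> j (hh_deg (Suc n) (l + j)) (\<sigma> (p - j) (hh_deg (Suc (Suc n)) (l + p)) v))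
    = (if p = 1 then x \<odot>\<^bsub>F (hh_deg n l)\<^esub> v else \<zero>\<^bsub>F (hh_deg n l)\<^esub>)"
proof -
  let ?s = "hh_deg (Suc (Suc n)) (l + p)"
  let ?t = "\<lambda>j. \<sigma> j (hh_deg (Suc n) (l + j)) (\<sigma> (p - j) ?s v)"
  have t: "?t j \<in> carrier (F (hh_deg n l))" if "j \<le> p" for j
    using module_hom_in[OF \<sigma>_hom module_hom_in[OF \<sigma>_hom[of "p - j" "Suc n" "l + j"]]] v that by simp
  consider "p = 0" | "p = 1" | "p > 1" by linarith
  then show ?thesis
  proof cases
    case 1
    have s: "?s = int n + 1 - 2 * int l + 1" "hh_deg (Suc n) l = int n + 1 - 2 * int l" "hh_deg n l = int n + 1 - 2 * int l - 1"
      using 1 by (simp_all add: hh_deg_def)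
    have "?t 0 = d (int n + 1 - 2 * int l) (d (int n + 1 - 2 * int l + 1) v)"
    proof -
      have "\<sigma> 0 ?s v \<in> carrier (F (hh_deg (Suc n) l))"
        using module_hom_in[OF \<sigma>_hom[of 0 "Suc n" l]] v 1 by simp
      then show ?thesis using v 1 by (simp add: \<sigma>_0 s(1)[unfolded 1, simplified] s(2))
    qed
    also have "\<dots> = \<zero>\<^bsub>F (hh_deg n l)\<^esub>" using d_d[of v "int n + 1 - 2 * int l"] v s by simp
    finally show ?thesis using 1 t[of 0] by simp
  next
    case 2
    have s: "?s = hh_deg n l" "hh_deg n l + 1 = hh_deg (Suc n) l" "hh_deg n l - 1 = hh_deg (Suc n) (l + 1)"
      using 2 by (simp_all add: hh_deg_def)
    have "\<forall>j. \<forall>v\<in>carrier (F j). \<sigma> 0 (j + 1) (\<sigma> 1 j v) \<oplus>\<^bsub>F j\<^esub> \<sigma> 1 (j - 1) (\<sigma> 0 j v) = x \<odot>\<^bsub>F j\<^esub> v"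
      using hh unfolding higher_homotopies_def by (elim conjE)
    from this[rule_format, of v "hh_deg n l"] have "?t 0 \<oplus>\<^bsub>F (hh_deg n l)\<^esub> ?t 1 = x \<odot>\<^bsub>F (hh_deg n l)\<^esub> v"
      using v unfolding s 2 by (simp add: hh_deg_simps(1))
    moreover have "{..p} = {0, 1}" using 2 by auto
    ultimately show ?thesis using 2 t[of 0] t[of 1] by simp
  next
    case 3
    have s: "?s + 2 * int p - 2 = hh_deg n l" "?s + 2 * int (p - j) - 1 = hh_deg (Suc n) (l + j)" if "j \<le> p" for j
      using that by (simp_all add: hh_deg_def of_nat_diff)
    have "(\<Oplus>\<^bsub>F (?s + 2 * int p - 2)\<^esub>j\<in>{..p}. \<sigma> j (?s + 2 * int (p - j) - 1) (\<sigma> (p - j) ?s v)) = \<zero>\<^bsub>F (?s + 2 * int p - 2)\<^esub>"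
      using hh 3 v by (simp add: higher_homotopies_def)
    moreover have "(\<Oplus>\<^bsub>F (hh_deg n l)\<^esub>j\<in>{..p}. \<sigma> j (?s + 2 * int (p - j) - 1) (\<sigma> (p - j) ?s v)) = (\<Oplus>\<^bsub>F (hh_deg n l)\<^esub>j\<in>{..p}. ?t j)"
      by (rule F.M.finsum_cong') (use s t in auto)
    ultimately show ?thesis using 3 s(1)[of 0] by simp
  qed
qed

text \<open>Sorted by \<open>p = j + k\<close>, the double sum consists of the sums of
  \<open>hh_sum\<close>. Only \<open>p = 1\<close> survives, and it reads summand
  \<open>l + 1\<close>; this accounts for the shift.\<close>

lemma D_D:
  assumes w: "w \<in> carrier (G (Suc (Suc n)))"
  shows "D n (D (Suc n) w) = (\<lambda>l. x \<odot>\<^bsub>F (hh_deg n l)\<^esub> w (Suc l))"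
proof
  fix l
  let ?t = "\<lambda>j k. \<sigma> j (hh_deg (Suc n) (l + j)) (\<sigma> k (hh_deg (Suc (Suc n)) (l + j + k)) (w (l + j + k)))"
  let ?K = "Suc n"
  let ?F = "F (hh_deg n l)"
  have "w (Suc l) \<in> carrier (F (hh_deg (Suc (Suc n)) (Suc l)))" using w by simp
  then have xw: "x \<odot>\<^bsub>?F\<^esub> w (Suc l) \<in> carrier ?F"
    unfolding hh_deg_simps(1) by (rule F.smult_closed[OF x_closed])
  have t1: "\<sigma> k (hh_deg (Suc (Suc n)) (l + j + k)) (w (l + j + k)) \<in> carrier (F (hh_deg (Suc n) (l + j)))" for j k
    by (rule term_in[OF w])
  have t: "?t j k \<in> carrier ?F" for j k
    by (rule module_hom_in[OF \<sigma>_hom t1])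
  \<comment> \<open>Terms outside the triangle act on summands of negative degree, so the square of
    indices may be cut down to the triangle.\<close>
  have t0: "?t j k = \<zero>\<^bsub>?F\<^esub>" if "j + k > ?K" for j k
  proof -
    have "hh_deg (Suc (Suc n)) (l + j + k) < 0" using that by (simp add: hh_deg_def)
    then have "w (l + j + k) = \<zero>\<^bsub>F (hh_deg (Suc (Suc n)) (l + j + k))\<^esub>" by (rule G_zero[OF w])
    then show ?thesis
      using module_hom_zero[OF F_module F_module \<sigma>_hom] module_hom_zero[OF F_module F_module \<sigma>_hom[of k "Suc n" "l + j"]] by simp
  qed
  have "D n (D (Suc n) w) l = (\<Oplus>\<^bsub>?F\<^esub>j\<in>{..?K}. \<sigma> j (hh_deg (Suc n) (l + j)) (D (Suc n) w (l + j)))"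
    by (rule D_eq[OF D_in[OF w]]) simp
  also have "\<dots> = (\<Oplus>\<^bsub>?F\<^esub>j\<in>{..?K}. \<Oplus>\<^bsub>?F\<^esub>k\<in>{..?K - j}. ?t j k)"
  proof (rule F.M.finsum_cong')
    fix j assume "j \<in> {..?K}"
    have "\<sigma> j (hh_deg (Suc n) (l + j)) (D (Suc n) w (l + j)) = (\<Oplus>\<^bsub>?F\<^esub>k\<in>{..?K}. ?t j k)"
      unfolding D_def by (rule module_hom_finsum[OF F_module F_module \<sigma>_hom finite_atMost t1])
    also have "\<dots> = (\<Oplus>\<^bsub>?F\<^esub>k\<in>{..?K - j}. ?t j k)"
      by (rule F.M.add.finprod_mono_neutral_cong_right) (use t t0 in auto)
    finally show "\<sigma> j (hh_deg (Suc n) (l + j)) (D (Suc n) w (l + j)) = \<dots>" .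
  qed (use t in auto)
  also have "\<dots> = (\<Oplus>\<^bsub>?F\<^esub>p\<in>{..?K}. \<Oplus>\<^bsub>?F\<^esub>j\<in>{..p}. ?t j (p - j))"
    by (rule F.M.finsum_triangle[OF t])
  also have "\<dots> = (\<Oplus>\<^bsub>?F\<^esub>p\<in>{..?K}. if 1 = p then x \<odot>\<^bsub>?F\<^esub> w (Suc l) else \<zero>\<^bsub>?F\<^esub>)"
  proof (rule F.M.finsum_cong'[OF refl])
    fix p
    have "(\<Oplus>\<^bsub>?F\<^esub>j\<in>{..p}. ?t j (p - j))
        = (\<Oplus>\<^bsub>?F\<^esub>j\<in>{..p}. \<sigma> j (hh_deg (Suc n) (l + j)) (\<sigma> (p - j) (hh_deg (Suc (Suc n)) (l + p)) (w (l + p))))"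
    proof (rule F.M.finsum_cong'[OF refl])
      show "(\<lambda>j. \<sigma> j (hh_deg (Suc n) (l + j)) (\<sigma> (p - j) (hh_deg (Suc (Suc n)) (l + p)) (w (l + p)))) \<in> {..p} \<rightarrow> carrier ?F"
      proof
        fix j assume "j \<in> {..p}"
        then have "l + j + (p - j) = l + p" by simp
        then show "\<sigma> j (hh_deg (Suc n) (l + j)) (\<sigma> (p - j) (hh_deg (Suc (Suc n)) (l + p)) (w (l + p))) \<in> carrier ?F"
          using t[of j "p - j"] by simp
      qed
    qed simp
    also have "\<dots> = (if p = 1 then x \<odot>\<^bsub>?F\<^esub> w (l + p) else \<zero>\<^bsub>?F\<^esub>)"
      by (rule hh_sum) (use w in simp)
    finally show "(\<Oplus>\<^bsub>?F\<^esub>j\<in>{..p}. ?t j (p - j)) = (if 1 = p then x \<odot>\<^bsub>?F\<^esub> w (Suc l) else \<zero>\<^bsub>?F\<^esub>)"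
      by (cases "p = 1") simp_all
  qed (use xw in simp)
  also have "\<dots> = x \<odot>\<^bsub>?F\<^esub> w (Suc l)"
    by (rule F.M.add.finprod_singleton[of _ _ "\<lambda>_. x \<odot>\<^bsub>?F\<^esub> w (Suc l)"]) (use xw in simp_all)
  finally show "D n (D (Suc n) w) l = x \<odot>\<^bsub>?F\<^esub> w (Suc l)" .
qed

section \<open>Exactness modulo \<open>x\<close>\<close>

lemma shift_in_G:
  assumes "u \<in> carrier (G n)" "f \<in> carrier (F (int (Suc (Suc n))))"
  shows "case_nat f u \<in> carrier (G (Suc (Suc n)))"
  unfolding hh_module_simps
proof
  show "case_nat f u l \<in> carrier (F (hh_deg (Suc (Suc n)) l))" for l
    using assms by (cases l) (simp_all add: hh_deg_simps del: of_nat_Suc)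
qed

text \<open>Shifting summands by one while raising \<open>n\<close> by two leaves every degree
  unchanged, and \<open>D\<close> into a positive index never reads the new summand 0.\<close>

lemma D_shift:
  assumes u: "u \<in> carrier (G (Suc n))"
  shows "D (Suc (Suc n)) (case_nat f u) (Suc l) = D n u l"
proof -
  have "D (Suc (Suc n)) (case_nat f u) (Suc l)
      = (\<Oplus>\<^bsub>F (hh_deg n l)\<^esub>j\<in>{..Suc (Suc n)}. \<sigma> j (hh_deg (Suc n) (l + j)) (u (l + j)))"
    unfolding D_def by (simp only: hh_deg_simps(1) add_Suc nat.case)
  then show ?thesis using D_eq[OF u, of "Suc (Suc n)"] by simp
qed

lemma D_incl_0:
  assumes "v \<in> carrier (F (int (Suc n)))"
  shows "D n (incl (Suc n) 0 v) = incl n 0 (d (int (Suc n)) v)"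
proof
  fix l
  have v: "v \<in> carrier (F (hh_deg (Suc n) 0))" using assms by (simp only: hh_deg_simps(2))
  show "D n (incl (Suc n) 0 v) l = incl n 0 (d (int (Suc n)) v) l"
    unfolding D_incl[OF v] using \<sigma>_0[OF v] by (simp add: incl_def hh_deg_simps(2))
qed

text \<open>Applying \<open>D\<close> to the hypothesis gives
  \<open>x (tail of w) = x (D u)\<close>. Once \<open>x\<close> is cancelled, \<open>w\<close>
  differs from \<open>D (0, u)\<close> only in summand 0, where exactness of \<open>F\<close>
  applies. The conclusion is an equality, not just a congruence.\<close>

lemma D_exact:
  assumes w: "w \<in> carrier (G (Suc n))" and u: "u \<in> carrier (G n)" and eq: "D n w = x \<odot>\<^bsub>G n\<^esub> u"
  obtains w' where "w' \<in> carrier (G (Suc (Suc n)))" "w = D (Suc n) w'"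
proof -
  \<comment> \<open>Shifting \<open>u\<close> by one place undoes the shift in \<open>D_D\<close>:
    \<open>D (D u0) = x u = D w\<close>, so \<open>w\<close> and \<open>D u0\<close> differ by an
    element that \<open>D\<close> kills.\<close>
  define u0 where "u0 = case_nat \<zero>\<^bsub>F (int (Suc (Suc n)))\<^esub> u"
  have u0: "u0 \<in> carrier (G (Suc (Suc n)))" unfolding u0_def by (rule shift_in_G[OF u]) (rule F.M.zero_closed)
  define c where "c = D (Suc n) u0"
  have c: "c \<in> carrier (G (Suc n))" unfolding c_def by (rule D_in[OF u0])
  have tail: "w (Suc l) = c (Suc l)" for l
  \<comment> \<open>For \<open>n = 0\<close> the tail lies in negative degrees. Otherwise
    \<open>D\<close> can be applied once more, which is what exhibits the factor \<open>x\<close> on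
    both sides.\<close>
  proof (cases n)
    case 0
    then have "hh_deg (Suc n) (Suc l) < 0" by (simp add: hh_deg_def)
    then show ?thesis using G_zero[OF w] G_zero[OF c] by simp
  next
    case (Suc m)
    have w': "w \<in> carrier (G (Suc (Suc m)))" and u': "u \<in> carrier (G (Suc m))" using w u Suc by simp_all
    have wl: "w (Suc l) \<in> carrier (F (hh_deg m l))"
      using w' unfolding hh_module_simps hh_deg_simps(1)[of m l, symmetric] by (rule spec)
    have ul: "D m u l \<in> carrier (F (hh_deg m l))"
      using D_in[OF u'] unfolding hh_module_simps by (rule spec)
    have "(\<lambda>l. x \<odot>\<^bsub>F (hh_deg m l)\<^esub> w (Suc l)) = D m (D (Suc m) w)" by (rule D_D[OF w', symmetric])
    also have "\<dots> = D m (x \<odot>\<^bsub>G (Suc m)\<^esub> u)" using eq unfolding Suc by (rule arg_cong)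
    also have "\<dots> = x \<odot>\<^bsub>G m\<^esub> D m u" by (rule module_hom_smult[OF D_hom x_closed u'])
    finally have "x \<odot>\<^bsub>F (hh_deg m l)\<^esub> w (Suc l) = x \<odot>\<^bsub>F (hh_deg m l)\<^esub> D m u l"
      unfolding hh_module_simps by (rule fun_cong)
    then have "x \<odot>\<^bsub>F (hh_deg m l)\<^esub> (w (Suc l) \<ominus>\<^bsub>F (hh_deg m l)\<^esub> D m u l) = \<zero>\<^bsub>F (hh_deg m l)\<^esub>"
      using wl ul x_closed by (simp add: F.M.minus_eq F.smult_r_distr F.smult_r_minus F.M.r_neg)
    then have "w (Suc l) \<ominus>\<^bsub>F (hh_deg m l)\<^esub> D m u l = \<zero>\<^bsub>F (hh_deg m l)\<^esub>"
      by (rule F_torsionfree[rotated]) (use wl ul in simp)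
    then have "w (Suc l) = D m u l" using wl ul by simp
    also have "\<dots> = c (Suc l)" unfolding c_def u0_def Suc by (rule D_shift[OF u', symmetric])
    finally show ?thesis .
  qed
  have wl: "w l \<in> carrier (F (hh_deg (Suc n) l))" and cl: "c l \<in> carrier (F (hh_deg (Suc n) l))" for l
    using w c by simp_all
  define v where "v = w 0 \<ominus>\<^bsub>F (hh_deg (Suc n) 0)\<^esub> c 0"
  have v: "v \<in> carrier (F (hh_deg (Suc n) 0))" unfolding v_def using wl cl by (rule F.M.minus_closed)
  have v': "v \<in> carrier (F (int (Suc n)))" using v by (simp only: hh_deg_simps(2))
  have wc: "w \<ominus>\<^bsub>G (Suc n)\<^esub> c = incl (Suc n) 0 v"
  proof
    fix l
    show "(w \<ominus>\<^bsub>G (Suc n)\<^esub> c) l = incl (Suc n) 0 v l"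
      unfolding G_minus[OF w c]
      by (cases l) (simp_all add: incl_def v_def tail F.M.minus_eq F.M.r_neg cl)
  qed
  have Dc: "D n c = D n w"
    unfolding c_def D_D[OF u0] eq by (simp add: u0_def)
  have "D n (w \<ominus>\<^bsub>G (Suc n)\<^esub> c) = D n w \<ominus>\<^bsub>G n\<^esub> D n c"
    by (rule module_hom_minus[OF G_module G_module D_hom w c])
  also have "\<dots> = \<zero>\<^bsub>G n\<^esub>" unfolding Dc using D_in[OF w] by (metis G.M.minus_eq G.M.r_neg)
  finally have "incl n 0 (d (int (Suc n)) v) = \<zero>\<^bsub>G n\<^esub>"
    unfolding wc D_incl_0[OF v'] .
  then have "incl n 0 (d (int (Suc n)) v) 0 = \<zero>\<^bsub>F (hh_deg n 0)\<^esub>" by (simp only: hh_module_simps)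
  then have "d (int (Suc n)) v = \<zero>\<^bsub>F (int n)\<^esub>" by (simp only: incl_def hh_deg_simps(2) if_True refl)
  then obtain f where f: "f \<in> carrier (F (int (Suc (Suc n))))"
      "v \<ominus>\<^bsub>F (int (Suc n))\<^esub> d (int (Suc (Suc n))) f \<in> {\<zero>\<^bsub>F (int (Suc n))\<^esub>}"
    using FR.exact_Suc[OF v'] unfolding F.multiples_0 by blast
  then have vf: "v = d (int (Suc (Suc n))) f" using v' FR.\<delta>_in[OF f(1)] by simp
  have f': "f \<in> carrier (F (hh_deg (Suc (Suc n)) 0))" using f(1) by (simp only: hh_deg_simps(2))
  have jf: "incl (Suc (Suc n)) 0 f \<in> carrier (G (Suc (Suc n)))" by (rule module_hom_in[OF incl_hom f'])
  show thesis
  proof (rule that)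
    show "u0 \<oplus>\<^bsub>G (Suc (Suc n))\<^esub> incl (Suc (Suc n)) 0 f \<in> carrier (G (Suc (Suc n)))"
      by (rule G.M.a_closed[OF u0 jf])
    have "D (Suc n) (u0 \<oplus>\<^bsub>G (Suc (Suc n))\<^esub> incl (Suc (Suc n)) 0 f) = c \<oplus>\<^bsub>G (Suc n)\<^esub> (w \<ominus>\<^bsub>G (Suc n)\<^esub> c)"
      unfolding module_hom_add[OF D_hom u0 jf] D_incl_0[OF f(1)] vf[symmetric] wc c_def[symmetric] ..
    also have "\<dots> = w"
      using w c by (metis G.M.a_comm G.M.a_assoc G.M.minus_eq G.M.a_inv_closed G.M.l_neg G.M.r_zero)
    finally show "w = D (Suc n) (u0 \<oplus>\<^bsub>G (Suc (Suc n))\<^esub> incl (Suc (Suc n)) 0 f)" ..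
  qed
qed

text \<open>Summands with index above \<open>n div 2\<close> have negative degree, so the
  decomposition is a finite one into projective modules.\<close>

lemma G_projective: "projective Q (G n)"
proof (rule projective_finite_sum[where I = "{..n div 2}" and F = "\<lambda>i. F (hh_deg n i)" and \<iota> = "incl n" and p = "\<lambda>i w. w i"])
  fix i assume "i \<in> {..n div 2}"
  then have "hh_deg n i = int (n - 2 * i)" by (auto simp: hh_deg_def)
  then show "projective Q (F (hh_deg n i))" using FR.proj by simp
next
  fix w assume w: "w \<in> carrier (G n)"
  have wl: "w l \<in> carrier (F (hh_deg n l))" for l using w by simp
  show "(\<Oplus>\<^bsub>G n\<^esub>i\<in>{..n div 2}. incl n i (w i)) = w"
  proof
    fix l
    have "(\<Oplus>\<^bsub>G n\<^esub>i\<in>{..n div 2}. incl n i (w i)) l = (\<Oplus>\<^bsub>F (hh_deg n l)\<^esub>i\<in>{..n div 2}. incl n i (w i) l)"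
      by (rule G_finsum[OF finite_atMost module_hom_in[OF incl_hom wl]])
    also have "\<dots> = (\<Oplus>\<^bsub>F (hh_deg n l)\<^esub>i\<in>{..n div 2}. if l = i then w l else \<zero>\<^bsub>F (hh_deg n l)\<^esub>)"
      by (rule F.M.finsum_cong') (use wl in \<open>auto simp: incl_def\<close>)
    also have "\<dots> = w l"
    proof (cases "l \<le> n div 2")
      case True
      then show ?thesis
        by (intro F.M.add.finprod_singleton[of l _ "\<lambda>_. w l"]) (use wl in auto)
    next
      case False
      then have "hh_deg n l < 0" by (simp add: hh_deg_def)
      then have z: "w l = \<zero>\<^bsub>F (hh_deg n l)\<^esub>" by (rule G_zero[OF w])
      have "(\<Oplus>\<^bsub>F (hh_deg n l)\<^esub>i\<in>{..n div 2}. if l = i then w l else \<zero>\<^bsub>F (hh_deg n l)\<^esub>) = \<zero>\<^bsub>F (hh_deg n l)\<^esub>"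
        by (rule F.M.add.finprod_one_eqI) (use False in auto)
      then show ?thesis using z by simp
    qed
    finally show "(\<Oplus>\<^bsub>G n\<^esub>i\<in>{..n div 2}. incl n i (w i)) l = w l" .
  qed
qed (auto intro: G_module incl_hom proj_hom)

lemma D_0_0:
  assumes u: "u \<in> carrier (G 1)"
  shows "D 0 u 0 = d 1 (u 0)"
proof -
  have "u 0 \<in> carrier (F (hh_deg (Suc 0) 0))" using u by simp
  then have "\<sigma> 0 1 (u 0) = d 1 (u 0)" "\<sigma> 0 1 (u 0) \<in> carrier (F (hh_deg 0 0))"
    using \<sigma>_0[of "u 0" 1] module_hom_in[OF \<sigma>_hom[of 0 0 0], of "u 0"] by (simp_all add: hh_deg_simps)
  then show ?thesis by (simp add: D_def hh_deg_simps)
qed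

text \<open>In positive degrees \<open>D_exact\<close> gives one direction and \<open>D_D\<close>
  the other. In degree 0 the term is \<open>F 0\<close> alone, and the augmentation is blind to
  multiples of \<open>x\<close> because \<open>x\<close> kills \<open>M\<close>.\<close>

lemma G_resolution: "resolution_mod Q x M G D (\<lambda>w. \<epsilon> (w 0))"
proof -
  have p0: "(\<lambda>w. w 0) \<in> module_hom Q (G 0) (F (int 0))" using proj_hom[where n = 0 and l = 0] by (simp add: hh_deg_simps)
  have i0: "incl 0 0 \<in> module_hom Q (F (int 0)) (G 0)" using incl_hom[where n = 0 and i = 0] by (simp add: hh_deg_simps)
  have G_0: "w = w'" if "w \<in> carrier (G 0)" "w' \<in> carrier (G 0)" "w 0 = w' 0" for w w'
  proof
    fix l
    show "w l = w' l"
    proof (cases l)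
      case (Suc k)
      then have "hh_deg 0 l < 0" by (simp add: hh_deg_def)
      then show ?thesis by (simp only: G_zero[OF that(1)] G_zero[OF that(2)])
    qed (use that in simp)
  qed
  show ?thesis
  proof unfold_locales
    show "(\<lambda>w. \<epsilon> (w 0)) ` carrier (G 0) = carrier M"
    proof (intro equalityI subsetI)
      fix m assume "m \<in> carrier M"
      then obtain v where v: "v \<in> carrier (F (int 0))" "m = \<epsilon> v" using FR.surj by blast
      have "m = \<epsilon> (incl 0 0 v 0)" using v(2) by (simp add: incl_def)
      then show "m \<in> (\<lambda>w. \<epsilon> (w 0)) ` carrier (G 0)"
        using module_hom_in[OF i0 v(1)] by (rule image_eqI)
    qed (use module_hom_in[OF FR.\<epsilon>] module_hom_in[OF p0] in auto)
  next
    fix w assume w: "w \<in> carrier (G 0)"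
    have w0: "w 0 \<in> carrier (F (int 0))" by (rule module_hom_in[OF p0 w])
    show "\<epsilon> (w 0) = \<zero>\<^bsub>M\<^esub> \<longleftrightarrow> (\<exists>u\<in>carrier (G 1). w \<ominus>\<^bsub>G 0\<^esub> D 0 u \<in> multiples Q x (G 0))"
    proof
      assume "\<epsilon> (w 0) = \<zero>\<^bsub>M\<^esub>"
      then obtain f where f: "f \<in> carrier (F (int 1))" "w 0 \<ominus>\<^bsub>F (int 0)\<^esub> d (int (Suc 0)) f \<in> {\<zero>\<^bsub>F (int 0)\<^esub>}"
        using FR.exact_0[OF w0] unfolding F.multiples_0 by blast
      have df: "d (int (Suc 0)) f \<in> carrier (F (int 0))" using FR.\<delta>_in[of f 0] f(1) by simp
      have wf: "w 0 = d (int (Suc 0)) f" using f(2) w0 df by simp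
      have f': "f \<in> carrier (F (hh_deg (Suc 0) 0))" "f \<in> carrier (F (int (Suc 0)))" using f(1) by (simp_all add: hh_deg_simps)
      have j: "incl (Suc 0) 0 f \<in> carrier (G (Suc 0))" by (rule module_hom_in[OF incl_hom f'(1)])
      have "w = D 0 (incl (Suc 0) 0 f)"
        by (rule G_0[OF w D_in[OF j]]) (unfold D_incl_0[OF f'(2)] wf, simp add: incl_def)
      then have "w \<ominus>\<^bsub>G 0\<^esub> D 0 (incl (Suc 0) 0 f) = \<zero>\<^bsub>G 0\<^esub>"
        using w by (metis G.M.minus_eq G.M.r_neg)
      then show "\<exists>u\<in>carrier (G 1). w \<ominus>\<^bsub>G 0\<^esub> D 0 u \<in> multiples Q x (G 0)"
        using j G.multiples_zero_in[OF x_closed] by (intro bexI[of _ "incl (Suc 0) 0 f"]) simp_all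
    next
      assume "\<exists>u\<in>carrier (G 1). w \<ominus>\<^bsub>G 0\<^esub> D 0 u \<in> multiples Q x (G 0)"
      then obtain u where u: "u \<in> carrier (G 1)" "w \<ominus>\<^bsub>G 0\<^esub> D 0 u \<in> multiples Q x (G 0)" by (rule bexE)
      have Du: "D 0 u \<in> carrier (G 0)" using D_in[of u 0] u(1) by simp
      obtain y where y: "y \<in> carrier (G 0)" "w = D 0 u \<oplus>\<^bsub>G 0\<^esub> x \<odot>\<^bsub>G 0\<^esub> y"
        using u(2) G.multiples_diff_iff[OF x_closed w Du] by blast
      have "u 0 \<in> carrier (F (hh_deg (Suc 0) 0))" using u(1) by simp
      then have u0: "u 0 \<in> carrier (F (int (Suc 0)))" by (simp only: hh_deg_simps(2))
      have y0: "y 0 \<in> carrier (F (int 0))" by (rule module_hom_in[OF p0 y(1)])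
      have du: "d (int (Suc 0)) (u 0) \<in> carrier (F (int 0))" by (rule FR.\<delta>_in[OF u0])
      have "w 0 = d (int (Suc 0)) (u 0) \<oplus>\<^bsub>F (int 0)\<^esub> x \<odot>\<^bsub>F (int 0)\<^esub> y 0"
        unfolding y(2) hh_module_simps D_0_0[OF u(1)] by (simp add: hh_deg_simps)
      \<comment> \<open>Both terms vanish: the first because \<open>\<epsilon>\<close> kills
        boundaries of \<open>F\<close>, the second because \<open>x\<close> kills
        \<open>M\<close>.\<close>
      then have "\<epsilon> (w 0) = \<epsilon> (d (int (Suc 0)) (u 0)) \<oplus>\<^bsub>M\<^esub> x \<odot>\<^bsub>M\<^esub> \<epsilon> (y 0)"
        using module_hom_add[OF FR.\<epsilon> du F.smult_closed[OF x_closed y0]] module_hom_smult[OF FR.\<epsilon> x_closed y0] by simp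
      moreover have "\<epsilon> (d (int (Suc 0)) (u 0)) = \<zero>\<^bsub>M\<^esub>"
        using FR.boundary_cycle[OF u0] unfolding FR.cycles_def by simp
      ultimately show "\<epsilon> (w 0) = \<zero>\<^bsub>M\<^esub>"
        using xM[OF module_hom_in[OF FR.\<epsilon> y0]] by simp
    qed
  next
    fix n w assume w: "w \<in> carrier (G (Suc n))"
    show "D n w \<in> multiples Q x (G n) \<longleftrightarrow>
        (\<exists>u\<in>carrier (G (Suc (Suc n))). w \<ominus>\<^bsub>G (Suc n)\<^esub> D (Suc n) u \<in> multiples Q x (G (Suc n)))"
    proof
      assume "D n w \<in> multiples Q x (G n)"
      then obtain u where "u \<in> carrier (G n)" "D n w = x \<odot>\<^bsub>G n\<^esub> u" unfolding multiples_def by (rule imageE)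
      with w obtain w' where w': "w' \<in> carrier (G (Suc (Suc n)))" "w = D (Suc n) w'" by (rule D_exact)
      have "w \<ominus>\<^bsub>G (Suc n)\<^esub> D (Suc n) w' = \<zero>\<^bsub>G (Suc n)\<^esub>"
        using w w'(2) by (metis G.M.minus_eq G.M.r_neg)
      then show "\<exists>u\<in>carrier (G (Suc (Suc n))). w \<ominus>\<^bsub>G (Suc n)\<^esub> D (Suc n) u \<in> multiples Q x (G (Suc n))"
        using w'(1) G.multiples_zero_in[OF x_closed] by (intro bexI[of _ w']) simp_all
    next
      assume "\<exists>u\<in>carrier (G (Suc (Suc n))). w \<ominus>\<^bsub>G (Suc n)\<^esub> D (Suc n) u \<in> multiples Q x (G (Suc n))"
      then obtain u where u: "u \<in> carrier (G (Suc (Suc n)))" "w \<ominus>\<^bsub>G (Suc n)\<^esub> D (Suc n) u \<in> multiples Q x (G (Suc n))"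
        by (rule bexE)
      have Du: "D (Suc n) u \<in> carrier (G (Suc n))" by (rule D_in[OF u(1)])
      have "D n (w \<ominus>\<^bsub>G (Suc n)\<^esub> D (Suc n) u) \<in> multiples Q x (G n)"
        by (rule multiples_hom[OF D_hom x_closed u(2)])
      then have 1: "D n w \<ominus>\<^bsub>G n\<^esub> D n (D (Suc n) u) \<in> multiples Q x (G n)"
        unfolding module_hom_minus[OF G_module G_module D_hom w Du] .
      have "u (Suc l) \<in> carrier (F (hh_deg (Suc (Suc n)) (Suc l)))" for l using u(1) by simp
      then have "(\<lambda>l. u (Suc l)) \<in> carrier (G n)"
        unfolding hh_module_simps hh_deg_simps(1) by (rule allI)
      \<comment> \<open>By \<open>D_D\<close> this is \<open>x\<close> times the tail of
        \<open>u\<close>, and that tail is an element of \<open>G n\<close>.\<close>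
      then have 2: "D n (D (Suc n) u) \<in> multiples Q x (G n)"
        unfolding D_D[OF u(1)] multiples_def by (intro image_eqI[of _ _ "\<lambda>l. u (Suc l)"]) simp_all
      have "D n w = (D n w \<ominus>\<^bsub>G n\<^esub> D n (D (Suc n) u)) \<oplus>\<^bsub>G n\<^esub> D n (D (Suc n) u)"
        using D_in[OF w] D_in[OF Du] by (metis G.M.a_assoc G.M.minus_eq G.M.a_inv_closed G.M.l_neg G.M.r_zero)
      then show "D n w \<in> multiples Q x (G n)"
        using G.multiples_add[OF x_closed 1 2] by metis
    qed
  qed (use G_projective D_hom x_closed module_hom_compose[OF p0 FR.\<epsilon>] in auto)
qed

end

text \<open>In degrees above \<open>r\<close> the differential of \<open>G \<otimes> N\<close> is the direct sum of those of \<open>F \<otimes> N\<close>. Hence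
  a cycle of \<open>F \<otimes> N\<close>, placed in the summand with index \<open>i\<close>, is a cycle of \<open>G \<otimes> N\<close>, and projecting
  back to this summand turns a bounding chain into one in \<open>F \<otimes> N\<close>.\<close>

lemma (in hh_resolution) tensor_exact_component:
  assumes N: "module Q N"
    and van: "\<And>j k t. j \<ge> 1 \<Longrightarrow> k > r - (2 * int j - 1) \<Longrightarrow> t \<in> carrier (tensor Q (F k) N) \<Longrightarrow>
      tensor_map Q (F (k + 2 * int j - 1)) N (\<sigma> j k) t = \<zero>\<^bsub>tensor Q (F (k + 2 * int j - 1)) N\<^esub>"
    and m: "int m > r \<or> r = 0 \<and> m = 0"
    and ex: "tensor_exact Q N G D (m + 2 * i)"
  shows "tensor_exact Q N (\<lambda>n. F (int n)) (\<lambda>n. d (int (Suc n))) m"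
proof -
  let ?n = "m + 2 * i"
  \<comment> \<open>Pre-rigidity rewritten in terms of the target: \<open>hh_deg n l\<close> is the
    degree in which \<open>\<sigma> j\<close> ends.\<close>
  have van': "tensor_map Q (F (hh_deg n l)) N (\<sigma> j (hh_deg (Suc n) (l + j))) t = \<zero>\<^bsub>tensor Q (F (hh_deg n l)) N\<^esub>"
    if "j \<ge> 1" "hh_deg n l > r" "t \<in> carrier (tensor Q (F (hh_deg (Suc n) (l + j))) N)" for n l j t
  proof -
    have "hh_deg (Suc n) (l + j) + 2 * int j - 1 = hh_deg n l" by (simp add: hh_deg_def)
    moreover have "hh_deg (Suc n) (l + j) > r - (2 * int j - 1)" using that(2) by (simp add: hh_deg_def)
    ultimately show ?thesis using van[OF that(1) _ that(3)] by simp
  qed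
  have deg_m: "hh_deg ?n i = int m" by (rule hh_deg_simps(3))
  interpret TF: tensor_product Q "F j" N for j using F_module N by (rule tensor_product.intro)
  interpret TG: tensor_product Q "G j" N for j using G_module N by (rule tensor_product.intro)
  show ?thesis unfolding tensor_exact_def
  proof (intro ballI impI)
    fix z assume z: "z \<in> carrier (tensor Q (F (int m)) N)"
      and cyc: "\<forall>k. m = Suc k \<longrightarrow> tensor_map Q (F (int k)) N (d (int (Suc k))) z = \<zero>\<^bsub>tensor Q (F (int k)) N\<^esub>"
    have z': "z \<in> carrier (tensor Q (F (hh_deg ?n i)) N)" using z unfolding deg_m .
    let ?z = "tensor_map Q (G ?n) N (incl ?n i) z"
    have Z: "?z \<in> carrier (tensor Q (G ?n) N)"
      by (rule tensor_map_closed[OF F_module G_module N incl_hom z'])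
    have "tensor_map Q (G k) N (D k) ?z = \<zero>\<^bsub>tensor Q (G k) N\<^esub>" if k: "?n = Suc k" for k
    proof -
      let ?s = "hh_deg (Suc k) i"
      have s: "?s = int m" using deg_m k by simp
      have zk: "z \<in> carrier (tensor Q (F ?s) N)" using z unfolding s .
      have \<sigma>h: "\<sigma> j ?s \<in> module_hom Q (F ?s) (F (hh_deg k (i - j)))" if "j \<le> i" for j
        using \<sigma>_hom[of j k "i - j"] that by simp
      have \<sigma>z: "tensor_map Q (F (hh_deg k (i - j))) N (\<sigma> j ?s) z = \<zero>\<^bsub>tensor Q (F (hh_deg k (i - j))) N\<^esub>" if j: "j \<le> i" for j
      proof (cases "j = 0")
        case True
        show ?thesis
        proof (cases m)
          case 0
          \<comment> \<open>For \<open>m = 0\<close> the component of \<open>\<sigma> 0\<close> ends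
            in degree -1.\<close>
          then have "hh_deg k (i - j) < 0" using s True by (simp add: hh_deg_def)
          then have "zero_module (tensor Q (F (hh_deg k (i - j))) N)"
            by (rule tensor_zero_module[OF F_module N F_neg])
          then show ?thesis by (rule zero_moduleD) (rule tensor_map_closed[OF F_module F_module N \<sigma>h[OF j] zk])
        next
          case (Suc p)
          have e: "hh_deg k (i - j) = int p" "?s = int (Suc p)" using s True Suc by (simp_all add: hh_deg_def)
          have zp: "z \<in> carrier (tensor Q (F (int (Suc p))) N)" using zk unfolding e(2) .
          have h: "\<sigma> j (int (Suc p)) \<in> module_hom Q (F (int (Suc p))) (F (int p))" using \<sigma>h[OF j] unfolding e .
          have "tensor_map Q (F (int p)) N (\<sigma> j (int (Suc p))) z = tensor_map Q (F (int p)) N (d (int (Suc p))) z"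
            by (rule tensor_map_cong[OF F_module F_module N h FR.\<delta> _ zp]) (simp only: True \<sigma>_0)
          also have "\<dots> = \<zero>\<^bsub>tensor Q (F (int p)) N\<^esub>" using cyc Suc by blast
          finally show ?thesis unfolding e .
        qed
      next
        case False
        \<comment> \<open>The target degree is \<open>m + 2 j - 1\<close>, which is at least
          \<open>m + 1\<close>. So it exceeds \<open>r\<close> also when
          \<open>m = r = 0\<close>.\<close>
        have "hh_deg k (i - j) > r" using s m j False by (auto simp: hh_deg_def of_nat_diff)
        moreover have "i - j + j = i" using j by simp
        ultimately show ?thesis using van'[of j k "i - j" z] False zk by simp
      qed
      have summand: "(\<lambda>v. incl k (i - j) (\<sigma> j ?s v)) \<in> module_hom Q (F ?s) (G k)" if "j \<in> {..i}" for j
        using that by (intro module_hom_compose[OF \<sigma>h incl_hom]) simp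
      have D_incl_sum: "D k (incl (Suc k) i v) = (\<Oplus>\<^bsub>G k\<^esub>j\<in>{..i}. incl k (i - j) (\<sigma> j ?s v))" if v: "v \<in> carrier (F ?s)" for v
      proof
        fix l
        have \<sigma>v: "\<sigma> j ?s v \<in> carrier (F (hh_deg k (i - j)))" if "j \<le> i" for j by (rule module_hom_in[OF \<sigma>h[OF that] v])
        have "(\<Oplus>\<^bsub>G k\<^esub>j\<in>{..i}. incl k (i - j) (\<sigma> j ?s v)) l = (\<Oplus>\<^bsub>F (hh_deg k l)\<^esub>j\<in>{..i}. incl k (i - j) (\<sigma> j ?s v) l)"
          by (rule G_finsum[OF finite_atMost module_hom_in[OF summand v]])
        also have "\<dots> = (if l \<le> i then \<sigma> (i - l) ?s v else \<zero>\<^bsub>F (hh_deg k l)\<^esub>)"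
        proof (cases "l \<le> i")
          case True
          then have \<sigma>l: "\<sigma> (i - l) ?s v \<in> carrier (F (hh_deg k l))" using \<sigma>v[of "i - l"] by simp
          have "(\<Oplus>\<^bsub>F (hh_deg k l)\<^esub>j\<in>{..i}. incl k (i - j) (\<sigma> j ?s v) l)
              = (\<Oplus>\<^bsub>F (hh_deg k l)\<^esub>j\<in>{..i}. if i - l = j then \<sigma> (i - l) ?s v else \<zero>\<^bsub>F (hh_deg k l)\<^esub>)"
            by (rule F.M.finsum_cong') (use True \<sigma>l in \<open>auto simp: incl_def\<close>)
          also have "\<dots> = \<sigma> (i - l) ?s v"
            by (rule F.M.add.finprod_singleton[of "i - l" _ "\<lambda>_. \<sigma> (i - l) ?s v"]) (use \<sigma>l in auto)
          finally show ?thesis using True by simp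
        next
          case False
          have "(\<Oplus>\<^bsub>F (hh_deg k l)\<^esub>j\<in>{..i}. incl k (i - j) (\<sigma> j ?s v) l) = \<zero>\<^bsub>F (hh_deg k l)\<^esub>"
            by (rule F.M.add.finprod_one_eqI) (use False in \<open>auto simp: incl_def\<close>)
          then show ?thesis using False by simp
        qed
        also have "\<dots> = D k (incl (Suc k) i v) l" by (rule D_incl[OF v, symmetric])
        finally show "D k (incl (Suc k) i v) l = (\<Oplus>\<^bsub>G k\<^esub>j\<in>{..i}. incl k (i - j) (\<sigma> j ?s v)) l" ..
      qed
      have "tensor_map Q (G k) N (D k) (tensor_map Q (G (Suc k)) N (incl (Suc k) i) z)
          = tensor_map Q (G k) N (\<lambda>v. D k (incl (Suc k) i v)) z"
        by (rule tensor_map_compose[OF F_module G_module G_module N incl_hom D_hom zk])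
      also have "\<dots> = tensor_map Q (G k) N (\<lambda>v. \<Oplus>\<^bsub>G k\<^esub>j\<in>{..i}. incl k (i - j) (\<sigma> j ?s v)) z"
        by (rule tensor_map_cong[OF F_module G_module N module_hom_compose[OF incl_hom D_hom]
              module_hom_finsum_fun[OF G_module finite_atMost summand] D_incl_sum zk])
      also have "\<dots> = (\<Oplus>\<^bsub>tensor Q (G k) N\<^esub>j\<in>{..i}. tensor_map Q (G k) N (\<lambda>v. incl k (i - j) (\<sigma> j ?s v)) z)"
        by (rule tensor_map_finsum[OF F_module G_module N finite_atMost summand zk])
      also have "\<dots> = \<zero>\<^bsub>tensor Q (G k) N\<^esub>"
      proof (rule TG.T.M.add.finprod_one_eqI)
        fix j assume "j \<in> {..i}"
        then have j: "j \<le> i" by simp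
        have "tensor_map Q (G k) N (\<lambda>v. incl k (i - j) (\<sigma> j ?s v)) z
            = tensor_map Q (G k) N (incl k (i - j)) (tensor_map Q (F (hh_deg k (i - j))) N (\<sigma> j ?s) z)"
          by (rule tensor_map_compose[OF F_module F_module G_module N \<sigma>h[OF j] incl_hom zk, symmetric])
        also have "\<dots> = \<zero>\<^bsub>tensor Q (G k) N\<^esub>"
          unfolding \<sigma>z[OF j] by (rule tensor_map_zero[OF F_module G_module N incl_hom])
        finally show "tensor_map Q (G k) N (\<lambda>v. incl k (i - j) (\<sigma> j ?s v)) z = \<zero>\<^bsub>tensor Q (G k) N\<^esub>" .
      qed
      finally show ?thesis unfolding k .
    qed
    then obtain W where W: "W \<in> carrier (tensor Q (G (Suc ?n)) N)" "?z = tensor_map Q (G ?n) N (D ?n) W"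
      using ex[unfolded tensor_exact_def, rule_format, OF Z] by metis
    let ?t = "\<lambda>j. tensor_map Q (F (hh_deg ?n i)) N (\<lambda>w. \<sigma> j (hh_deg (Suc ?n) (i + j)) (w (i + j))) W"
    let ?p = "\<lambda>l. tensor_map Q (F (hh_deg (Suc ?n) l)) N (\<lambda>w. w l) W"
    \<comment> \<open>The component of the bounding chain in degree \<open>m + 1\<close>, written
      with \<open>i + 0\<close> to match the term of \<open>D\<close> for
      \<open>j = 0\<close>.\<close>
    define u where "u = ?p (i + 0)"
    have p: "?p l \<in> carrier (tensor Q (F (hh_deg (Suc ?n) l)) N)" for l
      by (rule tensor_map_closed[OF G_module F_module N proj_hom W(1)])
    have t: "?t j = tensor_map Q (F (hh_deg ?n i)) N (\<sigma> j (hh_deg (Suc ?n) (i + j))) (?p (i + j))" for j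
      by (rule tensor_map_compose[OF G_module F_module F_module N proj_hom \<sigma>_hom W(1), symmetric])
    have t_in: "?t j \<in> carrier (tensor Q (F (hh_deg ?n i)) N)" for j
      by (rule tensor_map_closed[OF G_module F_module N term_hom W(1)])
    have t_zero: "?t j = \<zero>\<^bsub>tensor Q (F (hh_deg ?n i)) N\<^esub>" if j: "j \<ge> 1" for j
    proof (cases "int m > r")
      case True
      then show ?thesis unfolding t using j p by (intro van') (simp_all only: deg_m)
    next
      case False
      \<comment> \<open>Here \<open>m = r = 0\<close>, out of reach of pre-rigidity. The source has
        degree \<open>1 - 2 j\<close>, which is negative.\<close>
      then have "hh_deg (Suc ?n) (i + j) < 0" using m j by (simp add: hh_deg_def)
      then have "zero_module (tensor Q (F (hh_deg (Suc ?n) (i + j))) N)"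
        by (rule tensor_zero_module[OF F_module N F_neg])
      then have "?p (i + j) = \<zero>\<^bsub>tensor Q (F (hh_deg (Suc ?n) (i + j))) N\<^esub>" using p by (rule zero_moduleD)
      then show ?thesis unfolding t by (simp only: tensor_map_zero[OF F_module F_module N \<sigma>_hom])
    qed
    \<comment> \<open>Including \<open>z\<close> in summand \<open>i\<close> and projecting back is
      the identity; in between, the included cycle is replaced by the boundary of
      \<open>W\<close>.\<close>
    have "z = tensor_map Q (F (hh_deg ?n i)) N (\<lambda>v. v) z" by (rule tensor_map_id[OF F_module N z', symmetric])
    also have "\<dots> = tensor_map Q (F (hh_deg ?n i)) N (\<lambda>v. incl ?n i v i) z"
      by (rule tensor_map_cong[OF F_module F_module N module_hom_id module_hom_compose[OF incl_hom proj_hom] _ z'])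
        (simp add: incl_def)
    also have "\<dots> = tensor_map Q (F (hh_deg ?n i)) N (\<lambda>w. w i) ?z"
      by (rule tensor_map_compose[OF F_module G_module F_module N incl_hom proj_hom z', symmetric])
    also have "\<dots> = tensor_map Q (F (hh_deg ?n i)) N (\<lambda>w. D ?n w i) W"
      unfolding W(2) by (rule tensor_map_compose[OF G_module G_module F_module N D_hom proj_hom W(1)])
    also have "\<dots> = (\<Oplus>\<^bsub>tensor Q (F (hh_deg ?n i)) N\<^esub>j\<in>{..?n}. ?t j)"
      unfolding D_def by (rule tensor_map_finsum[OF G_module F_module N finite_atMost term_hom W(1)])
    also have "\<dots> = (\<Oplus>\<^bsub>tensor Q (F (hh_deg ?n i)) N\<^esub>j\<in>{..?n}. if 0 = j then ?t 0 else \<zero>\<^bsub>tensor Q (F (hh_deg ?n i)) N\<^esub>)"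
      by (rule TF.T.M.finsum_cong') (use t_in t_in[of 0] t_zero in auto)
    also have "\<dots> = ?t 0"
      by (rule TF.T.M.add.finprod_singleton[of 0 _ "\<lambda>_. ?t 0"]) (use t_in[of 0] in auto)
    also have "\<dots> = tensor_map Q (F (hh_deg ?n i)) N (\<sigma> 0 (hh_deg (Suc ?n) (i + 0))) (?p (i + 0))"
      by (rule t)
    finally have zt: "z = tensor_map Q (F (int m)) N (\<sigma> 0 (hh_deg (Suc ?n) (i + 0))) u"
      unfolding deg_m u_def .
    have e: "hh_deg (Suc ?n) (i + 0) = int (Suc m)" by (simp add: hh_deg_def)
    have u: "u \<in> carrier (tensor Q (F (int (Suc m))) N)" using p[of "i + 0", folded u_def] unfolding e .
    have h: "\<sigma> 0 (int (Suc m)) \<in> module_hom Q (F (int (Suc m))) (F (int m))"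
      using \<sigma>_hom[of 0 ?n i] unfolding deg_m e .
    have "z = tensor_map Q (F (int m)) N (d (int (Suc m))) u"
      using zt[unfolded e] tensor_map_cong[OF F_module F_module N h FR.\<delta> \<sigma>_0 u] by (rule trans)
    then show "\<exists>w\<in>carrier (tensor Q (F (int (Suc m))) N). z = tensor_map Q (F (int m)) N (d (int (Suc m))) w"
      using u by (rule bexI)
  qed
qed

section \<open>Vanishing of Tor\<close>

lemma (in module) standard_res_module: "module R (standard_res R M j)"
  unfolding standard_res_def by (rule free_on_module)

lemma (in module) standard_res_neg: "j < 0 \<Longrightarrow> zero_module (standard_res R M j)"
  using standard_res_free_resolution by (simp add: free_resolution_def)

lemma (in module) standard_res_nat: "standard_res R M (int n) = free_on R (cells R M n)"
  by (simp add: standard_res_def)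

lemma (in module) Tor_neg:
  assumes "module R N" "j < 0"
  shows "zero_module (Tor R M N j)"
  unfolding Tor_def
  by (rule tensor_homology_neg[where F = "standard_res R M" and d = "standard_diff R", OF assms(1) standard_res_module standard_res_neg standard_diff_hom assms(2)])

lemma (in module) Tor_nat:
  assumes "module R N"
  shows "zero_module (Tor R M N (int n)) \<longleftrightarrow>
    tensor_exact R N (\<lambda>n. standard_res R M (int n)) (\<lambda>n. standard_diff R (int (Suc n))) n"
  unfolding Tor_def
  by (rule tensor_homology_nat[where F = "standard_res R M" and d = "standard_diff R", OF assms standard_res_module standard_res_neg standard_diff_hom])

lemma quotient_reduction:
  fixes Q :: "'a ring"
  assumes Q: "cring Q" and x: "x \<in> carrier Q"
  obtains \<rho> where "reduction Q (Q Quot (PIdl\<^bsub>Q\<^esub> x)) x (\<lambda>q. PIdl\<^bsub>Q\<^esub> x +>\<^bsub>Q\<^esub> q) \<rho>"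
proof -
  interpret Q: cring Q by fact
  let ?I = "PIdl\<^bsub>Q\<^esub> x" and ?R = "Q Quot (PIdl\<^bsub>Q\<^esub> x)" and ?\<pi> = "\<lambda>q. PIdl\<^bsub>Q\<^esub> x +>\<^bsub>Q\<^esub> q"
  interpret I: ideal ?I Q by (rule Q.cgenideal_ideal[OF x])
  have R: "cring ?R" by (rule I.quotient_is_cring[OF Q])
  have zero: "\<zero>\<^bsub>?R\<^esub> = ?I" by (simp add: FactRing_def)
  have surj: "\<exists>q\<in>carrier Q. ?\<pi> q = a" if "a \<in> carrier ?R" for a
    using that by (auto simp: FactRing_def A_RCOSETS_def')
  have ker: "?\<pi> q = ?I \<longleftrightarrow> q \<in> ?I" if "q \<in> carrier Q" for q
    using I.a_rcos_self[OF that] Q.a_coset_join2[OF that I.a_subgroup] by blast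
  \<comment> \<open>An arbitrary choice of representatives need not send the zero class to zero, so
    this value is set separately.\<close>
  define \<rho> where "\<rho> a = (if a = ?I then \<zero>\<^bsub>Q\<^esub> else (SOME q. q \<in> carrier Q \<and> ?\<pi> q = a))" for a
  have \<rho>: "\<rho> a \<in> carrier Q \<and> ?\<pi> (\<rho> a) = a" if a: "a \<in> carrier ?R" for a
  proof (cases "a = ?I")
    case True
    then show ?thesis using ker[of "\<zero>\<^bsub>Q\<^esub>"] by (simp add: \<rho>_def)
  next
    case False
    have "\<exists>q. q \<in> carrier Q \<and> ?\<pi> q = a" using surj[OF a] by blast
    then show ?thesis unfolding \<rho>_def if_not_P[OF False] by (rule someI_ex)
  qed
  have "reduction Q ?R x ?\<pi> \<rho>"
  proof (intro reduction.intro reduction_axioms.intro Q R x)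
    show "?\<pi> \<in> ring_hom Q ?R" by (rule I.rcos_ring_hom)
    show "?\<pi> q = \<zero>\<^bsub>?R\<^esub> \<longleftrightarrow> (\<exists>y\<in>carrier Q. q = x \<otimes>\<^bsub>Q\<^esub> y)" if q: "q \<in> carrier Q" for q
    proof -
      have "?\<pi> q = \<zero>\<^bsub>?R\<^esub> \<longleftrightarrow> q \<in> ?I" unfolding zero by (rule ker[OF q])
      also have "\<dots> \<longleftrightarrow> (\<exists>y\<in>carrier Q. q = x \<otimes>\<^bsub>Q\<^esub> y)"
      proof -
        have "q \<in> ?I \<longleftrightarrow> (\<exists>y\<in>carrier Q. q = y \<otimes>\<^bsub>Q\<^esub> x)" unfolding cgenideal_def by blast
        also have "\<dots> \<longleftrightarrow> (\<exists>y\<in>carrier Q. q = x \<otimes>\<^bsub>Q\<^esub> y)"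
          by (rule bex_cong) (simp_all only: Q.m_comm[OF x])
        finally show ?thesis .
      qed
      finally show ?thesis .
    qed
    show "\<rho> \<zero>\<^bsub>?R\<^esub> = \<zero>\<^bsub>Q\<^esub>" by (simp add: \<rho>_def zero)
  qed (use \<rho> in auto)
  then show thesis by (rule that)
qed

theorem theorem4p4:
  fixes Q :: "'a ring" and \<nn> :: "'a set" and x :: 'a
    and R :: "'a set ring" and \<pi> :: "'a \<Rightarrow> 'a set"
    and M :: "('a set, 'm) module" and N :: "('a set, 'n) module"
    and r n :: int
  assumes Q: "local_ring Q \<nn>"
    and x: "x \<in> \<nn>" "nonzerodivisor Q x"
    and R: "R = Q Quot (PIdl\<^bsub>Q\<^esub> x)" "\<pi> = (\<lambda>q. PIdl\<^bsub>Q\<^esub> x +>\<^bsub>Q\<^esub> q)"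
    and M: "fg_module R M" "\<not> zero_module M"
    and N: "module R N" "pre_rigid TYPE('f) Q x M N r"
    and Tor: "n > r" "zero_module (Tor R M N n)"
  shows "(\<forall>i::nat. n - 2 * int i > r \<longrightarrow>
            zero_module (Tor Q (restrict_scalars \<pi> M) (restrict_scalars \<pi> N) (n - 2 * int i))) \<and>
         (r = 0 \<longrightarrow> (\<forall>i::nat.
            zero_module (Tor Q (restrict_scalars \<pi> M) (restrict_scalars \<pi> N) (n - 2 * int i))))"
proof -
  have cring: "cring Q" using Q by (simp add: local_ring_def)
  have xQ: "x \<in> carrier Q" using x(2) by (simp add: nonzerodivisor_def)
  obtain \<rho> where "reduction Q R x \<pi> \<rho>"
    using quotient_reduction[OF cring xQ] unfolding R by blast
  then interpret red: reduction Q R x \<pi> \<rho> .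
  have "module R M" using M(1) by (simp add: fg_module_def)
  then interpret M: module R M .
  interpret N: module R N by (rule N(1))
  let ?M = "restrict_scalars \<pi> M" and ?N = "restrict_scalars \<pi> N"
  interpret M': module Q ?M by (rule red.restrict_module[OF M.module_M])
  interpret N': module Q ?N by (rule red.restrict_module[OF N.module_M])
  have xM: "x \<odot>\<^bsub>?M\<^esub> v = \<zero>\<^bsub>?M\<^esub>" if "v \<in> carrier ?M" for v
    using red.restrict_kill[OF M.module_M] that by simp
  have xN: "x \<odot>\<^bsub>?N\<^esub> v = \<zero>\<^bsub>?N\<^esub>" if "v \<in> carrier ?N" for v
    using red.restrict_kill[OF N.module_M] that by simp
  obtain F :: "int \<Rightarrow> ('a, 'f) module" and d \<sigma>
    where F: "free_resolution Q ?M F d" and hh: "higher_homotopies Q x F d \<sigma>"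
      and van: "\<forall>i\<ge>1. \<forall>j > r - (2 * int i - 1). \<forall>t\<in>carrier (tensor Q (F j) ?N).
        tensor_map Q (F (j + 2 * int i - 1)) ?N (\<sigma> i j) t = \<zero>\<^bsub>tensor Q (F (j + 2 * int i - 1)) ?N\<^esub>"
    using N(2) unfolding pre_rigid_def Let_def R(2)[symmetric] by blast
  obtain \<epsilon> where \<epsilon>: "resolution_mod Q \<zero>\<^bsub>Q\<^esub> ?M (\<lambda>n. F (int n)) (\<lambda>n. d (int (Suc n))) \<epsilon>"
    using free_resolution_resolution_mod[OF M'.module_M F] .
  have "hh_resolution Q x ?M F d \<sigma> \<epsilon>"
  proof (intro hh_resolution.intro hh_resolution_axioms.intro M'.module_M x(2) xM \<epsilon> hh)
    show "module Q (F j)" "j < 0 \<Longrightarrow> zero_module (F j)" for j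
      using F by (auto simp: free_resolution_def free_module_def)
  qed
  then interpret G: hh_resolution Q x ?M F d \<sigma> \<epsilon> .
  \<comment> \<open>The exceptional degree 0 for \<open>r = 0\<close> is treated together with the
    degrees above \<open>r\<close>. Negative degrees can occur when \<open>r\<close> is negative and
    are trivial.\<close>
  have zero: "zero_module (Tor Q ?M ?N (n - 2 * int i))" if i: "n - 2 * int i > r \<or> r = 0 \<and> n - 2 * int i = 0" for i
  proof (cases "n - 2 * int i < 0")
    case True
    then show ?thesis by (rule M'.Tor_neg[OF N'.module_M])
  next
    case False
    define m where "m = nat (n - 2 * int i)"
    \<comment> \<open>\<open>F m\<close> is the summand of \<open>G n\<close> with index
      \<open>i\<close>, so vanishing in the single degree \<open>n\<close> reaches all the degrees
      \<open>n - 2 i\<close> concerned.\<close>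
    have m: "n - 2 * int i = int m" "n = int (m + 2 * i)" using False by (simp_all add: m_def)
    obtain \<epsilon>R where "resolution_mod R \<zero>\<^bsub>R\<^esub> M (\<lambda>n. standard_res R M (int n)) (\<lambda>n. standard_diff R (int (Suc n))) \<epsilon>R"
      using free_resolution_resolution_mod[OF M.module_M M.standard_res_free_resolution] .
    then have resR: "resolution_mod R \<zero>\<^bsub>R\<^esub> M (\<lambda>n. free_on R (cells R M n)) (\<lambda>n. standard_diff R (int (Suc n))) \<epsilon>R"
      unfolding M.standard_res_nat .
    then interpret SR: resolution_mod R "\<zero>\<^bsub>R\<^esub>" M "\<lambda>n. free_on R (cells R M n)" "\<lambda>n. standard_diff R (int (Suc n))" \<epsilon>R .
    have "tensor_exact R N (\<lambda>n. free_on R (cells R M n)) (\<lambda>n. standard_diff R (int (Suc n))) (m + 2 * i)"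
      using Tor(2) unfolding m(2) M.Tor_nat[OF N.module_M] M.standard_res_nat .
    note ex = red.lift_tensor_exact[OF N.module_M SR.\<delta> this]
    \<comment> \<open>\<open>G\<close> and the lifted standard resolution over \<open>R\<close> both
      resolve \<open>M\<close> modulo \<open>x\<close>, so vanishing passes to
      \<open>G\<close>.\<close>
    interpret GP: resolution_mod_pair Q x ?M G.G G.D "\<lambda>w. \<epsilon> (w 0)" "\<lambda>n. free_on Q (cells R M n)"
        "\<lambda>n. red.lft_hom (cells R M n) (standard_diff R (int (Suc n)))" "\<lambda>c. \<epsilon>R (red.red c)"
      by (rule resolution_mod_pair.intro[OF G.G_resolution red.lift_resolution[OF resR]])
    have "tensor_exact Q ?N G.G G.D (m + 2 * i)"
      by (rule GP.tensor_exact_transfer[OF N'.module_M xN ex])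
    then have exF: "tensor_exact Q ?N (\<lambda>n. F (int n)) (\<lambda>n. d (int (Suc n))) m"
      by (rule G.tensor_exact_component[OF N'.module_M, rotated 2]) (use van i m(1) in auto)
    obtain \<epsilon>Q where \<epsilon>Q: "resolution_mod Q \<zero>\<^bsub>Q\<^esub> ?M (\<lambda>n. standard_res Q ?M (int n)) (\<lambda>n. standard_diff Q (int (Suc n))) \<epsilon>Q"
      using free_resolution_resolution_mod[OF M'.module_M M'.standard_res_free_resolution] .
    \<comment> \<open>With modulus \<open>\<zero>\<close> the comparison is the independence of Tor
      over \<open>Q\<close> from the resolution, and the condition that the modulus kill
      \<open>N\<close> is trivial.\<close>
    interpret QF: resolution_mod_pair Q "\<zero>\<^bsub>Q\<^esub>" ?M "\<lambda>n. standard_res Q ?M (int n)" "\<lambda>n. standard_diff Q (int (Suc n))" \<epsilon>Q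
        "\<lambda>n. F (int n)" "\<lambda>n. d (int (Suc n))" \<epsilon>
      by (rule resolution_mod_pair.intro[OF \<epsilon>Q \<epsilon>])
    have "tensor_exact Q ?N (\<lambda>n. standard_res Q ?M (int n)) (\<lambda>n. standard_diff Q (int (Suc n))) m"
      by (rule QF.tensor_exact_transfer[OF N'.module_M N'.smult_l_null exF])
    then show ?thesis unfolding m(1) M'.Tor_nat[OF N'.module_M] .
  qed
  moreover have "zero_module (Tor Q ?M ?N (n - 2 * int i))" if "r = 0" for i
  proof (cases "n - 2 * int i < 0")
    case True
    then show ?thesis by (rule M'.Tor_neg[OF N'.module_M])
  next
    case False
    \<comment> \<open>For \<open>r = 0\<close> a nonnegative degree either exceeds \<open>r\<close>
      or equals 0, and \<open>zero\<close> covers both.\<close>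
    then show ?thesis using that by (intro zero) auto
  qed
  ultimately show ?thesis by blast
qed

end
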